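(* Let $G$ be a distance-regular graph with valency (degree) $k > 2$ and diameter $D \geq 3$. For $1 \le j \le D$ let $d_j$ denote the electric resistance between any two vertices of $G$ at distance $j$. Then $$\max_{1\le j\le D} d_j = d_D < \left(1+\frac{6}{k}\right) d_1 .$$
   Context: All graphs are finite, undirected and simple. A connected graph $G$ with diameter $D$ is distance-regular if there are integers $b_i, c_i$ ($0\le i\le D$) such that for any two vertices $x,y$ at graph distance $i$, exactly $c_i$ neighbours of $y$ are at distance $i-1$ from $x$ and exactly $b_i$ neighbours of $y$ are at distance $i+1$ from $x$. Such a graph is regular of valency $k=b_0$. Electric resistance: regard $G$ as an electric circuit in which each edge is a wire of resistance $1$. For distinct vertices $u,v$, let $f$ be a function on the vertices that is harmonic (i.e. $\sum_{x\sim z}(f(x)-f(z))=0$) at every $z\ne u,v$, with $f(u)\neq f(v)$; the resistance between $u$ and $v$ is $\dfrac{f(u)-f(v)}{\sum_{x\sim u}(f(u)-f(x))}$. In a distance-regular graph this depends only on the distance $j=d(u,v)$, and is denoted $d_j$. *)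

theory Defs
  imports Complex_Main "Graph_Theory.Graph_Theory"
begin

text \<open>
  A finite, undirected, simple graph is a \<open>pair_graph\<close>: a finite vertex set together with
  a finite symmetric irreflexive relation on it, so that every undirected edge is represented
  by both of its orientations.
\<close>

definition neighbours :: "'a pair_pre_digraph \<Rightarrow> 'a \<Rightarrow> 'a set" where
  "neighbours G z = {x. (z, x) \<in> parcs G}"

definition regular_of_valency :: "'a pair_pre_digraph \<Rightarrow> nat \<Rightarrow> bool" where
  "regular_of_valency G k \<longleftrightarrow> (\<forall>z \<in> pverts G. card (neighbours G z) = k)"

text \<open>
  The library only has the extended-real shortest-path cost \<open>\<mu>\<close> of weighted graphs; the
  lemma \<open>graph_dist_eq_\<mu>\<close> below relates it to this distance.  The value is meaningful only
  when \<open>v\<close> is reachable from \<open>u\<close>.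
\<close>

definition graph_dist :: "'a pair_pre_digraph \<Rightarrow> 'a \<Rightarrow> 'a \<Rightarrow> nat" where
  "graph_dist G u v = (LEAST n. \<exists>p. pre_digraph.awalk (with_proj G) u p v \<and> length p = n)"

definition graph_diameter :: "'a pair_pre_digraph \<Rightarrow> nat" where
  "graph_diameter G = Max {graph_dist G u v | u v. u \<in> pverts G \<and> v \<in> pverts G}"

lemma graph_dist_eq_\<mu>:
  assumes "pair_wf_digraph G" and "u \<rightarrow>\<^sup>*\<^bsub>with_proj G\<^esub> v"
  shows "wf_digraph.\<mu> (with_proj G) (\<lambda>_. 1) u v = ereal (real (graph_dist G u v))"
proof -
  interpret pair_wf_digraph G by fact
  have cost: "awalk_cost (\<lambda>_. 1) p = real (length p)" for p
    by (induction p) auto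
  have "\<exists>n p. awalk u p v \<and> length p = n"
    using assms(2) by (auto simp: reachable_awalk)
  from LeastI_ex[OF this] obtain p where p: "awalk u p v" "length p = graph_dist G u v"
    unfolding graph_dist_def by auto
  have least: "graph_dist G u v \<le> length q" if "awalk u q v" for q
    unfolding graph_dist_def by (rule Least_le) (use that in auto)
  show ?thesis
    unfolding \<mu>_def
    by (rule antisym) (auto simp: cost p(2)[symmetric] intro!: INF_lower2[of p] INF_greatest p(1)
          least[folded p(2)])
qed

text \<open>
  The condition \<open>graph_dist G x z + 1 = i\<close> says that \<open>z\<close> is at distance \<open>i - 1\<close> without
  truncated subtraction; for \<open>i = 0\<close> it is unsatisfiable, which forces \<open>c 0 = 0\<close>.
\<close>

definition distance_regular :: "'a pair_pre_digraph \<Rightarrow> bool" where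
  "distance_regular G \<longleftrightarrow>
     pair_graph G \<and> Digraph_Component.connected (with_proj G) \<and>
     (\<exists>b c :: nat \<Rightarrow> nat. \<forall>i \<le> graph_diameter G. \<forall>x \<in> pverts G. \<forall>y \<in> pverts G.
        graph_dist G x y = i \<longrightarrow>
          card {z \<in> neighbours G y. graph_dist G x z + 1 = i} = c i \<and>
          card {z \<in> neighbours G y. graph_dist G x z = i + 1} = b i)"

definition harmonic_at :: "'a pair_pre_digraph \<Rightarrow> ('a \<Rightarrow> real) \<Rightarrow> 'a \<Rightarrow> bool" where
  "harmonic_at G f z \<longleftrightarrow> (\<Sum>x \<in> neighbours G z. f x - f z) = 0"

text \<open>
  On a connected finite graph the quotient below does not depend on the choice of the potential
  \<open>f\<close>, so the description is proper for distinct vertices \<open>u\<close> and \<open>v\<close>.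
\<close>

definition resistance :: "'a pair_pre_digraph \<Rightarrow> 'a \<Rightarrow> 'a \<Rightarrow> real" where
  "resistance G u v = (THE r. \<exists>f :: 'a \<Rightarrow> real.
     (\<forall>z \<in> pverts G - {u, v}. harmonic_at G f z) \<and> f u \<noteq> f v \<and>
     r = (f u - f v) / (\<Sum>x \<in> neighbours G u. f u - f x))"

text \<open>
  The common resistance between all pairs of vertices at distance \<open>j\<close>, for
  \<open>1 \<le> j \<le> graph_diameter G\<close>; the description is proper when \<open>G\<close> is distance-regular.
\<close>

definition resistance_at_dist :: "'a pair_pre_digraph \<Rightarrow> nat \<Rightarrow> real" where
  "resistance_at_dist G j = (THE r. \<forall>u \<in> pverts G. \<forall>v \<in> pverts G.
     graph_dist G u v = j \<longrightarrow> resistance G u v = r)"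

end

theory Submission
  imports Defs
begin

text \<open>
  Let \<open>n\<close> be the number of vertices and let \<open>c\<close>, \<open>a\<close>, \<open>b\<close> be the intersection numbers. The function
  \<open>psi\<close> is chosen so that the Laplacian of the function \<open>psi (d x v)\<close> of \<open>v\<close> is \<open>n - 1\<close> at \<open>x\<close> and
  \<open>-1\<close> elsewhere. Differences of two such functions are electric potentials, and the resistance
  at distance \<open>j\<close> is \<open>2 * (psi 0 - psi j) / n\<close> (lemma \<open>resistance_iff\<close>). Since \<open>psi\<close> is strictly
  decreasing, the resistance is largest at distance \<open>D\<close>, and what remains is the inequality
  \<open>psi 0 - psi D < (1 + 6 / k) * (psi 0 - psi 1)\<close> (theorem \<open>target\<close>). There are two regimes.

  If \<open>c 2 \<ge> 2\<close> (theorem \<open>target_c2\<close>), the graph has a good spectral gap. Expanding the Green function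
  along two or four steps of the adjacency operator leaves a remainder that is bounded by its
  value on the diagonal, and lemma \<open>gap_from_weights\<close> bounds this value: a set of
  diameter at most two carrying weights with sum zero, such that adjacent vertices tend to have weights
  of opposite sign, acts like a lower bound for the nonzero eigenvalues of the Laplacian. Two
  vertices at distance two with all their common neighbours serve if \<open>c 2\<close> is large compared with
  \<open>a 1\<close>; otherwise an induced quadrangle does, and if there is none, a suitable part of the
  neighbourhood of a vertex.

  If \<open>c 2 = 1\<close> (theorem \<open>target_c2_one\<close>), the sum defining \<open>psi 1\<close> is estimated directly. Its
  coefficients are products of quotients \<open>c j / b j\<close>, which decrease as long as \<open>c < b\<close>; after \<open>c\<close>
  has overtaken \<open>b\<close>, in the second half of the diameter, the terms are at most the size of the
  second sphere, and the many vertices in the middle spheres outweigh them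
  (lemma \<open>weighted_outer_bound\<close>). The only danger is a long range in which \<open>c i = b i\<close>. It is excluded
  by the geometry: if the common value is \<open>1\<close>, geodesics would be unique over distances for which
  they cannot be (lemma \<open>no_unique_geodesics\<close>), and if it is larger, a geodesic that starts sideways in
  the middle of a long interval would be trapped in this interval (lemma \<open>flat_contradiction\<close>).
\<close>

section \<open>Intersection numbers\<close>

text \<open>
  The graph enters the argument only through its vertex set \<open>V\<close>, its neighbourhoods \<open>N\<close> and
  its distance \<open>d\<close>; the assumption \<open>pred_ex\<close> is what remains of shortest walks.
\<close>

locale drg =
  fixes V :: "'a set" and N :: "'a \<Rightarrow> 'a set" and d :: "'a \<Rightarrow> 'a \<Rightarrow> nat"
    and b c :: "nat \<Rightarrow> nat" and k D :: nat
  assumes fin: "finite V"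
    and nbr_in: "\<And>x y. x \<in> V \<Longrightarrow> y \<in> N x \<Longrightarrow> y \<in> V"
    and dist0: "\<And>x y. x \<in> V \<Longrightarrow> y \<in> V \<Longrightarrow> d x y = 0 \<longleftrightarrow> x = y"
    and dist_sym: "\<And>x y. x \<in> V \<Longrightarrow> y \<in> V \<Longrightarrow> d x y = d y x"
    and dist_tri: "\<And>x y z. x \<in> V \<Longrightarrow> y \<in> V \<Longrightarrow> z \<in> V \<Longrightarrow> d x z \<le> d x y + d y z"
    and adj_iff: "\<And>x y. x \<in> V \<Longrightarrow> y \<in> V \<Longrightarrow> y \<in> N x \<longleftrightarrow> d x y = 1"
    and pred_ex: "\<And>x y i. x \<in> V \<Longrightarrow> y \<in> V \<Longrightarrow> d x y = Suc i \<Longrightarrow> \<exists>z \<in> N y. d x z = i"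
    and dist_le: "\<And>x y. x \<in> V \<Longrightarrow> y \<in> V \<Longrightarrow> d x y \<le> D"
    and dist_ex: "\<exists>x \<in> V. \<exists>y \<in> V. d x y = D"
    and c_card: "\<And>x y. x \<in> V \<Longrightarrow> y \<in> V \<Longrightarrow> card {z \<in> N y. d x z + 1 = d x y} = c (d x y)"
    and b_card: "\<And>x y. x \<in> V \<Longrightarrow> y \<in> V \<Longrightarrow> card {z \<in> N y. d x z = d x y + 1} = b (d x y)"
    and k_card: "\<And>x. x \<in> V \<Longrightarrow> card (N x) = k"
    and k_gt: "k > 2" and D_ge: "D \<ge> 3"
begin

definition down :: "'a \<Rightarrow> 'a \<Rightarrow> 'a set" where
  "down x y = {z \<in> N y. d x z + 1 = d x y}"

definition side :: "'a \<Rightarrow> 'a \<Rightarrow> 'a set" where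
  "side x y = {z \<in> N y. d x z = d x y}"

definition up :: "'a \<Rightarrow> 'a \<Rightarrow> 'a set" where
  "up x y = {z \<in> N y. d x z = d x y + 1}"

definition a :: "nat \<Rightarrow> nat" where
  "a i = k - b i - c i"

lemma N_iff: "x \<in> V \<Longrightarrow> y \<in> N x \<longleftrightarrow> y \<in> V \<and> d x y = 1"
  using nbr_in adj_iff by blast

lemma fin_N: "x \<in> V \<Longrightarrow> finite (N x)"
  using fin nbr_in by (meson finite_subset subsetI)

lemma N_sym: "x \<in> V \<Longrightarrow> y \<in> V \<Longrightarrow> y \<in> N x \<longleftrightarrow> x \<in> N y"
  by (simp add: N_iff dist_sym)

lemma N_symD: "x \<in> V \<Longrightarrow> y \<in> N x \<Longrightarrow> x \<in> N y"
  using N_sym nbr_in by blast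

lemma dist_N: "x \<in> V \<Longrightarrow> y \<in> N x \<Longrightarrow> d x y = 1"
  using adj_iff nbr_in by blast

lemma dist_N': "x \<in> V \<Longrightarrow> y \<in> N x \<Longrightarrow> d y x = 1"
  using dist_N dist_sym nbr_in by metis

lemma dist_self [simp]: "x \<in> V \<Longrightarrow> d x x = 0"
  using dist0 by blast

lemma N_irrefl: "x \<in> V \<Longrightarrow> x \<notin> N x"
  using dist_N by fastforce

lemma dist_step:
  assumes "x \<in> V" "y \<in> V" "z \<in> N y"
  shows "d x z \<le> d x y + 1" "d x y \<le> d x z + 1"
proof -
  have z: "z \<in> V" using nbr_in assms by blast
  show "d x z \<le> d x y + 1" using dist_tri[of x y z] dist_N[of y z] assms z by simp
  show "d x y \<le> d x z + 1" using dist_tri[of x z y] dist_N'[of y z] assms z by simp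
qed

lemma dist_step':
  assumes "x \<in> V" "y \<in> V" "z \<in> N y"
  shows "d z x \<le> d y x + 1" "d y x \<le> d z x + 1"
  using dist_step[OF assms] dist_sym assms nbr_in by metis+

lemma fin_parts: "y \<in> V \<Longrightarrow> finite (down x y)" "y \<in> V \<Longrightarrow> finite (side x y)"
  "y \<in> V \<Longrightarrow> finite (up x y)"
  using fin_N by (auto simp: down_def side_def up_def)

lemma N_split:
  assumes "x \<in> V" "y \<in> V"
  shows "N y = down x y \<union> side x y \<union> up x y"
proof -
  have "z \<in> down x y \<union> side x y \<union> up x y" if "z \<in> N y" for z
    using dist_step[OF assms that] that by (auto simp: down_def side_def up_def)
  thus ?thesis by (auto simp: down_def side_def up_def)
qed

lemma parts_disjoint: "down x y \<inter> side x y = {}" "down x y \<inter> up x y = {}" "side x y \<inter> up x y = {}"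
  by (auto simp: down_def side_def up_def)

lemma card_down: "x \<in> V \<Longrightarrow> y \<in> V \<Longrightarrow> card (down x y) = c (d x y)"
  unfolding down_def by (rule c_card)

lemma card_up: "x \<in> V \<Longrightarrow> y \<in> V \<Longrightarrow> card (up x y) = b (d x y)"
  unfolding up_def by (rule b_card)

lemma card_sum: 
  assumes "x \<in> V" "y \<in> V"
  shows "c (d x y) + card (side x y) + b (d x y) = k"
proof -
  have "card (N y) = card (down x y) + card (side x y) + card (up x y)"
    unfolding N_split[OF assms] using fin_parts[OF assms(2)] parts_disjoint
    by (simp add: card_Un_disjoint Int_Un_distrib2)
  thus ?thesis using card_down[OF assms] card_up[OF assms] k_card[OF assms(2)] by simp
qed

lemma card_side: "x \<in> V \<Longrightarrow> y \<in> V \<Longrightarrow> card (side x y) = a (d x y)"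
  using card_sum[of x y] by (simp add: a_def)

lemma V_ne: "V \<noteq> {}" using dist_ex by blast

lemma geodesic_split:
  assumes "x \<in> V" "y \<in> V" "d x y = i + j"
  shows "\<exists>z \<in> V. d x z = i \<and> d z y = j"
  using assms(2,3)
proof (induction j arbitrary: y)
  case 0
  then show ?case using assms by (intro bexI[of _ y]) auto
next
  case (Suc j)
  obtain w where w: "w \<in> N y" "d x w = i + j"
    using pred_ex[of x y "i+j"] assms Suc.prems by auto
  have wV: "w \<in> V" using w nbr_in Suc.prems by blast
  from Suc.IH[OF wV w(2)] obtain z where z: "z \<in> V" "d x z = i" "d z w = j" by blast
  have "d z y \<le> Suc j" using dist_tri[of z w y] dist_N'[of y w] z w wV Suc.prems by simp
  moreover have "d z y \<ge> Suc j"
    using dist_tri[of x z y] z Suc.prems assms by simp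
  ultimately show ?case using z by (intro bexI[of _ z]) auto
qed

lemma vertex_pair_ex: "i \<le> D \<Longrightarrow> \<exists>x \<in> V. \<exists>y \<in> V. d x y = i"
  using dist_ex geodesic_split[of _ _ i "D - i"] by force

lemma b_pos: assumes "i < D" shows "b i > 0"
proof -
  obtain x y where xy: "x \<in> V" "y \<in> V" "d x y = D" using dist_ex by blast
  obtain z where z: "z \<in> V" "d x z = i" "d z y = D - i"
    using geodesic_split[of x y i "D - i"] xy assms by auto
  obtain w where w: "w \<in> V" "d x w = i + 1" "d w y = D - i - 1"
    using geodesic_split[of x y "i+1" "D - i - 1"] xy assms by auto
  obtain u where u: "u \<in> V" "d z u = 1" "d u y = D - i - 1"
    using geodesic_split[of z y 1 "D - i - 1"] z(1,3) xy(2) assms by fastforce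
  have "d x u \<ge> i + 1" using dist_tri[of x u y] u xy assms by linarith
  moreover have "d x u \<le> i + 1" using dist_tri[of x z u] z u xy by simp
  ultimately have "u \<in> up x z" using u z by (auto simp: up_def adj_iff)
  hence "card (up x z) > 0" using fin_parts z by (auto simp: card_gt_0_iff)
  thus ?thesis using card_up[of x z] z xy by simp
qed

text \<open>
  If \<open>y\<close> lies on a geodesic from \<open>x\<close> to \<open>z\<close>, a step at \<open>z\<close> towards \<open>y\<close> is also a step
  towards \<open>x\<close>, and dually. Sliding one end of a pair along a geodesic in this way gives all
  the monotonicity of the intersection numbers, and \<open>down_opposite_up\<close> below compares \<open>c\<close>
  with \<open>b\<close>.
\<close>

lemma geodesic_parts_mono:
  assumes "x \<in> V" "y \<in> V" "z \<in> V" "d x y + d y z = d x z"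
  shows "down y z \<subseteq> down x z" "up x z \<subseteq> up y z"
proof -
  show "down y z \<subseteq> down x z"
  proof
    fix w assume "w \<in> down y z"
    hence w: "w \<in> N z" "d y w + 1 = d y z" by (auto simp: down_def)
    have wV: "w \<in> V" using w nbr_in assms by blast
    have "d x w \<le> d x y + d y w" using dist_tri[of x y w] assms wV by simp
    moreover have "d x z \<le> d x w + 1" using dist_step[of x z w] assms w by simp
    ultimately have "d x w + 1 = d x z" using w assms by linarith
    thus "w \<in> down x z" using w by (simp add: down_def)
  qed
  show "up x z \<subseteq> up y z"
  proof
    fix w assume "w \<in> up x z"
    hence w: "w \<in> N z" "d x w = d x z + 1" by (auto simp: up_def)
    have wV: "w \<in> V" using w nbr_in assms by blast
    have "d x w \<le> d x y + d y w" using dist_tri[of x y w] assms wV by simp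
    moreover have "d y w \<le> d y z + 1" using dist_step[of y z w] assms w by simp
    ultimately have "d y w = d y z + 1" using w assms by linarith
    thus "w \<in> up y z" using w by (simp add: up_def)
  qed
qed

lemma down_opposite_up:
  assumes "x \<in> V" "y \<in> V" "z \<in> V" "d x y + d y z = d x z"
  shows "down z y \<subseteq> up x y"
proof
  fix w assume "w \<in> down z y"
  hence w: "w \<in> N y" "d z w + 1 = d z y" by (auto simp: down_def)
  have wV: "w \<in> V" using w nbr_in assms by blast
  have "d x z \<le> d x w + d w z" using dist_tri[of x w z] assms wV by simp
  moreover have "d w z + 1 = d y z" using w dist_sym assms wV by metis
  moreover have "d x w \<le> d x y + 1" using dist_step[of x y w] assms w by simp
  ultimately have "d x w = d x y + 1" using assms by linarith
  thus "w \<in> up x y" using w by (simp add: up_def)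
qed

lemma c_mono: assumes "i \<le> j" "j \<le> D" shows "c i \<le> c j"
proof -
  obtain x z where xz: "x \<in> V" "z \<in> V" "d x z = j" using vertex_pair_ex[OF assms(2)] by blast
  obtain y where y: "y \<in> V" "d x y = j - i" "d y z = i"
    using geodesic_split[of x z "j - i" i] xz assms by auto
  have "card (down y z) \<le> card (down x z)"
    using geodesic_parts_mono(1)[of x y z] xz y assms fin_parts by (intro card_mono) auto
  thus ?thesis using card_down xz y by simp
qed

lemma b_antimono: assumes "i \<le> j" "j \<le> D" shows "b j \<le> b i"
proof -
  obtain x z where xz: "x \<in> V" "z \<in> V" "d x z = j" using vertex_pair_ex[OF assms(2)] by blast
  obtain y where y: "y \<in> V" "d x y = j - i" "d y z = i"
    using geodesic_split[of x z "j - i" i] xz assms by auto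
  have "card (up x z) \<le> card (up y z)"
    using geodesic_parts_mono(2)[of x y z] xz y assms fin_parts by (intro card_mono) auto
  thus ?thesis using card_up xz y by simp
qed

lemma c_le_b: assumes "i + j \<le> D" shows "c i \<le> b j"
proof -
  obtain x z where xz: "x \<in> V" "z \<in> V" "d x z = j + i"
    using vertex_pair_ex[of "j + i"] assms by auto
  obtain y where y: "y \<in> V" "d x y = j" "d y z = i" using geodesic_split[of x z j i] xz by auto
  have "card (down z y) \<le> card (up x y)"
    using down_opposite_up[of x y z] xz y fin_parts by (intro card_mono) auto
  thus ?thesis using card_down[of z y] card_up[of x y] xz y dist_sym[of z y] by simp
qed

lemma b_0: "b 0 = k"
proof -
  obtain x where x: "x \<in> V" using V_ne by blast
  have "up x x = N x" using x dist_N by (auto simp: up_def)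
  thus ?thesis using card_up[of x x] k_card x by simp
qed

lemma c_0: "c 0 = 0"
proof -
  obtain x where x: "x \<in> V" using V_ne by blast
  have "down x x = {}" using x by (auto simp: down_def)
  thus ?thesis using card_down[of x x] x by simp
qed

lemma b_D: "b D = 0"
proof -
  obtain x y where xy: "x \<in> V" "y \<in> V" "d x y = D" using dist_ex by blast
  have "up x y = {}" using xy dist_le[of x] by (fastforce simp: up_def N_iff)
  thus ?thesis using card_up[of x y] xy by simp
qed

lemma c_1: "c 1 = 1"
proof -
  obtain x y where xy: "x \<in> V" "y \<in> V" "d x y = 1" using vertex_pair_ex[of 1] D_ge by auto
  have "down x y = {x}" using xy dist0[of x] dist_sym[of x y] by (auto simp: down_def N_iff)
  thus ?thesis using card_down[of x y] xy by simp
qed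

lemma c_pos: "1 \<le> i \<Longrightarrow> i \<le> D \<Longrightarrow> c i > 0"
  using c_mono[of 1 i] c_1 by simp

lemma abc_sum: "i \<le> D \<Longrightarrow> c i + a i + b i = k"
  using vertex_pair_ex[of i] card_sum card_side by metis

lemma side_eq_common:
  assumes "x \<in> V" "y \<in> N x"
  shows "side x y = N x \<inter> N y"
proof -
  have "y \<in> V" using assms nbr_in by blast
  thus ?thesis using assms dist_N[of x y] by (auto simp: side_def N_iff)
qed

lemma card_common_adj: "x \<in> V \<Longrightarrow> y \<in> N x \<Longrightarrow> card (N x \<inter> N y) = a 1"
  using side_eq_common card_side dist_N nbr_in by metis

lemma down_eq_common:
  assumes "x \<in> V" "y \<in> V" "d x y = 2"
  shows "down x y = N x \<inter> N y"
  using assms by (auto simp: down_def N_iff)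

lemma card_common_2: "x \<in> V \<Longrightarrow> y \<in> V \<Longrightarrow> d x y = 2 \<Longrightarrow> card (N x \<inter> N y) = c 2"
  using down_eq_common card_down by metis

lemma up_eq_far:
  assumes "x \<in> V" "y \<in> N x"
  shows "up x y = N y - N x - {x}"
proof -
  have yV: "y \<in> V" using assms nbr_in by blast
  have "d x z = 2" if "z \<in> N y" "z \<notin> N x" "z \<noteq> x" for z
  proof -
    have zV: "z \<in> V" using that yV nbr_in by blast
    have "d x z \<le> 2" using dist_step[of x y z] that assms yV dist_N[of x y] by simp
    moreover have "d x z \<noteq> 0" "d x z \<noteq> 1" using that dist0 adj_iff zV assms by auto
    ultimately show ?thesis by linarith
  qed
  moreover have "z \<notin> N x" "z \<noteq> x" if "d x z = 2" "z \<in> N y" for z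
    using that dist_N[of x z] assms by auto
  moreover have "up x y = {z \<in> N y. d x z = 2}" using assms dist_N[of x y] by (simp add: up_def numeral_2_eq_2)
  ultimately show ?thesis by blast
qed

lemma k_b1: "k = 1 + a 1 + b 1"
  using abc_sum[of 1] c_1 D_ge by simp

lemma c2_le_b1: "c 2 \<le> b 1"
  using c_le_b[of 2 1] D_ge by simp

section \<open>Spheres and the adjacency operator\<close>

definition sphere :: "'a \<Rightarrow> nat \<Rightarrow> 'a set" where
  "sphere x i = {y \<in> V. d x y = i}"

text \<open>
  The sphere sizes as a product of quotients, which makes sense without reference to a
  centre; \<open>card_sphere\<close> justifies the name.
\<close>

definition sphere_size :: "nat \<Rightarrow> real" where
  "sphere_size i = (\<Prod>j<i. real (b j) / real (c (j + 1)))"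

lemma fin_sphere: "finite (sphere x i)"
  using fin by (simp add: sphere_def)

lemma sphere_size_0: "sphere_size 0 = 1" by (simp add: sphere_size_def)

lemma sphere_size_Suc: "sphere_size (Suc i) = sphere_size i * b i / c (Suc i)"
  by (simp add: sphere_size_def)

lemma double_count:
  assumes "finite A" "finite B" "\<And>x y. x \<in> A \<Longrightarrow> y \<in> B \<Longrightarrow> R x y \<longleftrightarrow> R' y x"
  shows "(\<Sum>x\<in>A. card {y \<in> B. R x y}) = (\<Sum>y\<in>B. card {x \<in> A. R' y x})"
proof -
  have "(\<Sum>x\<in>A. card {y \<in> B. R x y}) = (\<Sum>x\<in>A. \<Sum>y\<in>B. if R x y then 1 else 0)"
    using assms(2) by (intro sum.cong) (auto simp: sum.If_cases Int_def)
  also have "\<dots> = (\<Sum>y\<in>B. \<Sum>x\<in>A. if R x y then 1 else 0)" by (rule sum.swap)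
  also have "\<dots> = (\<Sum>y\<in>B. \<Sum>x\<in>A. if R' y x then 1 else 0)"
    using assms(3) by (intro sum.cong) auto
  also have "\<dots> = (\<Sum>y\<in>B. card {x \<in> A. R' y x})"
    using assms(1) by (intro sum.cong) (auto simp: sum.If_cases Int_def)
  finally show ?thesis .
qed

lemma sphere_step:
  assumes "x \<in> V" "i < D"
  shows "card (sphere x i) * b i = card (sphere x (Suc i)) * c (Suc i)"
proof -
  have "(\<Sum>y\<in>sphere x i. card {z \<in> sphere x (Suc i). z \<in> N y}) =
        (\<Sum>z\<in>sphere x (Suc i). card {y \<in> sphere x i. y \<in> N z})"
    by (intro double_count fin_sphere) (auto simp: sphere_def N_iff dist_sym)
  moreover have "{z \<in> sphere x (Suc i). z \<in> N y} = up x y" if "y \<in> sphere x i" for y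
    using that by (auto simp: sphere_def up_def N_iff)
  moreover have "{y \<in> sphere x i. y \<in> N z} = down x z" if "z \<in> sphere x (Suc i)" for z
    using that by (auto simp: sphere_def down_def N_iff)
  ultimately have "(\<Sum>y\<in>sphere x i. card (up x y)) = (\<Sum>z\<in>sphere x (Suc i). card (down x z))"
    by simp
  moreover have "(\<Sum>y\<in>sphere x i. card (up x y)) = (\<Sum>y\<in>sphere x i. b i)"
    using assms by (intro sum.cong) (auto simp: sphere_def card_up)
  moreover have "(\<Sum>z\<in>sphere x (Suc i). card (down x z)) = (\<Sum>z\<in>sphere x (Suc i). c (Suc i))"
    using assms by (intro sum.cong) (auto simp: sphere_def card_down)
  ultimately show ?thesis by simp
qed

lemma card_sphere:
  assumes "x \<in> V" "i \<le> D"
  shows "real (card (sphere x i)) = sphere_size i"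
  using assms(2)
proof (induction i)
  case 0
  have "sphere x 0 = {x}" using assms by (auto simp: sphere_def dist0)
  thus ?case by (simp add: sphere_size_0)
next
  case (Suc i)
  have "real (card (sphere x (Suc i))) * c (Suc i) = sphere_size i * b i"
    using sphere_step[OF assms(1), of i] Suc by (metis Suc_le_lessD Suc_leD of_nat_mult)
  moreover have "c (Suc i) > 0" using c_pos[of "Suc i"] Suc.prems by simp
  ultimately show ?case by (simp add: sphere_size_Suc field_simps)
qed

lemma sphere_size_pos: "i \<le> D \<Longrightarrow> sphere_size i > 0"
  unfolding sphere_size_def by (intro prod_pos) (auto simp: b_pos c_pos)

lemma sphere_size_1: "sphere_size 1 = k"
  using b_0 c_1 by (simp add: sphere_size_def)

lemma sum_radial:
  assumes "x \<in> V"
  shows "(\<Sum>v\<in>V. \<eta> (d x v)) = (\<Sum>i\<le>D. sphere_size i * (\<eta> i :: real))"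
proof -
  have "(\<Sum>v\<in>V. \<eta> (d x v)) = (\<Sum>i\<le>D. \<Sum>v\<in>{v\<in>V. d x v = i}. \<eta> (d x v))"
    using assms dist_le by (intro sum.group[symmetric]) (auto simp: fin)
  also have "\<dots> = (\<Sum>i\<le>D. \<Sum>v\<in>sphere x i. \<eta> i)"
    by (intro sum.cong) (auto simp: sphere_def)
  also have "\<dots> = (\<Sum>i\<le>D. sphere_size i * \<eta> i)"
    using card_sphere[OF assms] by (intro sum.cong) auto
  finally show ?thesis .
qed

definition size_V :: real where "size_V = real (card V)"

lemma size_V_eq: "size_V = (\<Sum>i\<le>D. sphere_size i)"
  using sum_radial[of _ "\<lambda>_. 1"] V_ne by (auto simp: size_V_def)

definition adj :: "('a \<Rightarrow> real) \<Rightarrow> 'a \<Rightarrow> real" where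
  "adj f v = (\<Sum>w\<in>N v. f w)"

text \<open>
  On functions of the distance to a fixed vertex, the adjacency operator is the tridiagonal
  matrix of the intersection numbers. At \<open>j = 0\<close> the truncated index \<open>j - 1\<close> is harmless
  because \<open>c 0 = 0\<close>.
\<close>

definition radj :: "(nat \<Rightarrow> real) \<Rightarrow> nat \<Rightarrow> real" where
  "radj \<eta> j = real (c j) * \<eta> (j - 1) + real (a j) * \<eta> j + real (b j) * \<eta> (j + 1)"

lemma sum_N_radial:
  assumes "x \<in> V" "y \<in> V"
  shows "(\<Sum>z\<in>N y. \<eta> (d x z)) = radj \<eta> (d x y)"
proof -
  have "(\<Sum>z\<in>N y. \<eta> (d x z)) = (\<Sum>z\<in>down x y. \<eta> (d x z)) + (\<Sum>z\<in>side x y. \<eta> (d x z)) + (\<Sum>z\<in>up x y. \<eta> (d x z))"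
    unfolding N_split[OF assms] using fin_parts[OF assms(2)] parts_disjoint
    by (simp add: sum.union_disjoint Int_Un_distrib2)
  moreover have "(\<Sum>z\<in>down x y. \<eta> (d x z)) = (\<Sum>z\<in>down x y. \<eta> (d x y - 1))"
    by (intro sum.cong refl arg_cong[of _ _ \<eta>]) (auto simp: down_def)
  moreover have "(\<Sum>z\<in>side x y. \<eta> (d x z)) = (\<Sum>z\<in>side x y. \<eta> (d x y))"
    by (intro sum.cong) (auto simp: side_def)
  moreover have "(\<Sum>z\<in>up x y. \<eta> (d x z)) = (\<Sum>z\<in>up x y. \<eta> (d x y + 1))"
    by (intro sum.cong) (auto simp: up_def)
  ultimately show ?thesis using assms by (simp add: radj_def card_down card_side card_up)
qed

lemma adj_radial: "x \<in> V \<Longrightarrow> y \<in> V \<Longrightarrow> adj (\<lambda>v. \<eta> (d x v)) y = radj \<eta> (d x y)"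
  by (simp add: adj_def sum_N_radial)

definition inner :: "('a \<Rightarrow> real) \<Rightarrow> ('a \<Rightarrow> real) \<Rightarrow> real" where
  "inner f g = (\<Sum>v\<in>V. f v * g v)"

lemma sum_N_as_V:
  assumes "v \<in> V"
  shows "(\<Sum>w\<in>N v. f w) = (\<Sum>w\<in>V. if w \<in> N v then f w else (0::real))"
proof -
  have "V \<inter> N v = N v" using nbr_in assms by auto
  thus ?thesis using fin by (simp add: sum.inter_restrict[symmetric])
qed

lemma adj_selfadjoint: "inner f (adj g) = inner (adj f) g"
proof -
  have "inner f (adj g) = (\<Sum>v\<in>V. \<Sum>w\<in>V. if w \<in> N v then f v * g w else 0)"
    unfolding inner_def adj_def
    by (intro sum.cong) (auto simp: sum_N_as_V sum_distrib_left intro!: sum.cong)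
  also have "\<dots> = (\<Sum>w\<in>V. \<Sum>v\<in>V. if w \<in> N v then f v * g w else 0)" by (rule sum.swap)
  also have "\<dots> = (\<Sum>w\<in>V. \<Sum>v\<in>V. if v \<in> N w then f v * g w else 0)"
    by (intro sum.cong refl if_cong) (auto simp: N_sym)
  also have "\<dots> = inner (adj f) g"
    unfolding inner_def adj_def
    by (intro sum.cong) (auto simp: sum_N_as_V sum_distrib_right intro!: sum.cong)
  finally show ?thesis .
qed

definition lap :: "('a \<Rightarrow> real) \<Rightarrow> 'a \<Rightarrow> real" where
  "lap f v = real k * f v - adj f v"

lemma lap_alt: "v \<in> V \<Longrightarrow> lap f v = (\<Sum>x\<in>N v. f v - f x)"
  by (simp add: lap_def adj_def sum_subtractf k_card)

lemma lap_selfadjoint: "inner f (lap g) = inner (lap f) g"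
proof -
  have "inner f (lap g) = k * inner f g - inner f (adj g)"
    by (simp add: inner_def lap_def algebra_simps sum_subtractf sum_distrib_left)
  also have "\<dots> = k * inner f g - inner (adj f) g" by (simp add: adj_selfadjoint)
  also have "\<dots> = inner (lap f) g"
    by (simp add: inner_def lap_def algebra_simps sum_subtractf sum_distrib_left)
  finally show ?thesis .
qed

text \<open>
  Twice the left-hand side is the sum of \<open>(f v - f w)\<^sup>2\<close> over all ordered pairs of
  neighbours.
\<close>

lemma lap_nonneg: "inner f (lap f) \<ge> 0"
proof -
  have eq: "inner f (lap f) = (\<Sum>v\<in>V. \<Sum>w\<in>N v. f v * f v - f v * f w)"
    unfolding inner_def by (intro sum.cong) (auto simp: lap_alt sum_distrib_left algebra_simps)
  have "(\<Sum>v\<in>V. \<Sum>w\<in>N v. f v * f v - f v * f w) = (\<Sum>v\<in>V. \<Sum>w\<in>V. if w \<in> N v then f v * f v - f v * f w else 0)"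
    by (rule sum.cong[OF refl]) (rule sum_N_as_V)
  also have "\<dots> = (\<Sum>w\<in>V. \<Sum>v\<in>V. if w \<in> N v then f v * f v - f v * f w else 0)" by (rule sum.swap)
  also have "\<dots> = (\<Sum>w\<in>V. \<Sum>v\<in>V. if v \<in> N w then f v * f v - f v * f w else 0)"
    by (intro sum.cong refl if_cong) (auto simp: N_sym)
  also have "\<dots> = (\<Sum>v\<in>V. \<Sum>w\<in>N v. f w * f w - f w * f v)"
    by (rule sum.cong[OF refl]) (simp add: sum_N_as_V)
  finally have eq2: "inner f (lap f) = (\<Sum>v\<in>V. \<Sum>w\<in>N v. f w * f w - f w * f v)" using eq by simp
  have "2 * inner f (lap f) = (\<Sum>v\<in>V. \<Sum>w\<in>N v. (f v * f v - f v * f w) + (f w * f w - f w * f v))"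
    using eq eq2 by (simp only: sum.distrib)
  also have "\<dots> = (\<Sum>v\<in>V. \<Sum>w\<in>N v. (f v - f w)\<^sup>2)"
    by (intro sum.cong refl) (simp add: power2_eq_square algebra_simps)
  also have "\<dots> \<ge> 0" by (intro sum_nonneg) auto
  finally show ?thesis by simp
qed

section \<open>Effective resistance\<close>

definition outer :: "nat \<Rightarrow> real" where "outer j = (\<Sum>i=j..D. sphere_size i)"

definition edges :: "nat \<Rightarrow> real" where "edges i = sphere_size i * b i"

text \<open>
  The radial solution of the Poisson equation. A function of the distance to \<open>x\<close> whose
  Laplacian is \<open>-1\<close> outside \<open>x\<close> must send, through the edges between the spheres of radius
  \<open>i\<close> and \<open>i + 1\<close>, a current equal to the number of vertices beyond radius \<open>i\<close>; this fixes
  each of its decrements.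
\<close>

definition psi :: "nat \<Rightarrow> real" where "psi j = (\<Sum>i=j..<D. outer (i + 1) / edges i)"

lemma edges_pos: "i < D \<Longrightarrow> edges i > 0"
  using sphere_size_pos[of i] b_pos[of i] by (simp add: edges_def)

lemma edges_c: "i < D \<Longrightarrow> edges i = sphere_size (Suc i) * c (Suc i)"
  using c_pos[of "Suc i"] by (simp add: edges_def sphere_size_Suc)

lemma outer_pos: "j \<le> D \<Longrightarrow> outer j > 0"
  unfolding outer_def by (intro sum_pos) (auto simp: sphere_size_pos)

lemma outer_Suc: "j \<le> D \<Longrightarrow> outer j = sphere_size j + outer (j + 1)"
  by (simp add: outer_def sum.atLeast_Suc_atMost)

lemma outer_0: "outer 0 = size_V" by (simp add: outer_def size_V_eq atLeast0AtMost)

lemma psi_step: "j < D \<Longrightarrow> psi j = outer (j + 1) / edges j + psi (j + 1)"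
  by (simp add: psi_def sum.atLeast_Suc_lessThan)

lemma psi_D: "psi D = 0" by (simp add: psi_def)

lemma psi_decr: "i < j \<Longrightarrow> j \<le> D \<Longrightarrow> psi j < psi i"
proof (induction j)
  case (Suc j)
  have "psi (Suc j) < psi j"
    using psi_step[of j] outer_pos[of "j+1"] edges_pos[of j] Suc.prems by simp
  thus ?case using Suc by (cases "i = j") auto
qed auto

lemma psi_lap:
  assumes "j \<le> D"
  shows "k * psi j - radj psi j = (if j = 0 then size_V - 1 else -1)"
proof -
  have up: "b j * (psi j - psi (j + 1)) = outer (j + 1) / sphere_size j"
  proof (cases "j < D")
    case True
    thus ?thesis using psi_step[OF True] b_pos[OF True] sphere_size_pos[of j] by (simp add: edges_def field_simps)
  next
    case False
    thus ?thesis using assms b_D by (simp add: outer_def)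
  qed
  have dn: "c j * (psi (j - 1) - psi j) = outer j / sphere_size j" if "j \<noteq> 0"
    using psi_step[of "j - 1"] edges_c[of "j - 1"] c_pos[of j] that assms sphere_size_pos[of j] by simp
  have kj: "real k = c j + a j + b j" using abc_sum[OF assms] by (metis of_nat_add)
  have "k * psi j - radj psi j = b j * (psi j - psi (j + 1)) - c j * (psi (j - 1) - psi j)"
    by (simp add: kj radj_def algebra_simps)
  also have "\<dots> = (if j = 0 then size_V - 1 else -1)"
  proof (cases "j = 0")
    case True
    thus ?thesis using up outer_Suc[of 0] by (simp add: c_0 sphere_size_0 outer_0)
  next
    case False
    have "outer (j + 1) / sphere_size j - outer j / sphere_size j = -1"
      using outer_Suc[OF assms] sphere_size_pos[OF assms] by (simp add: diff_divide_distrib[symmetric])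
    thus ?thesis using up dn False by simp
  qed
  finally show ?thesis .
qed

lemma lap_psi:
  assumes "x \<in> V" "y \<in> V"
  shows "lap (\<lambda>v. psi (d x v)) y = (if y = x then size_V - 1 else -1)"
  unfolding lap_def adj_radial[OF assms] using psi_lap[of "d x y"] assms dist_le dist0 by auto

lemma size_V_pos: "size_V > 0" using V_ne fin by (simp add: size_V_def card_gt_0_iff)

lemma psi_01: "psi 0 - psi 1 = (size_V - 1) / k"
  using psi_step[of 0] outer_Suc[of 0] D_ge by (simp add: edges_def sphere_size_0 b_0 outer_0)

text \<open>
  In the difference of the radial solutions around \<open>u\<close> and \<open>v\<close> the constant parts of the
  Laplacians cancel, so it is harmonic off \<open>u\<close> and \<open>v\<close>. For any other admissible \<open>g\<close>, moving
  the Laplacian from \<open>g\<close> to this difference in their inner product determines the quotient.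
\<close>

lemma resistance_iff:
  assumes u: "u \<in> V" and v: "v \<in> V" and uv: "u \<noteq> v"
  shows "(\<exists>f :: 'a \<Rightarrow> real. (\<forall>z \<in> V - {u, v}. (\<Sum>x\<in>N z. f x - f z) = 0) \<and> f u \<noteq> f v \<and>
            r = (f u - f v) / (\<Sum>x\<in>N u. f u - f x)) \<longleftrightarrow>
         r = 2 * (psi 0 - psi (d u v)) / size_V"
proof -
  define f where "f z = psi (d u z) - psi (d v z)" for z
  have lf: "lap f z = (if z = u then size_V else 0) - (if z = v then size_V else 0)" if "z \<in> V" for z
  proof -
    have "lap f z = lap (\<lambda>w. psi (d u w)) z - lap (\<lambda>w. psi (d v w)) z"
      by (simp add: lap_def adj_def f_def sum_subtractf algebra_simps)
    thus ?thesis using lap_psi[OF u that] lap_psi[OF v that] uv by simp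
  qed
  have fuv: "f u - f v = 2 * (psi 0 - psi (d u v))" using u v by (simp add: f_def dist_sym)
  have fne: "f u - f v \<noteq> 0"
    using psi_decr[of 0 "d u v"] dist_le[OF u v] dist0[OF u v] uv by (simp add: fuv)
  have main: "(g u - g v) / (\<Sum>x\<in>N u. g u - g x) = 2 * (psi 0 - psi (d u v)) / size_V"
    if g: "\<forall>z \<in> V - {u, v}. (\<Sum>x\<in>N z. g x - g z) = 0" "g u \<noteq> g v" for g :: "'a \<Rightarrow> real"
  proof -
    have lg0: "lap g z = 0" if "z \<in> V - {u, v}" for z
      using g(1) that by (auto simp: lap_alt sum_subtractf)
    have two: "inner h (lap g) = h u * lap g u + h v * lap g v" for h
    proof -
      have "inner h (lap g) = (\<Sum>z\<in>{u, v}. h z * lap g z)"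
        unfolding inner_def by (rule sum.mono_neutral_right) (use fin u v lg0 in auto)
      thus ?thesis using uv by simp
    qed
    have "inner (\<lambda>_. 1) (lap g) = inner (lap (\<lambda>_. 1)) g" by (rule lap_selfadjoint)
    also have "\<dots> = 0" unfolding inner_def by (intro sum.neutral) (simp add: lap_alt)
    finally have s0: "lap g v = - lap g u" using two[of "\<lambda>_. 1"] by simp
    have "inner f (lap g) = inner (lap f) g" by (rule lap_selfadjoint)
    also have "\<dots> = (\<Sum>z\<in>{u, v}. lap f z * g z)"
      unfolding inner_def by (rule sum.mono_neutral_right) (use fin u v lf in auto)
    also have "\<dots> = size_V * (g u - g v)" using uv lf[OF u] lf[OF v] by (simp add: algebra_simps)
    finally have eq: "lap g u * (f u - f v) = size_V * (g u - g v)"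
      using two[of f] s0 by (simp add: algebra_simps)
    hence "lap g u \<noteq> 0" using g(2) size_V_pos by auto
    hence "(g u - g v) / lap g u = (f u - f v) / size_V" using eq size_V_pos by (simp add: field_simps)
    thus ?thesis using fuv u by (simp add: lap_alt)
  qed
  have fh: "\<forall>z \<in> V - {u, v}. (\<Sum>x\<in>N z. f x - f z) = 0"
  proof
    fix z assume z: "z \<in> V - {u, v}"
    have "(\<Sum>x\<in>N z. f x - f z) = - lap f z" using z by (simp add: lap_alt sum_subtractf)
    thus "(\<Sum>x\<in>N z. f x - f z) = 0" using lf[of z] z by auto
  qed
  show ?thesis
  proof
    assume "r = 2 * (psi 0 - psi (d u v)) / size_V"
    thus "\<exists>f :: 'a \<Rightarrow> real. (\<forall>z \<in> V - {u, v}. (\<Sum>x\<in>N z. f x - f z) = 0) \<and> f u \<noteq> f v \<and>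
            r = (f u - f v) / (\<Sum>x\<in>N u. f u - f x)"
      using main[OF fh] fne fh by (intro exI[of _ f]) auto
  qed (use main in blast)
qed

section \<open>The Green function and its iterates\<close>

lemma inner_sym: "inner f g = inner g f"
  by (simp add: inner_def mult.commute)

lemma inner_lap_left: "inner (lap f) g = k * inner f g - inner (adj f) g"
  by (simp add: inner_def lap_def algebra_simps sum_subtractf sum_distrib_left)

lemma inner_nonneg: "inner f f \<ge> 0"
  by (simp add: inner_def sum_nonneg)

lemma inner_cong: "(\<And>v. v \<in> V \<Longrightarrow> f v = f' v) \<Longrightarrow> (\<And>v. v \<in> V \<Longrightarrow> g v = g' v) \<Longrightarrow> inner f g = inner f' g'"
  unfolding inner_def by (intro sum.cong) auto

lemma sum_sphere:
  assumes "x \<in> V"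
  shows "(\<Sum>v\<in>sphere x i. F v) = (\<Sum>v\<in>V. if d x v = i then F v else (0::real))"
  unfolding sphere_def using fin by (simp add: sum.inter_filter)

text \<open>
  The distance matrices of a distance-regular graph span an algebra. Concretely, the
  indicator of a sphere is obtained from those of the two preceding spheres by the
  three-term recurrence of the adjacency operator, and this operator can be moved over to
  \<open>\<zeta>\<close>; so the property propagates from radius \<open>0\<close>.
\<close>

lemma sphere_sum_radial:
  "i \<le> D \<Longrightarrow> \<exists>\<xi>. \<forall>x\<in>V. \<forall>y\<in>V. (\<Sum>v\<in>sphere x i. \<zeta> (d v y)) = (\<xi> (d x y) :: real)"
proof (induction i arbitrary: \<zeta> rule: less_induct)
  case (less i)
  show ?case
  proof (cases i)
    case 0
    have "sphere x 0 = {x}" if "x \<in> V" for x using that by (auto simp: sphere_def dist0)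
    thus ?thesis using 0 by (intro exI[of _ \<zeta>]) auto
  next
    case (Suc j)
    obtain \<xi>1 where \<xi>1: "\<And>x y. x \<in> V \<Longrightarrow> y \<in> V \<Longrightarrow> (\<Sum>v\<in>sphere x j. radj \<zeta> (d v y)) = \<xi>1 (d x y)"
      using less.IH[of j "radj \<zeta>"] less.prems Suc by auto
    obtain \<xi>2 where \<xi>2: "\<And>x y. x \<in> V \<Longrightarrow> y \<in> V \<Longrightarrow> (\<Sum>v\<in>sphere x j. \<zeta> (d v y)) = \<xi>2 (d x y)"
      using less.IH[of j \<zeta>] less.prems Suc by auto
    obtain \<xi>3 where \<xi>3: "\<And>x y. x \<in> V \<Longrightarrow> y \<in> V \<Longrightarrow> (\<Sum>v\<in>sphere x (j - 1). \<zeta> (d v y)) = \<xi>3 (d x y)"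
    proof -
      have "j - 1 < i" "j - 1 \<le> D" using less.prems Suc by auto
      from less.IH[OF this, of \<zeta>] show ?thesis using that by blast
    qed
    define e where "e = (if j = 0 then 0 else real (b (j - 1)))"
    have key: "c i * (\<Sum>v\<in>sphere x i. \<zeta> (d v y)) = \<xi>1 (d x y) - a j * \<xi>2 (d x y) - e * \<xi>3 (d x y)"
      if xy: "x \<in> V" "y \<in> V" for x y
    proof -
      define F where "F v = \<zeta> (d v y)" for v
      define \<delta> where "\<delta> l = (if l = j then 1 else 0 :: real)" for l
      have "\<xi>1 (d x y) = (\<Sum>v\<in>sphere x j. adj F v)"
        unfolding \<xi>1[OF xy, symmetric]
      proof (intro sum.cong refl)
        fix v assume "v \<in> sphere x j"
        hence v: "v \<in> V" by (simp add: sphere_def)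
        have "adj F v = adj (\<lambda>w. \<zeta> (d y w)) v"
          unfolding adj_def F_def using v xy nbr_in by (intro sum.cong) (auto simp: dist_sym)
        thus "radj \<zeta> (d v y) = adj F v" using adj_radial[of y v \<zeta>] v xy by (simp add: dist_sym)
      qed
      also have "\<dots> = inner (\<lambda>v. \<delta> (d x v)) (adj F)"
        unfolding sum_sphere[OF xy(1)] inner_def \<delta>_def by (intro sum.cong) auto
      also have "\<dots> = inner (adj (\<lambda>v. \<delta> (d x v))) F" by (rule adj_selfadjoint)
      also have "\<dots> = (\<Sum>v\<in>V. radj \<delta> (d x v) * F v)"
        unfolding inner_def by (intro sum.cong) (auto simp: adj_radial xy)
      also have "\<dots> = (\<Sum>v\<in>V. c i * (if d x v = i then F v else 0) + a j * (if d x v = j then F v else 0)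
                         + e * (if d x v = j - 1 then F v else 0))"
      proof (intro sum.cong refl)
        fix v
        show "radj \<delta> (d x v) * F v = c i * (if d x v = i then F v else 0) + a j * (if d x v = j then F v else 0)
                         + e * (if d x v = j - 1 then F v else 0)"
          by (cases "d x v") (auto simp: radj_def \<delta>_def e_def Suc c_0 algebra_simps)
      qed
      also have "\<dots> = c i * (\<Sum>v\<in>sphere x i. F v) + a j * (\<Sum>v\<in>sphere x j. F v) + e * (\<Sum>v\<in>sphere x (j - 1). F v)"
        by (simp add: sum.distrib sum_distrib_left sum_sphere[OF xy(1)])
      finally show ?thesis using \<xi>2[OF xy] \<xi>3[OF xy] by (simp add: F_def)
    qed
    have "c i > 0" using c_pos[of i] less.prems Suc by simp
    hence "(\<Sum>v\<in>sphere x i. \<zeta> (d v y)) = (\<xi>1 (d x y) - a j * \<xi>2 (d x y) - e * \<xi>3 (d x y)) / c i"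
      if "x \<in> V" "y \<in> V" for x y
      using key[OF that] by (simp add: field_simps)
    thus ?thesis by (intro exI[of _ "\<lambda>l. (\<xi>1 l - a j * \<xi>2 l - e * \<xi>3 l) / c i"]) auto
  qed
qed

text \<open>
  Summing over the radius shows that the Gram matrices of the spectral argument are kernels
  of the distance, so that a few of their values determine them on a small set.
\<close>

lemma radial_inner:
  "\<exists>\<xi>. \<forall>x\<in>V. \<forall>y\<in>V. inner (\<lambda>v. \<eta> (d x v)) (\<lambda>v. \<zeta> (d y v)) = (\<xi> (d x y) :: real)"
proof -
  have "\<forall>i\<in>{..D}. \<exists>\<xi>. \<forall>x\<in>V. \<forall>y\<in>V. (\<Sum>v\<in>sphere x i. \<zeta> (d v y)) = (\<xi> (d x y) :: real)"
    using sphere_sum_radial by auto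
  then obtain \<xi> where \<xi>: "\<And>i x y. i \<le> D \<Longrightarrow> x \<in> V \<Longrightarrow> y \<in> V \<Longrightarrow> (\<Sum>v\<in>sphere x i. \<zeta> (d v y)) = \<xi> i (d x y)"
    by (metis atMost_iff)
  have "inner (\<lambda>v. \<eta> (d x v)) (\<lambda>v. \<zeta> (d y v)) = (\<Sum>i\<le>D. \<eta> i * \<xi> i (d x y))" if xy: "x \<in> V" "y \<in> V" for x y
  proof -
    have "inner (\<lambda>v. \<eta> (d x v)) (\<lambda>v. \<zeta> (d y v)) = (\<Sum>i\<le>D. \<Sum>v\<in>{v\<in>V. d x v = i}. \<eta> (d x v) * \<zeta> (d y v))"
      unfolding inner_def using xy dist_le by (intro sum.group[symmetric]) (auto simp: fin)
    also have "\<dots> = (\<Sum>i\<le>D. \<Sum>v\<in>sphere x i. \<eta> i * \<zeta> (d v y))"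
      using xy by (intro sum.cong) (auto simp: sphere_def dist_sym)
    also have "\<dots> = (\<Sum>i\<le>D. \<eta> i * \<xi> i (d x y))"
      using \<xi> xy by (intro sum.cong) (auto simp: sum_distrib_left[symmetric])
    finally show ?thesis .
  qed
  thus ?thesis by (intro exI[of _ "\<lambda>l. \<Sum>i\<le>D. \<eta> i * \<xi> i l"]) auto
qed

lemma radj_cong: "(\<And>i. i \<le> D \<Longrightarrow> f i = g i) \<Longrightarrow> j \<le> D \<Longrightarrow> radj f j = radj g j"
  using b_D by (cases "j = D") (auto simp: radj_def)

lemma radj_const: "j \<le> D \<Longrightarrow> radj (\<lambda>_. z) j = real k * z"
  using abc_sum[of j] by (simp add: radj_def distrib_right[symmetric] flip: of_nat_add)

text \<open>
  The entries of the powers of the adjacency matrix: \<open>walks p j\<close> is the number of walks of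
  length \<open>p\<close> between two vertices at distance \<open>j\<close>.
\<close>

definition walks :: "nat \<Rightarrow> nat \<Rightarrow> real" where
  "walks p = (radj ^^ p) (\<lambda>j. if j = 0 then 1 else 0)"

text \<open>
  The Green function of the Laplacian, shifted so that its sum over all vertices is zero.
\<close>

definition green :: "nat \<Rightarrow> real" where
  "green j = (psi j - (\<Sum>i\<le>D. sphere_size i * psi i) / size_V) / size_V"

definition green_iter :: "nat \<Rightarrow> nat \<Rightarrow> real" where
  "green_iter p = (radj ^^ p) green"

lemma walks_Suc: "walks (Suc p) = radj (walks p)" by (simp add: walks_def)
lemma green_iter_Suc: "green_iter (Suc p) = radj (green_iter p)" by (simp add: green_iter_def)
lemma green_iter_0: "green_iter 0 = green" by (simp add: green_iter_def)

lemma sum_adj: "(\<Sum>v\<in>V. adj f v) = real k * (\<Sum>v\<in>V. f v)"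
proof -
  have "inner (\<lambda>_. 1) (adj f) = inner (adj (\<lambda>_. 1)) f" by (rule adj_selfadjoint)
  also have "\<dots> = (\<Sum>v\<in>V. real k * f v)"
    unfolding inner_def by (intro sum.cong) (auto simp: adj_def k_card)
  finally show ?thesis by (simp add: inner_def sum_distrib_left)
qed

lemma sum_green_iter: "x \<in> V \<Longrightarrow> (\<Sum>v\<in>V. green_iter p (d x v)) = 0"
proof (induction p)
  case 0
  have "(\<Sum>v\<in>V. green (d x v)) = ((\<Sum>v\<in>V. psi (d x v)) - (\<Sum>i\<le>D. sphere_size i * psi i)) / size_V"
    using size_V_pos by (simp add: green_def sum_subtractf sum_divide_distrib[symmetric] size_V_def[symmetric] flip: size_V_def)
  thus ?case using sum_radial[OF 0] by (simp add: green_iter_0)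
next
  case (Suc p)
  have "(\<Sum>v\<in>V. green_iter (Suc p) (d x v)) = (\<Sum>v\<in>V. adj (\<lambda>v. green_iter p (d x v)) v)"
    using Suc.prems by (intro sum.cong) (auto simp: adj_radial green_iter_Suc)
  thus ?case using Suc by (simp add: sum_adj)
qed

lemma green_iter_rec: "j \<le> D \<Longrightarrow> k * green_iter p j - green_iter (Suc p) j = walks p j - k ^ p / size_V"
proof (induction p arbitrary: j)
  case 0
  define M where "M = (\<Sum>i\<le>D. sphere_size i * psi i) / size_V"
  have g: "green = (\<lambda>j. (psi j - M) / size_V)" by (simp add: green_def M_def fun_eq_iff)
  have "radj green j = (radj psi j - radj (\<lambda>_. M) j) / size_V"
    unfolding g radj_def by (simp add: field_simps add_divide_distrib diff_divide_distrib)
  hence "k * green j - radj green j = (k * psi j - radj psi j) / size_V"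
    using radj_const[OF 0, of M] by (simp add: g field_simps diff_divide_distrib)
  also have "\<dots> = (if j = 0 then 1 else 0) - 1 / size_V"
    using psi_lap[OF 0] size_V_pos by (simp add: diff_divide_distrib)
  finally show ?case by (simp add: green_iter_0 green_iter_Suc walks_def)
next
  case (Suc p)
  have lin: "radj (\<lambda>j. k * green_iter p j - green_iter (Suc p) j) j = k * radj (green_iter p) j - radj (green_iter (Suc p)) j"
    by (simp add: radj_def algebra_simps)
  have lin': "radj (\<lambda>j. walks p j - k ^ p / size_V) j = radj (walks p) j - radj (\<lambda>_. k ^ p / size_V) j"
    by (simp add: radj_def algebra_simps)
  have "radj (\<lambda>j. k * green_iter p j - green_iter (Suc p) j) j = radj (\<lambda>j. walks p j - k ^ p / size_V) j"
    using Suc.IH Suc.prems by (rule radj_cong)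
  thus ?case using radj_const[OF Suc.prems, of "k ^ p / size_V"] unfolding lin lin' by (simp add: green_iter_Suc walks_Suc)
qed

lemma inner_walks: "x \<in> V \<Longrightarrow> y \<in> V \<Longrightarrow> 
  inner (\<lambda>v. walks p (d x v)) (\<lambda>v. \<eta> (d y v)) = (radj ^^ p) \<eta> (d y x)"
proof (induction p arbitrary: \<eta>)
  case 0
  have "inner (\<lambda>v. walks 0 (d x v)) (\<lambda>v. \<eta> (d y v)) = (\<Sum>v\<in>V. if v = x then \<eta> (d y v) else 0)"
    unfolding inner_def walks_def using 0 dist0 by (intro sum.cong) auto
  thus ?case using fin 0 by simp
next
  case (Suc p)
  have "inner (\<lambda>v. walks (Suc p) (d x v)) (\<lambda>v. \<eta> (d y v)) = inner (adj (\<lambda>v. walks p (d x v))) (\<lambda>v. \<eta> (d y v))"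
    using Suc.prems by (intro inner_cong) (auto simp: adj_radial walks_Suc)
  also have "\<dots> = inner (\<lambda>v. walks p (d x v)) (adj (\<lambda>v. \<eta> (d y v)))"
    by (rule adj_selfadjoint[symmetric])
  also have "\<dots> = inner (\<lambda>v. walks p (d x v)) (\<lambda>v. radj \<eta> (d y v))"
    using Suc.prems by (intro inner_cong) (auto simp: adj_radial)
  also have "\<dots> = (radj ^^ Suc p) \<eta> (d y x)"
    using Suc.IH[OF Suc.prems, of "radj \<eta>"] by (simp add: funpow_swap1)
  finally show ?case .
qed

lemma inner_walks_green_iter: "x \<in> V \<Longrightarrow> y \<in> V \<Longrightarrow> 
  inner (\<lambda>v. walks p (d x v)) (\<lambda>v. green_iter q (d y v)) = green_iter (p + q) (d y x)"
  using inner_walks[of x y p "green_iter q"] by (simp add: green_iter_def funpow_add)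

lemma inner_const: "x \<in> V \<Longrightarrow> inner (\<lambda>v. z) (\<lambda>v. green_iter q (d x v)) = 0"
  using sum_green_iter[of x q] by (simp add: inner_def sum_distrib_left[symmetric])

lemma inner_diff_left: "inner (\<lambda>v. f v - f' v) g = inner f g - inner f' g"
  by (simp add: inner_def algebra_simps sum_subtractf)
lemma lap_green_iter: "x \<in> V \<Longrightarrow> v \<in> V \<Longrightarrow> lap (\<lambda>v. green_iter p (d x v)) v = walks p (d x v) - k ^ p / size_V"
  unfolding lap_def using green_iter_rec[of "d x v" p] dist_le by (simp add: adj_radial green_iter_Suc)

lemma inner_lap_green_iter:
  assumes "x \<in> V" "y \<in> V"
  shows "inner (lap (\<lambda>v. green_iter p (d x v))) (\<lambda>v. green_iter q (d y v)) = green_iter (p + q) (d y x)"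
proof -
  have "inner (lap (\<lambda>v. green_iter p (d x v))) (\<lambda>v. green_iter q (d y v)) =
        inner (\<lambda>v. walks p (d x v) - k ^ p / size_V) (\<lambda>v. green_iter q (d y v))"
    using assms by (intro inner_cong) (auto simp: lap_green_iter)
  thus ?thesis using inner_walks_green_iter[OF assms] inner_const[of y] assms by (simp add: inner_diff_left)
qed

text \<open>
  By \<open>inner_lap_green_iter\<close>, the kernel with entries \<open>green_iter (2 * p) (d x y)\<close> is a Gram
  matrix for the Dirichlet form, and the entries of a positive semidefinite matrix with
  constant diagonal are bounded by that diagonal.
\<close>

lemma green_iter_even_bound:
  assumes "j \<le> D" shows "\<bar>green_iter (2 * p) j\<bar> \<le> green_iter (2 * p) 0"
proof -
  obtain x y where xy: "x \<in> V" "y \<in> V" "d x y = j" using vertex_pair_ex[OF assms] by blast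
  have sq: "0 \<le> 2 * green_iter (2 * p) 0 + 2 * s * green_iter (2 * p) j" if s: "s * s = 1" for s :: real
  proof -
    define f where "f v = green_iter p (d x v) + s * green_iter p (d y v)" for v
    have lf: "lap f v = lap (\<lambda>v. green_iter p (d x v)) v + s * lap (\<lambda>v. green_iter p (d y v)) v" for v
      by (simp add: lap_def adj_def f_def sum.distrib sum_distrib_left algebra_simps)
    have "inner f (lap f) = inner (lap f) f" by (rule inner_sym)
    also have "\<dots> = inner (lap (\<lambda>v. green_iter p (d x v))) (\<lambda>v. green_iter p (d x v)) + s * inner (lap (\<lambda>v. green_iter p (d x v))) (\<lambda>v. green_iter p (d y v))
       + s * inner (lap (\<lambda>v. green_iter p (d y v))) (\<lambda>v. green_iter p (d x v)) + s * s * inner (lap (\<lambda>v. green_iter p (d y v))) (\<lambda>v. green_iter p (d y v))"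
      by (simp add: inner_def lf f_def algebra_simps sum.distrib sum_distrib_left)
    also have "\<dots> = 2 * green_iter (2 * p) 0 + 2 * s * green_iter (2 * p) j"
    proof -
      have "inner (lap (\<lambda>v. green_iter p (d x v))) (\<lambda>v. green_iter p (d x v)) = green_iter (2 * p) 0"
        "inner (lap (\<lambda>v. green_iter p (d x v))) (\<lambda>v. green_iter p (d y v)) = green_iter (2 * p) j"
        "inner (lap (\<lambda>v. green_iter p (d y v))) (\<lambda>v. green_iter p (d x v)) = green_iter (2 * p) j"
        "inner (lap (\<lambda>v. green_iter p (d y v))) (\<lambda>v. green_iter p (d y v)) = green_iter (2 * p) 0"
        using inner_lap_green_iter[of x x p p] inner_lap_green_iter[of x y p p] inner_lap_green_iter[of y x p p]
          inner_lap_green_iter[of y y p p] xy dist_sym[of y x] by (simp_all add: mult_2)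
      thus ?thesis using s by simp
    qed
    finally show ?thesis using lap_nonneg[of f] by simp
  qed
  show ?thesis using sq[of 1] sq[of "-1"] by simp
qed

text \<open>
  The function \<open>adj (h x)\<close> is the sum of the \<open>h y\<close> over the neighbours \<open>y\<close> of \<open>x\<close>, so its
  inner products are sums of values of the kernel \<open>\<xi>\<close>.
\<close>

lemma kernel_relations:
  fixes p :: nat and \<xi> :: "nat \<Rightarrow> real"
  defines "h \<equiv> \<lambda>x v. green_iter p (d x v)"
  assumes \<xi>: "\<And>x y. x \<in> V \<Longrightarrow> y \<in> V \<Longrightarrow> inner (h x) (h y) = \<xi> (d x y)"
  assumes x: "x \<in> V"
  shows "inner (h x) (adj (h x)) = k * \<xi> 1"
    and "inner (adj (h x)) (adj (h x)) = k * (\<xi> 0 + a 1 * \<xi> 1 + b 1 * \<xi> 2)"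
proof -
  have ah: "adj (h x) v = (\<Sum>y\<in>N x. h y v)" if "v \<in> V" for v
  proof -
    have "(\<Sum>y\<in>N x. h y v) = (\<Sum>y\<in>N x. green_iter p (d v y))"
      unfolding h_def using that x nbr_in by (intro sum.cong) (auto simp: dist_sym)
    thus ?thesis using sum_N_radial[of v x "green_iter p"] adj_radial[of x v "green_iter p"] that x
      by (simp add: h_def dist_sym)
  qed
  have pull: "inner f (adj (h x)) = (\<Sum>y\<in>N x. inner f (h y))" for f
  proof -
    have "inner f (adj (h x)) = (\<Sum>v\<in>V. \<Sum>y\<in>N x. f v * h y v)"
      unfolding inner_def by (intro sum.cong) (auto simp: ah sum_distrib_left)
    thus ?thesis unfolding inner_def by (simp add: sum.swap[of _ "N x"])
  qed
  have "inner (h x) (adj (h x)) = (\<Sum>y\<in>N x. \<xi> 1)"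
    unfolding pull using x nbr_in by (intro sum.cong) (auto simp: \<xi> dist_N)
  thus "inner (h x) (adj (h x)) = k * \<xi> 1" using x by (simp add: k_card)
  have in_y: "(\<Sum>z\<in>N x. inner (h y) (h z)) = \<xi> 0 + a 1 * \<xi> 1 + b 1 * \<xi> 2" if y: "y \<in> N x" for y
  proof -
    have yV: "y \<in> V" using y x nbr_in by blast
    have "(\<Sum>z\<in>N x. inner (h y) (h z)) = (\<Sum>z\<in>N x. \<xi> (d y z))"
      using yV x nbr_in by (intro sum.cong) (auto simp: \<xi>)
    also have "\<dots> = radj \<xi> (d y x)" by (rule sum_N_radial[OF yV x])
    also have "d y x = 1" using dist_N'[OF x y] .
    finally show ?thesis using c_1 by (simp add: radj_def numeral_2_eq_2)
  qed
  have "inner (adj (h x)) (adj (h x)) = (\<Sum>y\<in>N x. \<Sum>z\<in>N x. inner (h y) (h z))"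
    unfolding pull by (subst inner_sym) (simp add: pull inner_sym)
  also have "\<dots> = (\<Sum>y\<in>N x. \<xi> 0 + a 1 * \<xi> 1 + b 1 * \<xi> 2)"
    by (intro sum.cong in_y) auto
  finally show "inner (adj (h x)) (adj (h x)) = k * (\<xi> 0 + a 1 * \<xi> 1 + b 1 * \<xi> 2)"
    using x by (simp add: k_card)
qed

text \<open>
  The spectral tool for \<open>c 2 \<ge> 2\<close>. The square norm of the combination of the
  \<open>green_iter p (d x v)\<close>, \<open>x \<in> W\<close>, with coefficients \<open>w x\<close> only involves the values of their
  Gram kernel at the distances \<open>0\<close>, \<open>1\<close> and \<open>2\<close>, since \<open>W\<close> has diameter at most two. Because
  the weights sum to zero, its nonnegativity is an inequality between two differences of
  these values, and by \<open>kernel_relations\<close> these are expressed through \<open>green_iter (2 * p) 0\<close>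
  and one further application of the adjacency operator. The outcome is the estimate that
  one would get if all eigenvalues but the trivial one were at most \<open>b 1 / \<tau> - 1\<close>, that is,
  if the Laplacian had the gap \<open>k + 1 - b 1 / \<tau>\<close>.
\<close>

lemma gap_from_weights:
  fixes w :: "'a \<Rightarrow> real"
  assumes W: "W \<subseteq> V" and diam: "\<And>x y. x \<in> W \<Longrightarrow> y \<in> W \<Longrightarrow> d x y \<le> 2"
    and zero: "(\<Sum>x\<in>W. w x) = 0" and ne: "(\<Sum>x\<in>W. (w x)\<^sup>2) > 0" and \<tau>: "\<tau> > 0"
    and edge: "(\<Sum>x\<in>W. \<Sum>y\<in>W \<inter> N x. w x * w y) \<le> - (1 + \<tau>) * (\<Sum>x\<in>W. (w x)\<^sup>2)"
  shows "(k + 1 - b 1 / \<tau>) * green_iter (2 * p) 0 \<le> walks (2 * p) 0 - k ^ (2 * p) / size_V"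
proof -
  define h where "h x v = green_iter p (d x v)" for x v
  obtain \<xi> where \<xi>: "\<And>x y. x \<in> V \<Longrightarrow> y \<in> V \<Longrightarrow> inner (h x) (h y) = \<xi> (d x y)"
    using radial_inner[of "green_iter p" "green_iter p"] unfolding h_def by blast
  have fW: "finite W" using W fin finite_subset by blast
  define A0 where "A0 = (\<Sum>x\<in>W. (w x)\<^sup>2)"
  define A1 where "A1 = (\<Sum>x\<in>W. \<Sum>y\<in>W \<inter> N x. w x * w y)"
  define F where "F v = (\<Sum>x\<in>W. w x * h x v)" for v
  have "inner F F = (\<Sum>v\<in>V. \<Sum>x\<in>W. \<Sum>y\<in>W. w x * w y * (h x v * h y v))"
    unfolding inner_def F_def by (simp add: sum_product mult_ac)
  also have "\<dots> = (\<Sum>x\<in>W. \<Sum>y\<in>W. \<Sum>v\<in>V. w x * w y * (h x v * h y v))"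
    by (subst sum.swap) (intro sum.cong refl sum.swap)
  also have "\<dots> = (\<Sum>x\<in>W. \<Sum>y\<in>W. w x * w y * \<xi> (d x y))"
    using \<xi> W by (intro sum.cong) (auto simp: inner_def sum_distrib_left[symmetric])
  also have "\<dots> = (\<Sum>x\<in>W. \<Sum>y\<in>W. (if y = x then (w x)\<^sup>2 * (\<xi> 0 - \<xi> 2) else 0)
       + (if y \<in> N x then w x * w y * (\<xi> 1 - \<xi> 2) else 0) + w x * w y * \<xi> 2)"
  proof (intro sum.cong refl)
    fix x y assume xy: "x \<in> W" "y \<in> W"
    hence V: "x \<in> V" "y \<in> V" using W by auto
    have "d x y = 0 \<or> d x y = 1 \<or> d x y = 2" using diam[OF xy] by linarith
    thus "w x * w y * \<xi> (d x y) = (if y = x then (w x)\<^sup>2 * (\<xi> 0 - \<xi> 2) else 0)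
       + (if y \<in> N x then w x * w y * (\<xi> 1 - \<xi> 2) else 0) + w x * w y * \<xi> 2"
      using V dist0[of x y] N_iff[of x y] by (auto simp: power2_eq_square algebra_simps)
  qed
  also have "\<dots> = A0 * (\<xi> 0 - \<xi> 2) + A1 * (\<xi> 1 - \<xi> 2)"
  proof -
    have "(\<Sum>x\<in>W. \<Sum>y\<in>W. w x * w y * \<xi> 2) = 0"
      using zero by (simp add: sum_distrib_left[symmetric] sum_distrib_right[symmetric])
    thus ?thesis unfolding A0_def A1_def using fW
      by (simp add: sum.distrib sum.If_cases sum_distrib_right Int_def)
  qed
  finally have Q: "A0 * (\<xi> 0 - \<xi> 2) + A1 * (\<xi> 1 - \<xi> 2) \<ge> 0"
    using inner_nonneg[of F] by simp
  obtain x where x: "x \<in> V" using V_ne by blast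
  define N0 where "N0 = inner (h x) (h x)"
  define N1 where "N1 = inner (h x) (adj (h x))"
  define N2 where "N2 = inner (adj (h x)) (adj (h x))"
  define m where "m = green_iter (2 * p) 0"
  define X where "X = walks (2 * p) 0 - k ^ (2 * p) / size_V"
  have r: "N1 = k * \<xi> 1" "N2 = k * (\<xi> 0 + a 1 * \<xi> 1 + b 1 * \<xi> 2)" "N0 = \<xi> 0"
    using kernel_relations[of p \<xi> x] \<xi> x unfolding N0_def N1_def N2_def h_def by auto
  have "inner (lap (h x)) (h x) = k * N0 - N1"
    unfolding N0_def N1_def using adj_selfadjoint[of "h x" "h x"] by (simp add: inner_lap_left)
  hence e1: "k * N0 - N1 = m" using inner_lap_green_iter[OF x x, of p p] x by (simp add: h_def[abs_def] m_def mult_2)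
  have "inner (lap (h x)) (adj (h x)) = k * N1 - N2"
    unfolding N1_def N2_def by (simp add: inner_lap_left)
  moreover have "inner (lap (h x)) (adj (h x)) = inner (lap (h x)) (\<lambda>v. green_iter (Suc p) (d x v))"
    using x by (intro inner_cong) (auto simp: h_def[abs_def] adj_radial green_iter_Suc)
  ultimately have "k * N1 - N2 = green_iter (Suc (2 * p)) 0"
    using inner_lap_green_iter[OF x x, of p "Suc p"] x by (simp add: h_def[abs_def] mult_2)
  hence e2: "k * N1 - N2 = k * m - X"
    using green_iter_rec[of 0 "2 * p"] by (simp add: m_def X_def)
  \<comment> \<open>The value of \<open>\<tau>\<close> for which the hypothesis \<open>edge\<close> is an equation; the bound is
    monotone in it.\<close>
  define s where "s = - A1 / A0 - 1"
  have A0: "A0 > 0" using ne by (simp add: A0_def)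
  have s: "s \<ge> \<tau>" using edge A0 unfolding s_def A0_def[symmetric] A1_def[symmetric] by (simp add: field_simps)
  have A1: "A1 = - (1 + s) * A0" using A0 by (simp add: s_def field_simps)
  have "A0 * ((\<xi> 0 - \<xi> 2) - (1 + s) * (\<xi> 1 - \<xi> 2)) \<ge> 0"
    using Q unfolding A1 by (simp add: algebra_simps)
  hence "(\<xi> 0 - \<xi> 2) - (1 + s) * (\<xi> 1 - \<xi> 2) \<ge> 0" using A0 by (simp add: zero_le_mult_iff)
  hence "k * b 1 * ((\<xi> 0 - \<xi> 2) - (1 + s) * (\<xi> 1 - \<xi> 2)) \<ge> 0" by (intro mult_nonneg_nonneg) auto
  moreover have "k * b 1 * ((\<xi> 0 - \<xi> 2) - (1 + s) * (\<xi> 1 - \<xi> 2)) = (b 1 - s) * (k * N0 - N1) - s * (k * N1 - N2)"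
  proof -
    have kr: "real k = 1 + real (a 1) + real (b 1)" using k_b1 by (metis of_nat_add of_nat_1)
    have ident: "K * B * ((z0 - z2) - (1 + s) * (z1 - z2)) =
        (B - s) * (K * z0 - K * z1) - s * (K * (K * z1) - K * (z0 + A * z1 + B * z2))"
      if "K = 1 + A + B" for K A B z0 z1 z2 :: real
      unfolding that by (simp add: algebra_simps)
    show ?thesis unfolding r of_nat_mult using ident[OF kr] by simp
  qed
  ultimately have "s * X \<ge> (s * (k + 1) - b 1) * m" unfolding e1 e2 by (simp add: algebra_simps)
  hence "X \<ge> (k + 1 - b 1 / s) * m" using s \<tau> by (simp add: field_simps)
  moreover have "m \<ge> 0" using green_iter_even_bound[of 0 p] by (simp add: m_def)
  moreover have "b 1 / s \<le> b 1 / \<tau>" using s \<tau> by (intro divide_left_mono) auto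
  ultimately show ?thesis unfolding m_def X_def
    by (smt (verit) mult_right_mono)
qed

lemma a_0: "a 0 = 0" by (simp add: a_def b_0)

lemma walks_nonneg: "walks p j \<ge> 0"
  by (induction p arbitrary: j) (auto simp: walks_def radj_def)

lemma walks_1: "walks 1 j = (if j = 1 then 1 else 0)"
  using c_1 by (auto simp: walks_def radj_def a_0 c_0)

lemma walks_1_0: "walks 1 0 = 0" by (simp only: walks_1) simp

lemma walks_2: "walks 2 0 = k" "walks 2 1 = a 1" "walks 2 2 = c 2"
proof -
  have s: "walks 2 = radj (walks 1)" using walks_Suc[of 1] by (simp add: numeral_2_eq_2)
  show "walks 2 0 = k" "walks 2 1 = a 1" "walks 2 2 = c 2"
    unfolding s by (auto simp: radj_def walks_1[unfolded One_nat_def] b_0 c_0 a_0)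
qed

lemma walks_3: "walks 3 0 = k * a 1" "walks 3 1 = k + a 1 ^ 2 + c 2 * b 1"
proof -
  have s: "walks 3 = radj (walks 2)" using walks_Suc[of 2] by (simp add: numeral_3_eq_3 numeral_2_eq_2)
  show "walks 3 0 = k * a 1" "walks 3 1 = k + a 1 ^ 2 + c 2 * b 1"
    unfolding s using c_1 walks_2 by (auto simp: radj_def b_0 c_0 a_0 power2_eq_square numeral_2_eq_2)
qed

lemma walks_4: "walks 4 0 = k * (k + a 1 ^ 2 + c 2 * b 1)"
proof -
  have s: "walks 4 = radj (walks 3)" using walks_Suc[of 3] by (simp add: eval_nat_numeral)
  show ?thesis unfolding s using walks_3 by (simp add: radj_def b_0 c_0 a_0)
qed

lemma green_iter_step: "j \<le> D \<Longrightarrow> k * (green_iter p 0 - green_iter p j) = walks p 0 - walks p j + (green_iter (Suc p) 0 - green_iter (Suc p) j)"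
  using green_iter_rec[of 0 p] green_iter_rec[of j p] by (simp add: algebra_simps)

text \<open>
  The equation \<open>green_iter_rec\<close> trades a factor \<open>k\<close> for one more application of the
  adjacency operator and a walk count. After an even number of applications the remaining
  difference is controlled by \<open>green_iter_even_bound\<close>; here after two, in \<open>green_drop_two\<close>
  after four.
\<close>

lemma green_drop_one: "k * (green_iter 0 0 - green_iter 0 D) \<le> 1 + 2 * green_iter 2 0 / k"
proof -
  have k0: "real k > 0" using k_gt by simp
  have "k * (green_iter 1 0 - green_iter 1 D) = walks 1 0 - walks 1 D + (green_iter 2 0 - green_iter 2 D)"
    using green_iter_step[of D 1, unfolded Suc_1] by simp
  moreover have "\<bar>green_iter 2 D\<bar> \<le> green_iter 2 0" using green_iter_even_bound[of D 1] by simp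
  ultimately have "k * (green_iter 1 0 - green_iter 1 D) \<le> 2 * green_iter 2 0"
    using walks_nonneg[of 1 D] walks_1_0 by linarith
  hence "green_iter 1 0 - green_iter 1 D \<le> 2 * green_iter 2 0 / k" using k0 by (simp add: field_simps)
  thus ?thesis using green_iter_step[of D 0] D_ge by (simp add: walks_def)
qed

lemma green_drop_two: "k * (green_iter 0 0 - green_iter 0 D) \<le> 1 + 1 / k + a 1 / k ^ 2 + 2 * green_iter 4 0 / k ^ 3"
proof -
  have k0: "real k > 0" using k_gt by simp
  have hb: "\<bar>green_iter 4 D\<bar> \<le> green_iter 4 0" using green_iter_even_bound[of D 2] by simp
  have st: "k * (green_iter 3 0 - green_iter 3 D) = walks 3 0 - walks 3 D + (green_iter 4 0 - green_iter 4 D)"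
    "k * (green_iter 2 0 - green_iter 2 D) = walks 2 0 - walks 2 D + (green_iter 3 0 - green_iter 3 D)"
    "k * (green_iter 1 0 - green_iter 1 D) = walks 1 0 - walks 1 D + (green_iter 2 0 - green_iter 2 D)"
    using green_iter_step[of D 3] green_iter_step[of D 2] green_iter_step[of D 1, unfolded Suc_1] by simp_all
  have "k * (green_iter 3 0 - green_iter 3 D) \<le> k * a 1 + 2 * green_iter 4 0"
    using st(1) hb walks_nonneg[of 3 D] walks_3(1) by linarith
  hence 3: "green_iter 3 0 - green_iter 3 D \<le> a 1 + 2 * green_iter 4 0 / k" using k0 by (simp add: field_simps)
  have "k * (green_iter 2 0 - green_iter 2 D) \<le> k + (a 1 + 2 * green_iter 4 0 / k)"
    using st(2) 3 walks_nonneg[of 2 D] walks_2(1) by linarith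
  hence 2: "green_iter 2 0 - green_iter 2 D \<le> 1 + (a 1 + 2 * green_iter 4 0 / k) / k" using k0 by (simp add: field_simps)
  have "k * (green_iter 1 0 - green_iter 1 D) \<le> 1 + (a 1 + 2 * green_iter 4 0 / k) / k"
    using st(3) 2 walks_nonneg[of 1 D] walks_1_0 by linarith
  hence 1: "green_iter 1 0 - green_iter 1 D \<le> (1 + (a 1 + 2 * green_iter 4 0 / k) / k) / k" using k0 by (simp add: field_simps)
  have "k * (green_iter 0 0 - green_iter 0 D) \<le> 1 + (1 + (a 1 + 2 * green_iter 4 0 / k) / k) / k"
    using green_iter_step[of D 0] D_ge 1 by (simp add: walks_def)
  also have "\<dots> = 1 + 1 / k + a 1 / k ^ 2 + 2 * green_iter 4 0 / k ^ 3"
    using k0 by (simp add: field_simps power2_eq_square power3_eq_cube)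
  finally show ?thesis .
qed

lemma green_diff: "green_iter 0 i - green_iter 0 j = (psi i - psi j) / size_V"
  by (simp add: green_iter_0 green_def diff_divide_distrib)

section \<open>Spectral gaps from small vertex sets\<close>

lemma target_from_green:
  assumes "k * (green_iter 0 0 - green_iter 0 D) < (1 + 6 / k) * (1 - 1 / size_V)"
  shows "psi 0 - psi D < (1 + 6 / k) * (psi 0 - psi 1)"
proof -
  have k0: "real k > 0" using k_gt by simp
  have "k * ((psi 0 - psi D) / size_V) < (1 + 6 / k) * ((size_V - 1) / size_V)"
    using assms size_V_pos unfolding green_diff by (simp add: diff_divide_distrib)
  hence "k * (psi 0 - psi D) / size_V < (1 + 6 / k) * (size_V - 1) / size_V" by simp
  hence "k * (psi 0 - psi D) < (1 + 6 / k) * (size_V - 1)"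
    using size_V_pos by (simp add: divide_less_cancel)
  hence "psi 0 - psi D < (1 + 6 / k) * (size_V - 1) / k" using k0 by (simp add: field_simps)
  thus ?thesis unfolding psi_01 by simp
qed

lemma green_iter_even_nonneg: "green_iter (2 * p) 0 \<ge> 0"
  using green_iter_even_bound[of 0 p] by simp

text \<open>
  With a gap of at least a third of the valency, the remainder \<open>2 * green_iter 2 0 / k\<close> of
  \<open>green_drop_one\<close> is at most \<open>6 / k - 6 / size_V\<close>.
\<close>

lemma target_from_large_gap:
  assumes "\<gamma> \<ge> k / 3" "\<gamma> * green_iter 2 0 \<le> walks 2 0 - k ^ 2 / size_V"
  shows "psi 0 - psi D < (1 + 6 / k) * (psi 0 - psi 1)"
proof (rule target_from_green)
  have k0: "real k \<ge> 3" using k_gt by simp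
  have "green_iter 2 0 \<ge> 0" using green_iter_even_nonneg[of 1] by simp
  hence "real k / 3 * green_iter 2 0 \<le> \<gamma> * green_iter 2 0" using assms(1) by (intro mult_right_mono)
  also have "\<dots> \<le> real k - real k ^ 2 / size_V" using assms(2) walks_2(1) by simp
  finally have "real k / 3 * green_iter 2 0 \<le> real k / 3 * (3 - 3 * (k / size_V))" 
    by (simp add: power2_eq_square algebra_simps)
  hence "green_iter 2 0 \<le> 3 - 3 * (k / size_V)" using k0 by (subst (asm) mult_le_cancel_left_pos) auto
  hence "2 * green_iter 2 0 / k \<le> 2 * (3 - 3 * (k / size_V)) / k" using k0 by (intro divide_right_mono) auto
  also have "\<dots> = 6 / k - 6 / size_V" using k0 by (simp add: field_simps)
  finally have "k * (green_iter 0 0 - green_iter 0 D) \<le> 1 + 6 / k - 6 / size_V" using green_drop_one by simp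
  also have "\<dots> < 1 + 6 / k - (1 + 6 / k) / size_V"
  proof -
    have "6 / real k \<le> 2" using k0 by (simp add: field_simps)
    hence "1 + 6 / real k < 6" by simp
    hence "(1 + 6 / k) / size_V < 6 / size_V" using size_V_pos by (simp add: divide_strict_right_mono)
    thus ?thesis by simp
  qed
  finally show "k * (green_iter 0 0 - green_iter 0 D) < (1 + 6 / k) * (1 - 1 / size_V)" by (simp add: right_diff_distrib)
qed

text \<open>
  A gap far below \<open>k\<close> suffices when there are few closed walks of length four: their number
  is \<open>k * (k + a 1 ^ 2 + c 2 * b 1)\<close>, and the expansion of \<open>green_drop_two\<close> has room for it.
\<close>

lemma target_from_moderate_gap:
  fixes \<gamma> :: real
  assumes \<gamma>: "\<gamma> > 0" "\<gamma> \<le> real k" "\<gamma> * green_iter 4 0 \<le> walks 4 0 - k ^ 4 / size_V"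
    and Z: "2 * (real k + real (a 1) ^ 2 + real (c 2) * real (b 1)) \<le> \<gamma> * (5 * real k - 4 - real (a 1))"
  shows "psi 0 - psi D < (1 + 6 / k) * (psi 0 - psi 1)"
proof (rule target_from_green)
  have k0: "real k \<ge> 3" using k_gt by simp
  define z where "z = real (k + a 1 ^ 2 + c 2 * b 1)"
  have "2 * green_iter 4 0 \<le> 2 * ((k * z - k ^ 4 / size_V) / \<gamma>)"
    using \<gamma> walks_4 by (simp add: field_simps z_def)
  also have "\<dots> = 2 * z / \<gamma> * k - 2 * (k ^ 4 / (size_V * \<gamma>))" using \<gamma> by (simp add: field_simps)
  also have "\<dots> \<le> (5 * real k - 4 - real (a 1)) * real k - 2 * (real k ^ 4 / (size_V * real k))"
  proof -
    have "2 * z / \<gamma> \<le> 5 * real k - 4 - real (a 1)" using Z \<gamma>(1) by (simp add: field_simps z_def)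
    moreover have "real k ^ 4 / (size_V * real k) \<le> real k ^ 4 / (size_V * \<gamma>)"
      using \<gamma> size_V_pos k0 by (intro divide_left_mono mult_left_mono) auto
    ultimately show ?thesis using k0 by (intro diff_mono mult_right_mono) auto
  qed
  also have "real k ^ 4 / (size_V * real k) = real k ^ 3 / size_V" using k0 by (simp add: power4_eq_xxxx power3_eq_cube)
  finally have "2 * green_iter 4 0 / real k ^ 3 \<le> ((5 * real k - 4 - real (a 1)) * real k - 2 * (real k ^ 3 / size_V)) / real k ^ 3"
    using k0 by (intro divide_right_mono) auto
  also have "\<dots> = (5 * real k - 4 - real (a 1)) / real k ^ 2 - 2 / size_V"
    using k0 size_V_pos by (simp add: field_simps power2_eq_square power3_eq_cube)
  finally have "k * (green_iter 0 0 - green_iter 0 D) \<le> 1 + 1 / k + a 1 / k ^ 2 + ((5 * real k - 4 - real (a 1)) / real k ^ 2 - 2 / size_V)"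
    using green_drop_two by simp
  also have "\<dots> = 1 + 6 / k - 4 / k ^ 2 - 2 / size_V"
    using k0 by (simp add: field_simps power2_eq_square)
  also have "\<dots> < 1 + 6 / k - (1 + 6 / k) / size_V"
  proof -
    have "size_V \<ge> 4"
    proof -
      obtain x where x: "x \<in> V" using V_ne by blast
      have "insert x (N x) \<subseteq> V" using x nbr_in by auto
      hence "card (insert x (N x)) \<le> card V" using fin card_mono by blast
      thus ?thesis using x fin_N N_irrefl k_card k_gt by (simp add: size_V_def)
    qed
    have "real k * (6 - real k) \<le> 9" using zero_le_power2[of "real k - 3"] by (simp add: power2_eq_square algebra_simps)
    hence "real k * (6 - real k) < 4 * size_V" using \<open>size_V \<ge> 4\<close> by linarith
    hence "(real k * (6 - real k)) / (real k ^ 2 * size_V) < (4 * size_V) / (real k ^ 2 * size_V)" 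
      using k0 size_V_pos by (intro divide_strict_right_mono) auto
    moreover have "(real k * (6 - real k)) / (real k ^ 2 * size_V) = (6 / k - 1) / size_V"
      using k0 size_V_pos by (simp add: field_simps power2_eq_square)
    moreover have "(4 * size_V) / (real k ^ 2 * size_V) = 4 / real k ^ 2" using size_V_pos by simp
    ultimately have "(6 / k - 1) / size_V < 4 / k ^ 2" by simp
    thus ?thesis by (simp add: add_divide_distrib diff_divide_distrib)
  qed
  finally show "k * (green_iter 0 0 - green_iter 0 D) < (1 + 6 / k) * (1 - 1 / size_V)" by (simp add: right_diff_distrib)
qed

lemma common_nbr_dist: 
  assumes "y \<in> V" "p \<in> N y" "q \<in> N y" shows "d p q \<le> 2"
proof -
  have "p \<in> V" "q \<in> V" using assms nbr_in by auto
  thus ?thesis using dist_tri[of p y q] assms dist_N[of y q] dist_N'[of y p] by simp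
qed

lemma dist2I:
  assumes "y \<in> V" "p \<in> N y" "q \<in> N y" "p \<noteq> q" "q \<notin> N p" shows "d p q = 2"
proof -
  have V: "p \<in> V" "q \<in> V" using assms nbr_in by auto
  have "d p q \<noteq> 0" "d p q \<noteq> 1" using V assms dist0[of p q] N_iff[of p q] by auto
  thus ?thesis using common_nbr_dist[OF assms(1-3)] by linarith
qed

text \<open>
  Alternating weights on the quadrangle: the two neighbours of each vertex have the opposite
  sign, so the weights form an eigenvector with eigenvalue \<open>-2\<close>.
\<close>

lemma quadrangle_gap:
  assumes V: "x \<in> V" "z \<in> V" "d x z = 2" and u: "u \<in> N x \<inter> N z" "u' \<in> N x \<inter> N z" "u \<noteq> u'" "u' \<notin> N u"
  shows "(a 1 + 2) * green_iter (2 * p) 0 \<le> walks (2 * p) 0 - k ^ (2 * p) / size_V"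
proof -
  have uV: "u \<in> V" "u' \<in> V" using u V nbr_in by auto
  have duu: "d u u' = 2" using dist2I[of x u u'] V u by auto
  have ne: "x \<noteq> z" "x \<noteq> u" "x \<noteq> u'" "z \<noteq> u" "z \<noteq> u'" using V u N_irrefl by auto
  have nb: "u \<in> N x" "u' \<in> N x" "u \<in> N z" "u' \<in> N z" "x \<in> N u" "z \<in> N u" "x \<in> N u'" "z \<in> N u'"
    using u V N_symD by auto
  have nn': "z \<notin> N x" "x \<notin> N z" "u \<notin> N u'" "u' \<notin> N u" "x \<notin> N x" "z \<notin> N z" "u \<notin> N u" "u' \<notin> N u'"
  proof -
    show "z \<notin> N x" "x \<notin> N z" using dist_N[of x z] dist_N'[of z x] V by auto
    show "u \<notin> N u'" "u' \<notin> N u" using dist_N[of u u'] dist_N'[of u' u] duu uV by auto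
  qed (simp_all add: V uV N_irrefl)
  define w where "w v = (if v = x \<or> v = z then 1 else -1 :: real)" for v
  let ?W = "{x, z, u, u'}"
  have Wn: "?W \<inter> N x = {u, u'}" "?W \<inter> N z = {u, u'}" "?W \<inter> N u = {x, z}" "?W \<inter> N u' = {x, z}"
    using nb nn' by auto
  have "(k + 1 - b 1 / (1::real)) * green_iter (2 * p) 0 \<le> walks (2 * p) 0 - k ^ (2 * p) / size_V"
  proof (rule gap_from_weights[of ?W w])
    show "?W \<subseteq> V" using V uV by auto
    fix s t assume "s \<in> ?W" "t \<in> ?W"
    thus "d s t \<le> 2" using V uV duu dist_sym[of x z] dist_sym[of u u']
        dist_N[OF _ nb(1)] dist_N[OF _ nb(2)] dist_N[OF _ nb(3)] dist_N[OF _ nb(4)] 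
        dist_N'[OF _ nb(1)] dist_N'[OF _ nb(2)] dist_N'[OF _ nb(3)] dist_N'[OF _ nb(4)] by auto
  next
    show "(\<Sum>v\<in>?W. w v) = 0" using ne u by (simp add: w_def)
    show "(\<Sum>v\<in>?W. (w v)\<^sup>2) > 0" using ne u by (simp add: w_def)
    show "(\<Sum>s\<in>?W. \<Sum>t\<in>?W \<inter> N s. w s * w t) \<le> - (1 + 1) * (\<Sum>v\<in>?W. (w v)\<^sup>2)"
    proof -
      have "(\<Sum>s\<in>?W. \<Sum>t\<in>?W \<inter> N s. w s * w t) = -8"
        using ne u(3) by (simp add: Wn w_def)
      moreover have "(\<Sum>v\<in>?W. (w v)\<^sup>2) = 4" using ne u(3) by (simp add: w_def)
      ultimately show ?thesis by simp
    qed
  qed simp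
  moreover have "real (k + 1) - b 1 / (1::real) = real (a 1 + 2)" using k_b1 by simp
  ultimately show ?thesis by (simp only:)
qed

text \<open>
  The weight \<open>c 2\<close> on two vertices at distance two is balanced by \<open>-2\<close> on each of their
  common neighbours. The only edges between weights of equal sign join common neighbours, at
  most \<open>a 1\<close> at each, which is little compared with \<open>c 2\<close>.
\<close>

lemma many_paths_gap:
  assumes "c 2 \<ge> 2 * a 1 + 5"
  shows "(k + 1 - b 1 / (3 / 2)) * green_iter (2 * p) 0 \<le> walks (2 * p) 0 - k ^ (2 * p) / size_V"
proof -
  obtain x z where V: "x \<in> V" "z \<in> V" "d x z = 2" using vertex_pair_ex[of 2] D_ge by auto
  define C where "C = N x \<inter> N z"
  define m where "m = real (c 2)"
  have m: "m \<ge> 2 * a 1 + 5" using assms by (simp add: m_def)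
  have cC: "real (card C) = m" using card_common_2[OF V] by (simp add: C_def m_def)
  have fC: "finite C" using V fin_N by (simp add: C_def)
  have CV: "C \<subseteq> V" using V nbr_in by (auto simp: C_def)
  have ne: "x \<noteq> z" "x \<notin> C" "z \<notin> C" using V N_irrefl by (auto simp: C_def)
  have nx: "z \<notin> N x" "x \<notin> N z" using dist_N[of x z] dist_N'[of z x] V by auto
  define w where "w v = (if v = x \<or> v = z then m else -2 :: real)" for v
  let ?W = "insert x (insert z C)"
  have wC: "w v = -2" if "v \<in> C" for v using that ne by (auto simp: w_def)
  have A0: "(\<Sum>v\<in>?W. (w v)\<^sup>2) = 2 * m\<^sup>2 + 4 * m"
    using ne fC cC wC by (simp add: w_def[of x] w_def[of z])
  show ?thesis
  proof (rule gap_from_weights[of ?W w])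
    show "?W \<subseteq> V" using V CV by auto
    fix s t assume "s \<in> ?W" "t \<in> ?W"
    moreover have "d s t \<le> 2" if "s \<in> C" "t \<in> C" for s t
      using that common_nbr_dist[of x s t] V by (auto simp: C_def)
    moreover have "d s x \<le> 2" "d s z \<le> 2" "d x s \<le> 2" "d z s \<le> 2" if "s \<in> C" for s
      using that V dist_N[of x s] dist_N[of z s] dist_N'[of x s] dist_N'[of z s] by (auto simp: C_def)
    ultimately show "d s t \<le> 2" using V dist_sym[of z x] by auto
  next
    show "(\<Sum>v\<in>?W. w v) = 0" using ne fC cC wC by (simp add: w_def[of x] w_def[of z])
    show "(\<Sum>v\<in>?W. (w v)\<^sup>2) > 0" 
    proof -
      have "m > 0" using m by simp
      thus ?thesis unfolding A0 by (simp add: add_pos_pos)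
    qed
    show "(3 / 2 :: real) > 0" by simp
    have Wx: "?W \<inter> N x = C" "?W \<inter> N z = C"
      using nx V N_irrefl by (auto simp: C_def)
    have row_x: "(\<Sum>t\<in>?W \<inter> N x. w x * w t) = - 2 * m\<^sup>2" "(\<Sum>t\<in>?W \<inter> N z. w z * w t) = - 2 * m\<^sup>2"
      unfolding Wx using wC cC by (simp_all add: w_def[of x] w_def[of z] power2_eq_square)
    have row: "(\<Sum>t\<in>?W \<inter> N s. w s * w t) \<le> - 4 * m + 4 * a 1" if s: "s \<in> C" for s
    proof -
      have sx: "x \<in> N s" "z \<in> N s" "s \<in> N x" using s V N_symD by (auto simp: C_def)
      have "?W \<inter> N s = insert x (insert z (C \<inter> N s))" using sx by auto
      hence "(\<Sum>t\<in>?W \<inter> N s. w s * w t) = w s * w x + (w s * w z + (\<Sum>t\<in>C \<inter> N s. w s * w t))"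
        using ne fC by simp
      also have "(\<Sum>t\<in>C \<inter> N s. w s * w t) = 4 * card (C \<inter> N s)"
        using wC s by simp
      also have "card (C \<inter> N s) \<le> card (N x \<inter> N s)"
        using V fin_N by (intro card_mono) (auto simp: C_def)
      also have "card (N x \<inter> N s) = a 1" using card_common_adj[of x s] V sx by simp
      finally show ?thesis using wC[OF s] by (simp add: w_def[of x] w_def[of z])
    qed
    have "(\<Sum>s\<in>?W. \<Sum>t\<in>?W \<inter> N s. w s * w t) = - 4 * m\<^sup>2 + (\<Sum>s\<in>C. \<Sum>t\<in>?W \<inter> N s. w s * w t)"
      using ne fC row_x by simp
    also have "\<dots> \<le> - 4 * m\<^sup>2 + (\<Sum>s\<in>C. - 4 * m + 4 * a 1)"
      by (intro add_left_mono sum_mono row)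
    also have "\<dots> = - 8 * m\<^sup>2 + 4 * a 1 * m" using cC by (simp add: power2_eq_square algebra_simps)
    also have "\<dots> \<le> - (1 + 3 / 2) * (2 * m\<^sup>2 + 4 * m)"
    proof -
      have "0 \<le> m * (3 * m - 4 * a 1 - 10)" using m by (intro mult_nonneg_nonneg) auto
      thus ?thesis by (simp add: power2_eq_square algebra_simps)
    qed
    finally show "(\<Sum>s\<in>?W. \<Sum>t\<in>?W \<inter> N s. w s * w t) \<le> - (1 + 3 / 2) * (\<Sum>v\<in>?W. (w v)\<^sup>2)"
      unfolding A0 .
  qed
qed

definition private_nbrs :: "'a \<Rightarrow> 'a \<Rightarrow> 'a \<Rightarrow> 'a set" where
  "private_nbrs y p q = N y \<inter> N p - N q - {q}"

lemma card_private_nbrs: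
  assumes "y \<in> V" "p \<in> N y" "q \<in> N y \<inter> N p"
  shows "card (private_nbrs y p q) + card (N y \<inter> N p \<inter> N q) + 1 = a 1"
proof -
  have V: "p \<in> V" "q \<in> V" using assms nbr_in by auto
  have "N y \<inter> N p = insert q (private_nbrs y p q \<union> (N y \<inter> N p \<inter> N q))" using assms by (auto simp: private_nbrs_def)
  moreover have "q \<notin> private_nbrs y p q \<union> (N y \<inter> N p \<inter> N q)" using V N_irrefl by (auto simp: private_nbrs_def)
  moreover have "finite (N y)" using fin_N assms by simp
  ultimately have "card (N y \<inter> N p) = Suc (card (private_nbrs y p q \<union> (N y \<inter> N p \<inter> N q)))"
    by (metis card_insert_disjoint finite_Int finite_insert)
  also have "card (private_nbrs y p q \<union> (N y \<inter> N p \<inter> N q)) = card (private_nbrs y p q) + card (N y \<inter> N p \<inter> N q)"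
    using \<open>finite (N y)\<close> by (intro card_Un_disjoint) (auto simp: private_nbrs_def)
  finally show ?thesis using card_common_adj assms by simp
qed

lemma private_nbrs_swap: 
  assumes "y \<in> V" "p \<in> N y" "q \<in> N y \<inter> N p"
  shows "card (private_nbrs y p q) = card (private_nbrs y q p)"
proof -
  have "p \<in> N y \<inter> N q" using assms nbr_in N_symD[of p q] by auto
  moreover have "q \<in> N y" using assms by auto
  moreover have "N y \<inter> N p \<inter> N q = N y \<inter> N q \<inter> N p" by auto
  ultimately show ?thesis using card_private_nbrs[OF assms] card_private_nbrs[of y q p] assms(1) by simp
qed

text \<open>
  In the neighbourhood of \<open>y\<close>, the weights \<open>h\<close> on \<open>p\<close> and \<open>-h\<close> on \<open>q\<close> are balanced by \<open>-1\<close>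
  on the vertices attached to \<open>p\<close> only and \<open>1\<close> on those attached to \<open>q\<close> only. The weights
  have large edge sums at \<open>p\<close> and \<open>q\<close>; inside each of the two groups a vertex has at most
  \<open>h - 1\<close> neighbours of its own sign.
\<close>

lemma triangle_gap:
  assumes y: "y \<in> V" and p: "p \<in> N y" and q: "q \<in> N y \<inter> N p" and h: "h = card (private_nbrs y p q)" "h > 0"
  shows "(a 1 + 2 - b 1 / h) * green_iter (2 * n) 0 \<le> walks (2 * n) 0 - k ^ (2 * n) / size_V"
proof -
  have V: "p \<in> V" "q \<in> V" using y p q nbr_in by auto
  define P where "P = private_nbrs y p q"
  define Q where "Q = private_nbrs y q p"
  have fPQ: "finite P" "finite Q" using fin_N y by (auto simp: P_def Q_def private_nbrs_def)
  have hP: "card P = h" using h by (simp add: P_def)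
  have hQ: "card Q = h" using private_nbrs_swap[OF y p q] h by (simp add: Q_def)
  have pq: "q \<in> N p" "p \<in> N q" "p \<noteq> q" using q V N_symD N_irrefl by auto
  have PN: "P \<subseteq> N p" "P \<inter> N q = {}" "Q \<subseteq> N q" "Q \<inter> N p = {}" "P \<inter> Q = {}" by (auto simp: P_def Q_def private_nbrs_def)
  have nin: "p \<notin> P" "q \<notin> P" "p \<notin> Q" "q \<notin> Q" "p \<notin> N p" "q \<notin> N q" using V N_irrefl by (auto simp: P_def Q_def private_nbrs_def)
  have PV: "P \<subseteq> V" "Q \<subseteq> V" using y nbr_in by (auto simp: P_def Q_def private_nbrs_def)
  define w where "w v = (if v = p then real h else if v = q then - real h else if v \<in> P then -1 else 1)" for v
  have wv: "w p = h" "w q = - real h" using pq by (auto simp: w_def)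
  have wP: "w v = -1" if "v \<in> P" for v using that nin by (auto simp: w_def)
  have wQ: "w v = 1" if "v \<in> Q" for v using that nin PN by (auto simp: w_def)
  \<comment> \<open>The sets \<open>P\<close> and \<open>Q\<close> have the same size by \<open>private_nbrs_swap\<close>, so the weights add
    up to zero.\<close>
  let ?W = "insert p (insert q (P \<union> Q))"
  have sumW: "(\<Sum>v\<in>?W. F v) = F p + F q + (\<Sum>v\<in>P. F v) + (\<Sum>v\<in>Q. F v)" for F :: "'a \<Rightarrow> real"
    using nin pq fPQ PN(5) by (simp add: sum.union_disjoint)
  have A0: "(\<Sum>v\<in>?W. (w v)\<^sup>2) = 2 * real h * (real h + 1)"
    using hP hQ wP wQ by (simp add: sumW wv power2_eq_square algebra_simps)
  have hr: "real h > 0" using h by simp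
  have "(k + 1 - b 1 / (real h / (real h + 1))) * green_iter (2 * n) 0 \<le> walks (2 * n) 0 - k ^ (2 * n) / size_V"
  proof (rule gap_from_weights[of ?W w])
    show "?W \<subseteq> V" using V PV by auto
    fix s t assume "s \<in> ?W" "t \<in> ?W"
    hence "s \<in> N y" "t \<in> N y" using p q by (auto simp: P_def Q_def private_nbrs_def)
    thus "d s t \<le> 2" using common_nbr_dist[OF y] by simp
  next
    show "(\<Sum>v\<in>?W. w v) = 0" using hP hQ wP wQ by (simp add: sumW wv)
    show "(\<Sum>v\<in>?W. (w v)\<^sup>2) > 0" unfolding A0 using hr by simp
    show "real h / (real h + 1) > 0" using hr by simp
    have rp: "(\<Sum>t\<in>?W \<inter> N p. w p * w t) = - 2 * (real h)\<^sup>2"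
    proof -
      have "?W \<inter> N p = insert q P" using pq PN nin by auto
      thus ?thesis using fPQ nin hP wP by (simp add: wv power2_eq_square)
    qed
    have rq: "(\<Sum>t\<in>?W \<inter> N q. w q * w t) = - 2 * (real h)\<^sup>2"
    proof -
      have "?W \<inter> N q = insert p Q" using pq PN nin by auto
      thus ?thesis using fPQ nin hQ wQ by (simp add: wv power2_eq_square)
    qed
    have card_less: "card (P \<inter> N s) \<le> h - 1" if "s \<in> P" for s
    proof -
      have "P \<inter> N s \<subseteq> P - {s}" using that PV N_irrefl by auto
      hence "card (P \<inter> N s) \<le> card (P - {s})" using fPQ by (intro card_mono) auto
      thus ?thesis using that fPQ hP by simp
    qed
    have card_less': "card (Q \<inter> N s) \<le> h - 1" if "s \<in> Q" for s
    proof -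
      have "Q \<inter> N s \<subseteq> Q - {s}" using that PV N_irrefl by auto
      hence "card (Q \<inter> N s) \<le> card (Q - {s})" using fPQ by (intro card_mono) auto
      thus ?thesis using that fPQ hQ by simp
    qed
    have rP: "(\<Sum>t\<in>?W \<inter> N s. w s * w t) \<le> -1" if s: "s \<in> P" for s
    proof -
      have "p \<in> N s" "q \<notin> N s" using s PN PV V N_symD by blast+
      hence "?W \<inter> N s = insert p ((P \<inter> N s) \<union> (Q \<inter> N s))" by auto
      hence "(\<Sum>t\<in>?W \<inter> N s. w s * w t) = w s * w p + ((\<Sum>t\<in>P \<inter> N s. w s * w t) + (\<Sum>t\<in>Q \<inter> N s. w s * w t))"
        using nin fPQ PN(5) by (subst sum.union_disjoint[symmetric]) auto
      also have "\<dots> = - real h + card (P \<inter> N s) - card (Q \<inter> N s)"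
        using wP wQ s by (simp add: wv)
      also have "\<dots> \<le> -1" using card_less[OF s] h by linarith
      finally show ?thesis .
    qed
    have rQ: "(\<Sum>t\<in>?W \<inter> N s. w s * w t) \<le> -1" if s: "s \<in> Q" for s
    proof -
      have "q \<in> N s" "p \<notin> N s" using s PN PV V N_symD by blast+
      hence "?W \<inter> N s = insert q ((P \<inter> N s) \<union> (Q \<inter> N s))" by auto
      hence "(\<Sum>t\<in>?W \<inter> N s. w s * w t) = w s * w q + ((\<Sum>t\<in>P \<inter> N s. w s * w t) + (\<Sum>t\<in>Q \<inter> N s. w s * w t))"
        using nin fPQ PN(5) by (subst sum.union_disjoint[symmetric]) auto
      also have "\<dots> = - real h - card (P \<inter> N s) + card (Q \<inter> N s)"
        using wP wQ s by (simp add: wv)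
      also have "\<dots> \<le> -1" using card_less'[OF s] h by linarith
      finally show ?thesis .
    qed
    have "(\<Sum>s\<in>?W. \<Sum>t\<in>?W \<inter> N s. w s * w t) \<le> - 2 * (real h)\<^sup>2 + - 2 * (real h)\<^sup>2 + (\<Sum>s\<in>P. -1) + (\<Sum>s\<in>Q. -1)"
      unfolding sumW rp rq by (intro add_mono sum_mono rP rQ order_refl)
    also have "\<dots> = - (1 + real h / (real h + 1)) * (2 * real h * (real h + 1))"
      using hr hP hQ by (simp add: field_simps power2_eq_square)
    finally show "(\<Sum>s\<in>?W. \<Sum>t\<in>?W \<inter> N s. w s * w t) \<le> - (1 + real h / (real h + 1)) * (\<Sum>v\<in>?W. (w v)\<^sup>2)"
      unfolding A0 by simp
  qed
  moreover have "real (k + 1) - b 1 / (real h / (real h + 1)) = real (a 1 + 2) - b 1 / h"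
  proof -
    have "real k = 1 + real (a 1) + real (b 1)" using k_b1 by (metis of_nat_add of_nat_1)
    thus ?thesis using hr by (simp add: field_simps)
  qed
  ultimately show ?thesis by (simp only:)
qed

section \<open>Several common neighbours at distance two\<close>

lemma quadrangle_target:
  assumes V: "x \<in> V" "z \<in> V" "d x z = 2" and u: "u \<in> N x \<inter> N z" "u' \<in> N x \<inter> N z" "u \<noteq> u'" "u' \<notin> N u"
    and few: "c 2 \<le> 2 * a 1 + 4"
  shows "psi 0 - psi D < (1 + 6 / k) * (psi 0 - psi 1)"
proof (rule target_from_moderate_gap)
  define \<alpha> \<beta> \<mu> where "\<alpha> = real (a 1)" and "\<beta> = real (b 1)" and "\<mu> = real (c 2)"
  have kr: "real k = 1 + \<alpha> + \<beta>" unfolding \<alpha>_def \<beta>_def using k_b1 by (metis of_nat_add of_nat_1)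
  have pos: "\<alpha> \<ge> 0" "\<beta> \<ge> 1" "\<mu> \<le> 2 * \<alpha> + 4" 
    using b_pos[of 1] D_ge few by (auto simp: \<alpha>_def \<beta>_def \<mu>_def)
  show "real (a 1 + 2) > 0" by simp
  show "real (a 1 + 2) \<le> k" using kr pos by (simp add: \<alpha>_def)
  show "real (a 1 + 2) * green_iter 4 0 \<le> walks 4 0 - k ^ 4 / size_V"
    using quadrangle_gap[OF V u, of 2] by simp
  have "\<mu> * \<beta> \<le> (2 * \<alpha> + 4) * \<beta>" using pos by (intro mult_right_mono) auto
  moreover have "0 \<le> 2 * \<alpha> * \<alpha> + 7 * \<alpha> + \<alpha> * \<beta>" using pos by simp
  ultimately have "2 * (real k + \<alpha> ^ 2 + \<mu> * \<beta>) \<le> (\<alpha> + 2) * (5 * real k - 4 - \<alpha>)"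
    unfolding kr by (simp add: power2_eq_square algebra_simps)
  thus "2 * (real k + real (a 1) ^ 2 + real (c 2) * real (b 1)) \<le> real (a 1 + 2) * (5 * real k - 4 - real (a 1))"
    unfolding \<alpha>_def \<beta>_def \<mu>_def of_nat_add of_nat_numeral .
qed

text \<open>
  Equivalently, there is no induced quadrangle.
\<close>

definition clique_paths :: bool where
  "clique_paths \<longleftrightarrow> (\<forall>x\<in>V. \<forall>z\<in>V. \<forall>u\<in>N x \<inter> N z. \<forall>u'\<in>N x \<inter> N z. d x z = 2 \<longrightarrow> u \<noteq> u' \<longrightarrow> u' \<in> N u)"

lemma clique_pathsD:
  "clique_paths \<Longrightarrow> x \<in> V \<Longrightarrow> z \<in> V \<Longrightarrow> d x z = 2 \<Longrightarrow> u \<in> N x \<inter> N z \<Longrightarrow> u' \<in> N x \<inter> N z \<Longrightarrow> u \<noteq> u' \<Longrightarrow> u' \<in> N u"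
  unfolding clique_paths_def by blast

text \<open>
  On a geodesic \<open>x0\<close>, \<open>x1\<close>, \<open>x2\<close>, \<open>x3\<close> every other common neighbour of \<open>x0\<close> and \<open>x2\<close> is
  adjacent to \<open>x1\<close>, and every other common neighbour of \<open>x1\<close> and \<open>x3\<close> is adjacent to \<open>x2\<close>.
  All of them are common neighbours of \<open>x1\<close> and \<open>x2\<close>, and the two families are disjoint
  because \<open>x0\<close> and \<open>x3\<close> are far apart.
\<close>

lemma clique_paths_c2:
  assumes cl: clique_paths shows "2 * (c 2 - 1) \<le> a 1"
proof -
  obtain x0 x3 where x03: "x0 \<in> V" "x3 \<in> V" "d x0 x3 = 1 + 2" using vertex_pair_ex[of 3] D_ge by auto
  obtain x1 where x1: "x1 \<in> V" "d x0 x1 = 1" "d x1 x3 = 2" using geodesic_split[OF x03] by blast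
  obtain x2 where x2: "x2 \<in> V" "d x1 x2 = 1" "d x2 x3 = 1" 
    using geodesic_split[OF x1(1) x03(2), of 1 1] x1 by auto
  have d02: "d x0 x2 = 2" using dist_tri[of x0 x1 x2] dist_tri[of x0 x2 x3] x03 x1 x2 by simp
  have nb: "x1 \<in> N x0" "x2 \<in> N x1" "x3 \<in> N x2" using N_iff x03 x1 x2 by auto
  have nb': "x0 \<in> N x1" "x1 \<in> N x2" "x2 \<in> N x3" using nb N_symD x03 x1 x2 by auto
  define A where "A = N x0 \<inter> N x2 - {x1}"
  define B where "B = N x1 \<inter> N x3 - {x2}"
  have "card (N x0 \<inter> N x2) = c 2" "card (N x1 \<inter> N x3) = c 2"
    using card_common_2 x03 x1 x2 d02 by auto
  hence cAB: "card A = c 2 - 1" "card B = c 2 - 1" using nb nb' by (auto simp: A_def B_def)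
  have fAB: "finite A" "finite B" using fin_N x03 x1 x2 by (auto simp: A_def B_def)
  have "A \<subseteq> N x1 \<inter> N x2"
    using clique_pathsD[OF cl x03(1) x2(1) d02, of x1] nb nb' by (auto simp: A_def)
  moreover have "B \<subseteq> N x1 \<inter> N x2"
    using clique_pathsD[OF cl x1(1) x03(2) x1(3), of x2] nb nb' by (auto simp: B_def)
  moreover have "A \<inter> B = {}"
  proof -
    have False if w: "w \<in> N x0" "w \<in> N x3" for w
    proof -
      have "w \<in> V" using w nbr_in x03 by blast
      thus False using dist_tri[of x0 w x3] dist_N[OF x03(1) w(1)] dist_N'[OF x03(2) w(2)] x03 by simp
    qed
    thus ?thesis by (auto simp: A_def B_def)
  qed
  ultimately have "card A + card B \<le> card (N x1 \<inter> N x2)"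
    using fAB fin_N[OF x1(1)] by (metis Un_least card_Un_disjoint card_mono finite_Int)
  also have "\<dots> = a 1" using card_common_adj[OF x1(1) nb(2)] .
  finally show ?thesis using cAB by simp
qed

text \<open>
  Count the edges between the common neighbours \<open>s\<close> of \<open>y\<close> and \<open>p\<close> and the neighbours \<open>w\<close> of
  \<open>y\<close> at distance two from \<open>p\<close>. The \<open>c 2\<close> common neighbours of \<open>p\<close> and \<open>w\<close> are \<open>y\<close> and
  vertices adjacent to \<open>y\<close>, so every \<open>w\<close> has exactly \<open>c 2 - 1\<close> such edges.
\<close>

lemma clique_paths_count:
  assumes cl: clique_paths and y: "y \<in> V" and p: "p \<in> N y"
  shows "(\<Sum>s\<in>N y \<inter> N p. card (private_nbrs y p s)) = b 1 * (c 2 - 1)"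
proof -
  have pV: "p \<in> V" using y p nbr_in by blast
  define S where "S = N y \<inter> N p"
  define U where "U = up p y"
  have fin': "finite S" "finite U" using fin_N y fin_parts(3)[OF y] by (auto simp: S_def U_def)
  have U_eq: "U = N y - N p - {p}" using up_eq_far[OF pV N_symD[OF y p]] by (simp add: U_def)
  have "(\<Sum>s\<in>S. card (private_nbrs y p s)) = (\<Sum>s\<in>S. card {w \<in> U. w \<in> N s})"
  proof (rule sum.cong[OF refl])
    fix s assume "s \<in> S"
    hence s: "s \<in> N y \<inter> N p" by (simp add: S_def)
    have "card (private_nbrs y p s) = card (private_nbrs y s p)" by (rule private_nbrs_swap[OF y p s])
    also have "private_nbrs y s p = {w \<in> U. w \<in> N s}" by (auto simp: private_nbrs_def U_eq)
    finally show "card (private_nbrs y p s) = card {w \<in> U. w \<in> N s}" .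
  qed
  also have "\<dots> = (\<Sum>w\<in>U. card {s \<in> S. s \<in> N w})"
  proof (rule double_count[OF fin'])
    fix s w assume "s \<in> S" "w \<in> U"
    hence "s \<in> V" "w \<in> V" using y nbr_in by (auto simp: S_def U_eq)
    thus "w \<in> N s \<longleftrightarrow> s \<in> N w" by (rule N_sym[symmetric, rotated])
  qed
  also have "\<dots> = (\<Sum>w\<in>U. c 2 - 1)"
  proof (rule sum.cong[OF refl])
    fix w assume w: "w \<in> U"
    hence wN: "w \<in> N y" "w \<notin> N p" "w \<noteq> p" by (auto simp: U_eq)
    have wV: "w \<in> V" using wN y nbr_in by blast
    have pw: "d p w = 2" using dist2I[OF y p wN(1)] wN by auto
    have yy: "y \<in> N p \<inter> N w" using N_symD y p wN by auto
    have "{s \<in> S. s \<in> N w} = N p \<inter> N w - {y}"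
      using clique_pathsD[OF cl pV wV pw yy] N_irrefl[OF y] by (auto simp: S_def)
    moreover have "card (N p \<inter> N w) = c 2" by (rule card_common_2[OF pV wV pw])
    ultimately show "card {s \<in> S. s \<in> N w} = c 2 - 1" using yy by simp
  qed
  also have "\<dots> = b 1 * (c 2 - 1)"
  proof -
    have "card U = b 1" using card_up[OF pV y] dist_N'[OF y p] by (simp add: U_def)
    thus ?thesis by simp
  qed
  finally show ?thesis by (simp add: S_def)
qed

text \<open>
  By averaging in \<open>clique_paths_count\<close>, some triangle has \<open>a 1 * h \<ge> b 1 * (c 2 - 1)\<close> in
  \<open>triangle_gap\<close>. For \<open>c 2 \<ge> 3\<close> this and \<open>clique_paths_c2\<close> leave a gap of \<open>a 1 / 2 + 2\<close>. For
  \<open>c 2 = 2\<close> two non-adjacent common neighbours \<open>s\<close> and \<open>t\<close> of \<open>y\<close> and \<open>p\<close> have no common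
  neighbour besides \<open>y\<close> and \<open>p\<close>, so one of them yields \<open>h \<ge> a 1 / 2\<close>, and this compensates a
  small gap.
\<close>

lemma clique_paths_target:
  assumes cl: clique_paths and c2: "c 2 \<ge> 2"
  shows "psi 0 - psi D < (1 + 6 / k) * (psi 0 - psi 1)"
proof -
  obtain y p where yp: "y \<in> V" "p \<in> V" "d y p = 1" using vertex_pair_ex[of 1] D_ge by auto
  hence p: "p \<in> N y" by (simp add: N_iff)
  define S where "S = N y \<inter> N p"
  have cS: "card S = a 1" using card_common_adj[OF yp(1) p] by (simp add: S_def)
  have a1: "a 1 \<ge> 2 * (c 2 - 1)" by (rule clique_paths_c2[OF cl])
  have fS: "finite S" using fin_N yp by (simp add: S_def)
  have "S \<noteq> {}" using cS a1 c2 by auto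
  define h where "h = Max ((\<lambda>s. card (private_nbrs y p s)) ` S)"
  have "h \<in> (\<lambda>s. card (private_nbrs y p s)) ` S" unfolding h_def using fS \<open>S \<noteq> {}\<close> by (intro Max_in) auto
  then obtain s where s: "s \<in> S" "h = card (private_nbrs y p s)" by auto
  have hmax: "card (private_nbrs y p t) \<le> h" if "t \<in> S" for t unfolding h_def using fS that by (intro Max_ge) auto
  have "b 1 * (c 2 - 1) \<le> (\<Sum>t\<in>S. h)"
    using clique_paths_count[OF cl yp(1) p] hmax sum_mono[of S "\<lambda>t. card (private_nbrs y p t)" "\<lambda>_. h"] by (simp add: S_def)
  hence ah: "b 1 * (c 2 - 1) \<le> a 1 * h" using cS by simp
  have b1: "b 1 \<ge> 1" using b_pos[of 1] D_ge by simp
  have h0: "h > 0"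
  proof (rule ccontr)
    assume "\<not> h > 0"
    hence "b 1 * (c 2 - 1) = 0" using ah by simp
    thus False using b1 c2 by simp
  qed
  have gap: "real (a 1 + 2) * green_iter 4 0 - b 1 / h * green_iter 4 0 \<le> walks 4 0 - k ^ 4 / size_V"
    using triangle_gap[OF yp(1) p _ s(2) h0, of 2] s(1) by (simp add: S_def left_diff_distrib)
  have hp4: "green_iter 4 0 \<ge> 0" using green_iter_even_nonneg[of 2] by simp
  define \<alpha> \<beta> \<mu> G where "\<alpha> = real (a 1)" and "\<beta> = real (b 1)" and "\<mu> = real (c 2)" and "G = \<beta> / h"
  have kr: "real k = 1 + \<alpha> + \<beta>" unfolding \<alpha>_def \<beta>_def using k_b1 by (metis of_nat_add of_nat_1)
  have "real (2 * (c 2 - 1)) \<le> real (a 1)" using a1 of_nat_le_iff by blast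
  hence pos: "\<beta> \<ge> 1" "2 * (\<mu> - 1) \<le> \<alpha>" "\<mu> \<ge> 2" "real h > 0"
    using b1 c2 h0 by (auto simp: \<alpha>_def \<beta>_def \<mu>_def of_nat_diff)
  have "real (b 1 * (c 2 - 1)) \<le> real (a 1 * h)" using ah of_nat_le_iff by blast
  hence "\<beta> * (\<mu> - 1) \<le> \<alpha> * h" using c2 by (simp add: \<alpha>_def \<beta>_def \<mu>_def of_nat_diff)
  hence G: "G * (\<mu> - 1) \<le> \<alpha>" using pos by (simp add: G_def field_simps)
  have G0: "G \<ge> 0" using pos by (simp add: G_def)
  have gap': "(\<alpha> + 2 - G) * green_iter 4 0 \<le> walks 4 0 - k ^ 4 / size_V"
    using gap by (simp add: \<alpha>_def \<beta>_def G_def algebra_simps)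
  have Gle: "G \<le> \<alpha>" using G mult_left_mono[of 1 "\<mu> - 1" G] G0 pos by simp
  show ?thesis
  proof (cases "c 2 = 2")
    case False
    hence mu: "\<mu> \<ge> 3" using c2 by (simp add: \<mu>_def)
    have "G * 2 \<le> G * (\<mu> - 1)" using mu G0 by (intro mult_left_mono) auto
    hence G2: "G \<le> \<alpha> / 2" using G by simp
    show ?thesis
    proof (rule target_from_moderate_gap[of "\<alpha> / 2 + 2"])
      show "0 < \<alpha> / 2 + 2" "\<alpha> / 2 + 2 \<le> real k" using pos kr mu by auto
      have "(\<alpha> / 2 + 2) * green_iter 4 0 \<le> (\<alpha> + 2 - G) * green_iter 4 0" using G2 hp4 by (intro mult_right_mono) auto
      thus "(\<alpha> / 2 + 2) * green_iter 4 0 \<le> walks 4 0 - k ^ 4 / size_V" using gap' by linarith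
      have "\<mu> * \<beta> \<le> (\<alpha> / 2 + 1) * \<beta>" using pos by (intro mult_right_mono) auto
      moreover have "0 \<le> 13 * \<alpha> + 3 * (\<alpha> * \<beta>) + 12 * \<beta>" using pos by simp
      ultimately have "2 * (real k + \<alpha> ^ 2 + \<mu> * \<beta>) \<le> (\<alpha> / 2 + 2) * (5 * real k - 4 - \<alpha>)"
        unfolding kr by (simp add: power2_eq_square algebra_simps)
      thus "2 * (real k + real (a 1) ^ 2 + real (c 2) * real (b 1)) \<le> (\<alpha> / 2 + 2) * (5 * real k - 4 - real (a 1))"
        by (simp add: \<alpha>_def \<beta>_def \<mu>_def)
    qed
  next
    case True
    have "private_nbrs y p s \<noteq> {}" using s(2) h0 by auto
    then obtain t where t: "t \<in> N y" "t \<in> N p" "t \<notin> N s" "t \<noteq> s" by (auto simp: private_nbrs_def)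
    have st: "s \<in> V" "t \<in> V" "s \<in> N y" "s \<in> N p" using s t yp nbr_in by (auto simp: S_def)
    have dst: "d s t = 2" using dist2I[of y s t] t st yp by auto
    have Nst: "N s \<inter> N t = {y, p}"
    proof (rule card_subset_eq[symmetric])
      show "finite (N s \<inter> N t)" using fin_N st by simp
      show "{y, p} \<subseteq> N s \<inter> N t" using N_symD yp t st by auto
      have "y \<noteq> p" using p N_irrefl yp by auto
      thus "card {y, p} = card (N s \<inter> N t)" using card_common_2[OF st(1,2) dst] True by simp
    qed
    define Cs where "Cs = S \<inter> N s" 
    define Ct where "Ct = S \<inter> N t"
    have "y \<notin> N y" "p \<notin> N p" using N_irrefl yp by auto
    hence "Cs \<inter> Ct = {}" using Nst by (auto simp: Cs_def Ct_def S_def)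
    moreover have "Cs \<subseteq> S - {s, t}" "Ct \<subseteq> S - {s, t}"
      using t(3) N_symD[of t s] N_irrefl st by (auto simp: Cs_def Ct_def)
    ultimately have "card Cs + card Ct \<le> card (S - {s, t})"
      using fS by (metis Un_least card_Un_disjoint card_mono finite_Diff finite_subset)
    also have "\<dots> = a 1 - 2" using s(1) t cS fS by (simp add: S_def card_Diff_subset)
    finally have "card Cs + card Ct \<le> a 1 - 2" .
    moreover have "card (private_nbrs y p s) + card Cs + 1 = a 1"
      using card_private_nbrs[OF yp(1) p, of s] s(1) by (simp add: S_def Cs_def)
    moreover have "card (private_nbrs y p t) + card Ct + 1 = a 1"
      using card_private_nbrs[OF yp(1) p, of t] t by (simp add: S_def Ct_def)
    moreover have "card (private_nbrs y p t) \<le> h" using hmax t by (simp add: S_def)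
    moreover have "a 1 \<ge> 2" using a1 True by simp
    ultimately have "a 1 \<le> 2 * h" using s(2) by linarith
    hence "\<alpha> \<le> 2 * h" by (simp add: \<alpha>_def)
    hence "\<alpha> * \<beta> \<le> 2 * h * \<beta>" using pos by (intro mult_right_mono) auto
    hence aG: "\<alpha> * G \<le> 2 * \<beta>" using pos by (simp add: G_def field_simps)
    define g where "g = \<alpha> - G"
    have g: "g \<ge> 0" "\<alpha> * \<alpha> \<le> 2 * \<beta> + \<alpha> * g" using aG Gle by (auto simp: g_def algebra_simps)
    have mu: "\<mu> = 2" using True by (simp add: \<mu>_def)
    show ?thesis
    proof (rule target_from_moderate_gap[of "g + 2"])
      show "0 < g + 2" using g by simp
      show "g + 2 \<le> real k" using pos G0 kr by (auto simp: g_def)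
      show "(g + 2) * green_iter 4 0 \<le> walks 4 0 - k ^ 4 / size_V" using gap' by (simp add: g_def algebra_simps)
      have "0 \<le> \<alpha> * g" "0 \<le> g * \<beta>" "0 \<le> \<alpha>" using g pos by auto
      moreover have "(g + 2) * (5 * real k - 4 - \<alpha>) = g + 4 * (\<alpha> * g) + 5 * (g * \<beta>) + 2 + 8 * \<alpha> + 10 * \<beta>"
        unfolding kr by (simp add: algebra_simps)
      moreover have "2 * (real k + \<alpha> ^ 2 + \<mu> * \<beta>) = 2 * (\<alpha> * \<alpha>) + 2 + 2 * \<alpha> + 6 * \<beta>"
        unfolding kr mu by (simp add: power2_eq_square algebra_simps)
      ultimately have "2 * (real k + \<alpha> ^ 2 + \<mu> * \<beta>) \<le> (g + 2) * (5 * real k - 4 - \<alpha>)"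
        using g pos(1) by linarith
      thus "2 * (real k + real (a 1) ^ 2 + real (c 2) * real (b 1)) \<le> (g + 2) * (5 * real k - 4 - real (a 1))"
        by (simp add: \<alpha>_def \<beta>_def \<mu>_def)
    qed
  qed
qed

theorem target_c2:
  assumes "c 2 \<ge> 2"
  shows "psi 0 - psi D < (1 + 6 / k) * (psi 0 - psi 1)"
proof (cases "c 2 \<ge> 2 * a 1 + 5")
  case True
  show ?thesis
  proof (rule target_from_large_gap)
    show "k / 3 \<le> real (k + 1) - b 1 / (3 / 2)"
      using k_b1 by simp
    show "(real (k + 1) - b 1 / (3 / 2)) * green_iter 2 0 \<le> walks 2 0 - k ^ 2 / size_V"
      using many_paths_gap[OF True, of 1] by simp
  qed
next
  case few: False
  show ?thesis
  proof (cases clique_paths)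
    case True
    thus ?thesis using clique_paths_target assms by blast
  next
    case False
    then obtain x z u u' where "x \<in> V" "z \<in> V" "d x z = 2" "u \<in> N x \<inter> N z" "u' \<in> N x \<inter> N z" "u \<noteq> u'" "u' \<notin> N u"
      unfolding clique_paths_def by blast
    thus ?thesis using quadrangle_target few by auto
  qed
qed

section \<open>A single common neighbour at distance two\<close>

text \<open>
  Let \<open>y\<close> and \<open>z\<close> be adjacent, at distances \<open>i\<close> and \<open>i + 1\<close> from \<open>x\<close>. Each of their \<open>a 1\<close>
  common neighbours is either one step before \<open>z\<close> or one step after \<open>y\<close>.
\<close>

lemma edge_clique_bound:
  assumes "i < D" shows "a 1 + 2 \<le> b i + c (Suc i)"
proof -
  obtain x z where V: "x \<in> V" "z \<in> V" "d x z = i + 1" using vertex_pair_ex[of "Suc i"] assms by auto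
  obtain y where y: "y \<in> V" "d x y = i" "d y z = 1" using geodesic_split[OF V] by blast
  have yz: "z \<in> N y" "y \<in> N z" using y V N_symD by (auto simp: N_iff)
  define A where "A = down x z - {y}"
  define B where "B = up x y - {z}"
  have "card (down x z) = c (Suc i)" "card (up x y) = b i" using card_down card_up V y by auto
  moreover have "y \<in> down x z" "z \<in> up x y" using V y yz by (auto simp: down_def up_def)
  moreover have f: "finite (down x z)" "finite (up x y)" using fin_parts V y by auto
  ultimately have AB: "card A + 1 = c (Suc i)" "card B + 1 = b i"
    unfolding A_def B_def by (metis Suc_eq_plus1 card.remove)+
  have "N y \<inter> N z \<subseteq> A \<union> B"
  proof
    fix w assume w: "w \<in> N y \<inter> N z"
    hence "w \<noteq> y" "w \<noteq> z" using N_irrefl V y by auto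
    moreover have "d x w \<le> i + 1" "i \<le> d x w" 
      using dist_step[OF V(1) y(1), of w] dist_step[OF V(1,2), of w] w V y by auto
    hence "d x w = i \<or> d x w = i + 1" by linarith
    ultimately show "w \<in> A \<union> B" using w V y by (auto simp: A_def B_def down_def up_def)
  qed
  hence "card (N y \<inter> N z) \<le> card (A \<union> B)" using f by (intro card_mono) (auto simp: A_def B_def)
  also have "\<dots> \<le> card A + card B" by (rule card_Un_le)
  finally show ?thesis using card_common_adj[OF y(1) yz(1)] AB by linarith
qed

end

locale drg_c21 = drg +
  assumes c21: "c 2 = 1"
begin

lemma common_unique:
  assumes "x \<in> V" "z \<in> V" "d x z = 2" "u \<in> N x \<inter> N z" "u' \<in> N x \<inter> N z" shows "u = u'"
proof -
  have "card (N x \<inter> N z) = 1" using card_common_2[OF assms(1-3)] c21 by simp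
  thus ?thesis using assms(4,5) by (metis card_1_singletonE singletonD)
qed

lemma common_unique':
  assumes "y \<in> V" "p \<in> N y" "q \<in> N y" "p \<noteq> q" "q \<notin> N p" "w \<in> N p \<inter> N q" shows "w = y"
proof -
  have V: "p \<in> V" "q \<in> V" using assms nbr_in by auto
  have "y \<in> N p \<inter> N q" using N_symD assms by auto
  thus ?thesis using common_unique[OF V dist2I[OF assms(1-5)]] assms(6) by blast
qed

text \<open>
  When two vertices at distance two have only one common neighbour, adjacency is transitive
  on the neighbourhood of \<open>y\<close>, which thus splits into cliques; this is the one through \<open>p\<close>.
\<close>

definition clique_at :: "'a \<Rightarrow> 'a \<Rightarrow> 'a set" where
  "clique_at y p = insert p (N y \<inter> N p)"

lemma clique_at:
  assumes "y \<in> V" "p \<in> N y"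
  shows "card (clique_at y p) = a 1 + 1" "clique_at y p \<subseteq> N y" "finite (clique_at y p)"
proof -
  have "p \<notin> N p" using N_irrefl assms nbr_in by blast
  thus "card (clique_at y p) = a 1 + 1" using card_common_adj[OF assms] fin_N assms
    by (simp add: clique_at_def)
qed (use assms fin_N in \<open>auto simp: clique_at_def\<close>)

lemma clique_at_disjoint:
  assumes "y \<in> V" "p \<in> N y" "q \<in> N y" "q \<notin> clique_at y p"
  shows "clique_at y p \<inter> clique_at y q = {}"
proof -
  have V: "p \<in> V" "q \<in> V" using assms nbr_in by auto
  have q: "p \<noteq> q" "q \<notin> N p" "p \<notin> N q" using assms N_symD[OF V(2), of p] by (auto simp: clique_at_def)
  have "w = y" if "w \<in> N p \<inter> N q" for w using common_unique'[OF assms(1-3) q(1,2) that] .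
  moreover have "y \<notin> N y" using N_irrefl assms by simp
  ultimately show ?thesis using q by (auto simp: clique_at_def)
qed

text \<open>
  The number of cliques of size \<open>a 1 + 1\<close> that make up a neighbourhood is two or at least
  three; a single one would give \<open>b 1 = 0\<close>.
\<close>

lemma valency_dichotomy: "k = 2 * (a 1 + 1) \<or> k \<ge> 3 * (a 1 + 1)"
proof -
  obtain y p where yp: "y \<in> V" "p \<in> V" "d y p = 1" using vertex_pair_ex[of 1] D_ge by auto
  hence p: "p \<in> N y" by (simp add: N_iff)
  have kN: "card (N y) = k" using k_card yp by simp
  have fN: "finite (N y)" using fin_N yp by simp
  note P = clique_at[OF yp(1) p]
  have "N y \<noteq> clique_at y p"
  proof
    assume "N y = clique_at y p"
    hence "b 1 = 0" using P(1) kN k_b1 by simp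
    thus False using b_pos[of 1] D_ge by simp
  qed
  then obtain q where q: "q \<in> N y" "q \<notin> clique_at y p" using P(2) by blast
  note Q = clique_at[OF yp(1) q(1)]
  have pq: "clique_at y p \<inter> clique_at y q = {}" by (rule clique_at_disjoint[OF yp(1) p q])
  hence cu: "card (clique_at y p \<union> clique_at y q) = 2 * (a 1 + 1)"
    using P Q by (simp add: card_Un_disjoint)
  show ?thesis
  proof (cases "N y = clique_at y p \<union> clique_at y q")
    case True
    thus ?thesis using cu kN by simp
  next
    case False
    then obtain r where r: "r \<in> N y" "r \<notin> clique_at y p" "r \<notin> clique_at y q" using P(2) Q(2) by blast
    note R = clique_at[OF yp(1) r(1)]
    have "(clique_at y p \<union> clique_at y q) \<inter> clique_at y r = {}"
      using clique_at_disjoint[OF yp(1) p r(1,2)] clique_at_disjoint[OF yp(1) q(1) r(1,3)] by blast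
    hence "card (clique_at y p \<union> clique_at y q \<union> clique_at y r) = 3 * (a 1 + 1)"
      using P Q R cu by (subst card_Un_disjoint) auto
    moreover have "card (clique_at y p \<union> clique_at y q \<union> clique_at y r) \<le> card (N y)"
      using P Q R fN by (intro card_mono) auto
    ultimately show ?thesis using kN by simp
  qed
qed

lemma two_cliques_cover:
  assumes k: "k = 2 * (a 1 + 1)" and y: "y \<in> V" "p \<in> N y" "q \<in> N y" "p \<noteq> q" "q \<notin> N p"
  shows "N y = clique_at y p \<union> clique_at y q"
proof (rule card_subset_eq[symmetric])
  note P = clique_at[OF y(1,2)] and Q = clique_at[OF y(1,3)]
  have "q \<notin> clique_at y p" using y by (simp add: clique_at_def)
  hence "clique_at y p \<inter> clique_at y q = {}" using clique_at_disjoint y by blast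
  thus "card (clique_at y p \<union> clique_at y q) = card (N y)"
    using P Q k k_card y by (simp add: card_Un_disjoint)
  show "clique_at y p \<union> clique_at y q \<subseteq> N y" using P Q by blast
  show "finite (N y)" using fin_N y by simp
qed

text \<open>
  The cliques of \<open>p\<close> and \<open>q\<close> exhaust the neighbourhood of \<open>y\<close>. If both \<open>p\<close> and \<open>q\<close> are
  closer to \<open>x\<close> than \<open>y\<close>, no neighbour of \<open>y\<close> can be farther away.
\<close>

lemma split_preds_end:
  assumes k: "k = 2 * (a 1 + 1)" and V: "x \<in> V" "y \<in> V"
    and p: "p \<in> down x y" and q: "q \<in> down x y" and pq: "p \<noteq> q" "q \<notin> N p"
  shows "b (d x y) = 0"
proof -
  have pN: "p \<in> N y" "d x p + 1 = d x y" "q \<in> N y" "d x q + 1 = d x y" using p q by (auto simp: down_def)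
  have pV: "p \<in> V" "q \<in> V" using pN V nbr_in by auto
  have "up x y = {}"
  proof -
    have False if w: "w \<in> N y" "d x w = d x y + 1" for w
    proof -
      have "w \<in> clique_at y p \<union> clique_at y q" using two_cliques_cover[OF k V(2) pN(1,3) pq] w by simp
      hence "w = p \<or> w = q \<or> w \<in> N p \<or> w \<in> N q" by (auto simp: clique_at_def)
      thus False using dist_step(1)[OF V(1) pV(1), of w] dist_step(1)[OF V(1) pV(2), of w] pN w by auto
    qed
    thus ?thesis by (auto simp: up_def)
  qed
  thus ?thesis using card_up[OF V] by simp
qed

text \<open>
  Each vertex lies in just two maximal cliques, as in a line graph. At the first \<open>s\<close> with
  \<open>c s \<ge> 2\<close> take \<open>x\<close> and \<open>y\<close> at distance \<open>s\<close>, two predecessors \<open>y1\<close> and \<open>y2\<close> of \<open>y\<close>, and the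
  first steps \<open>x1\<close> and \<open>x2\<close> from \<open>x\<close> towards them. By \<open>split_preds_end\<close> at both ends, \<open>y1\<close>
  and \<open>y2\<close> are adjacent and so are \<open>x1\<close> and \<open>x2\<close>. Then \<open>x1\<close> reaches \<open>y2\<close> in \<open>s - 1\<close> steps
  both through \<open>y1\<close> and through a geodesic from \<open>x2\<close>, against \<open>c (s - 1) = 1\<close>.
\<close>

lemma line_like_c:
  assumes k: "k = 2 * (a 1 + 1)" and "1 \<le> i" "i < D"
  shows "c i = 1"
  using assms(2,3)
proof (induction i rule: less_induct)
  case (less s)
  show ?case
  proof (rule ccontr)
    assume ne: "c s \<noteq> 1"
    hence s3: "s \<ge> 3" using c_1 c21 less.prems(1)
      by (metis One_nat_def Suc_1 Suc_leI antisym_conv2 not_less_eq_eq numeral_3_eq_3)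
    have sm: "s - 1 = 1 + (s - 2)" "s - 2 = (s - 3) + 1" using s3 by auto
    have cs1: "c (s - 1) = 1" using less s3 by simp
    have bs: "b s > 0" using b_pos less by simp
    obtain x y where V: "x \<in> V" "y \<in> V" "d x y = s" using vertex_pair_ex[of s] less by auto
    have uniq: "u = v" if "x' \<in> V" "y' \<in> V" "d x' y' = s - 1" "u \<in> down x' y'" "v \<in> down x' y'" for u v x' y'
    proof -
      have "card (down x' y') = 1" using card_down that cs1 by simp
      thus ?thesis using that(4,5) by (metis card_1_singletonE singletonD)
    qed
    have "card (down x y) \<ge> 2" using card_down V c_pos[of s] ne less.prems by simp
    hence "\<not> card (down x y) \<le> 1" by simp
    then obtain y1 y2 where yy: "y1 \<in> down x y" "y2 \<in> down x y" "y1 \<noteq> y2"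
      using fin_parts(1)[OF V(2)] card_le_Suc0_iff_eq by (metis One_nat_def)
    have yN: "y1 \<in> N y" "y2 \<in> N y" "d x y1 = s - 1" "d x y2 = s - 1" using yy V s3 by (auto simp: down_def)
    have yV: "y1 \<in> V" "y2 \<in> V" using yN V nbr_in by auto
    have adjy: "y2 \<in> N y1" using split_preds_end[OF k V(1,2) yy] V bs by auto
    obtain x1 where x1: "x1 \<in> V" "d x x1 = 1" "d x1 y1 = s - 2"
      using geodesic_split[OF V(1) yV(1), of 1 "s - 2"] yN s3 sm by auto
    obtain x2 where x2: "x2 \<in> V" "d x x2 = 1" "d x2 y2 = s - 2"
      using geodesic_split[OF V(1) yV(2), of 1 "s - 2"] yN s3 sm by auto
    have d1y: "d x1 y = s - 1" using dist_tri[of x1 y1 y] dist_tri[of x x1 y] dist_N'[OF V(2) yN(1)] V x1 yV s3 by simp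
    have d2y: "d x2 y = s - 1" using dist_tri[of x2 y2 y] dist_tri[of x x2 y] dist_N'[OF V(2) yN(2)] V x2 yV s3 by simp
    have x12: "x1 \<noteq> x2"
    proof
      assume eq: "x1 = x2"
      have "y1 \<in> down x1 y" "y2 \<in> down x1 y" using yN d1y x1 x2 eq s3 by (auto simp: down_def)
      thus False using uniq[OF x1(1) V(2) d1y] yy(3) by blast
    qed
    have xN: "x1 \<in> N x" "x2 \<in> N x" using V x1 x2 by (auto simp: N_iff)
    have "x1 \<in> down y x" "x2 \<in> down y x"
      using xN d1y d2y dist_sym V x1 x2 s3 by (auto simp: down_def)
    hence "x2 \<in> N x1" using split_preds_end[OF k V(2,1) _ _ x12] V dist_sym[of x y] bs by auto
    hence adjx: "d x1 x2 = 1" using dist_N x1 by simp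
    have "d x1 y2 \<noteq> s - 2"
    proof
      assume "d x1 y2 = s - 2"
      hence "d y2 x1 + 1 = d y2 x" "d y2 x2 + 1 = d y2 x"
        using yN(4) x2(3) dist_sym[OF V(1) yV(2)] dist_sym[OF x1(1) yV(2)] dist_sym[OF x2(1) yV(2)] s3
        by linarith+
      hence "x1 \<in> down y2 x" "x2 \<in> down y2 x" using xN by (auto simp: down_def)
      thus False using uniq[OF yV(2) V(1)] dist_sym[of x y2] V yV yN x12 by auto
    qed
    moreover have "d x1 y2 \<le> s - 1" using dist_tri[of x1 x2 y2] x1 x2 yV adjx s3 by simp
    moreover have "s - 1 \<le> d x1 y2 + 1" using dist_tri[of x x1 y2] x1 V yV yN by simp
    ultimately have d12: "d x1 y2 = s - 1" using s3 by linarith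
    obtain z where z: "z \<in> V" "d x2 z = s - 3" "d z y2 = 1"
      using geodesic_split[OF x2(1) yV(2), of "s - 3" 1] x2 s3 sm by auto
    have zN: "z \<in> N y2" using z yV dist_sym[of z y2] by (simp add: N_iff)
    have dxz: "d x z \<le> s - 2" using dist_tri[of x x2 z] x2 z V s3 by simp
    \<comment> \<open>This separates the predecessor \<open>z\<close> of \<open>y2\<close> from \<open>y1\<close>, a neighbour of \<open>y\<close>.\<close>
    have "z \<notin> N y" using dist_step(2)[OF V(1,2), of z] dxz V(3) s3 by auto
    hence "z \<noteq> y1" using yN by auto
    moreover have "d x1 z = s - 2"
      using dist_tri[of x1 x2 z] dist_tri[of x1 z y2] x1 x2 z yV adjx d12 s3 by simp
    hence "z \<in> down x1 y2" using zN d12 s3 by (auto simp: down_def)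
    moreover have "y1 \<in> down x1 y2" using N_symD[OF yV(1) adjy] x1 d12 s3 by (auto simp: down_def)
    ultimately show False using uniq[OF x1(1) yV(2) d12] by blast
  qed
qed

end

section \<open>Intervals between two vertices\<close>

context drg begin

definition interval :: "'a \<Rightarrow> 'a \<Rightarrow> nat \<Rightarrow> 'a set" where
  "interval x u l = {v \<in> V. d x v = l \<and> d x v + d v u = d x u}"

lemma fin_interval: "finite (interval x u l)" using fin by (simp add: interval_def)

text \<open>
  Double counting of the edges between two consecutive levels: the steps from \<open>v\<close> towards
  \<open>u\<close> and the steps back towards \<open>x\<close> never leave the interval.
\<close>

lemma interval_step:
  assumes V: "x \<in> V" "u \<in> V" and l: "l < d x u"
  shows "card (interval x u (Suc l)) * c (Suc l) = card (interval x u l) * c (d x u - l)"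
proof -
  have "(\<Sum>v\<in>interval x u l. card {w \<in> interval x u (Suc l). w \<in> N v}) =
        (\<Sum>w\<in>interval x u (Suc l). card {v \<in> interval x u l. v \<in> N w})"
  proof (rule double_count[OF fin_interval fin_interval])
    fix v w assume "v \<in> interval x u l" "w \<in> interval x u (Suc l)"
    hence "v \<in> V" "w \<in> V" by (auto simp: interval_def)
    thus "w \<in> N v \<longleftrightarrow> v \<in> N w" by (rule N_sym)
  qed
  moreover have "card {w \<in> interval x u (Suc l). w \<in> N v} = c (d x u - l)" if v: "v \<in> interval x u l" for v
  proof -
    have v': "v \<in> V" "d x v = l" "d x v + d v u = d x u" using v by (auto simp: interval_def)
    have "{w \<in> interval x u (Suc l). w \<in> N v} = down u v"
    proof (intro set_eqI iffI)
      fix w assume "w \<in> {w \<in> interval x u (Suc l). w \<in> N v}"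
      hence w: "w \<in> V" "w \<in> N v" "d x w = Suc l" "d x w + d w u = d x u" by (auto simp: interval_def)
      hence "d w u + 1 = d v u" using v' by simp
      thus "w \<in> down u v" using w dist_sym[OF w(1) V(2)] dist_sym[OF v'(1) V(2)] by (auto simp: down_def)
    next
      fix w assume w: "w \<in> down u v"
      have "w \<in> up x v" using down_opposite_up[OF V(1) v'(1) V(2) v'(3)] w by blast
      hence w2: "d x w = Suc l" "w \<in> N v" using v' by (auto simp: up_def)
      have wV: "w \<in> V" using w2 v' nbr_in by blast
      have "d u w + 1 = d u v" using w by (simp add: down_def)
      hence "d w u + 1 = d v u" using dist_sym[OF wV V(2)] dist_sym[OF v'(1) V(2)] by simp
      thus "w \<in> {w \<in> interval x u (Suc l). w \<in> N v}" using w2 wV v' by (auto simp: interval_def)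
    qed
    moreover have "d u v = d x u - l" using v' V dist_sym[of u v] by simp
    ultimately show ?thesis using card_down[OF V(2) v'(1)] by simp
  qed
  moreover have "card {v \<in> interval x u l. v \<in> N w} = c (Suc l)" if w: "w \<in> interval x u (Suc l)" for w
  proof -
    have w': "w \<in> V" "d x w = Suc l" "d x w + d w u = d x u" using w by (auto simp: interval_def)
    have "{v \<in> interval x u l. v \<in> N w} = down x w"
    proof (intro set_eqI iffI)
      fix v assume "v \<in> {v \<in> interval x u l. v \<in> N w}"
      thus "v \<in> down x w" using w' by (auto simp: down_def interval_def)
    next
      fix v assume "v \<in> down x w"
      hence v: "v \<in> N w" "d x v = l" using w' by (auto simp: down_def)
      have vV: "v \<in> V" using v w' nbr_in by blast
      have "d v u \<le> d w u + 1" using dist_step'(1)[OF V(2) w'(1) v(1)] by simp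
      moreover have "d x u \<le> d x v + d v u" using dist_tri V vV by blast
      ultimately have "d x v + d v u = d x u" using v w' by linarith
      thus "v \<in> {v \<in> interval x u l. v \<in> N w}" using v vV by (auto simp: interval_def)
    qed
    thus ?thesis using card_down[OF V(1) w'(1)] w' by simp
  qed
  ultimately show ?thesis by simp
qed

lemma interval_0: "x \<in> V \<Longrightarrow> u \<in> V \<Longrightarrow> interval x u 0 = {x}"
  by (auto simp: interval_def dist0)

text \<open>
  The inclusion \<open>down_opposite_up\<close> between sets of equal size.
\<close>

lemma geodesic_sides_match:
  assumes V: "x \<in> V" "u \<in> V" "v \<in> V" "d x v + d v u = d x u" and bc: "c (d v u) = b (d x v)"
  shows "down u v = up x v"
proof (rule card_subset_eq)
  show "finite (up x v)" using fin_parts V by blast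
  show "down u v \<subseteq> up x v" using down_opposite_up V by blast
  show "card (down u v) = card (up x v)" using card_down card_up V bc dist_sym[of u v] by simp
qed

text \<open>
  All \<open>c j\<close> with \<open>j \<le> 2 * s\<close> would be \<open>1\<close>, so two vertices at distance \<open>2 * s\<close> would be
  joined by exactly one geodesic. As \<open>k > 2\<close>, its midpoint \<open>p\<close> has a neighbour \<open>w\<close> at the
  same distance from \<open>x\<close>; since at \<open>p\<close> the steps away from one end are the steps towards the
  other, \<open>w\<close> is also at the same distance from \<open>u\<close> as \<open>p\<close> and is a second midpoint.
\<close>

lemma no_unique_geodesics:
  assumes s: "1 \<le> s" "2 * s \<le> D" and c: "c (2 * s) = 1" and b: "b s = 1"
  shows False
proof -
  have cj: "c j = 1" if "1 \<le> j" "j \<le> 2 * s" for j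
    using c_mono[of j "2 * s"] c_pos[of j] that c s by simp
  obtain x u where V: "x \<in> V" "u \<in> V" "d x u = 2 * s" using vertex_pair_ex[of "2 * s"] s by auto
  have one: "card (interval x u l) = 1" if "l \<le> 2 * s" for l
    using that
  proof (induction l)
    case 0
    show ?case using interval_0 V by simp
  next
    case (Suc l)
    thus ?case using interval_step[OF V(1,2), of l] V(3) cj[of "Suc l"] cj[of "2 * s - l"] by simp
  qed
  obtain p where p: "p \<in> V" "d x p = s" "d p u = s" using geodesic_split[OF V(1,2), of s s] V by auto
  have up: "d u p = s" "d u x = 2 * s" "d p x = s" using p V dist_sym by auto
  have cs: "c s = 1" using cj s by simp
  have "down u p = up x p" by (rule geodesic_sides_match[OF V(1,2) p(1)]) (use p V b cs in auto)
  moreover have "down x p = up u p" by (rule geodesic_sides_match[OF V(2,1) p(1)]) (use p V b cs up in auto)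
  ultimately have side: "side x p \<subseteq> side u p"
    using N_split[OF V(2) p(1)] N_split[OF V(1) p(1)] parts_disjoint[of x p] by blast
  have "c s + card (side x p) + b s = k" using card_sum[OF V(1) p(1)] p by simp
  hence "card (side x p) \<noteq> 0" using cs b k_gt by simp
  then obtain w where w: "w \<in> side x p" by (metis card.empty ex_in_conv)
  hence w': "w \<in> N p" "d x w = s" "d u w = s" using side p up by (auto simp: side_def)
  have wV: "w \<in> V" using w' p nbr_in by blast
  have "w \<in> interval x u s" "p \<in> interval x u s" using w' wV p V dist_sym[of u w] by (auto simp: interval_def)
  moreover have "w \<noteq> p" using w' N_irrefl p by auto
  moreover have "card (interval x u s) = 1" using one by simp
  ultimately show False by (metis card_1_singletonE singletonD)
qed

end

text \<open>
  A hypothetical long range where the numbers \<open>c i\<close> and \<open>b i\<close> agree and stay constant. The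
  ranges are those that an argument at distance \<open>4 * s - 4\<close> uses; it refutes them in
  \<open>flat_contradiction\<close>.
\<close>

locale drg_flat = drg +
  fixes s C :: nat
  assumes s3: "s \<ge> 3" and sD: "4 * s - 4 \<le> D"
    and cC: "\<And>i. s \<le> i \<Longrightarrow> i \<le> 4 * s - 4 \<Longrightarrow> c i = C"
    and bC: "\<And>i. s \<le> i \<Longrightarrow> i \<le> 3 * s - 4 \<Longrightarrow> b i = C"
begin

text \<open>
  On these levels the steps from \<open>v\<close> towards \<open>u\<close> are exactly those away from \<open>x\<close>, and
  conversely, so every neighbour keeps the sum of the two distances.
\<close>

lemma flat_closed:
  assumes V: "x \<in> V" "u \<in> V" "d x u = 4 * s - 4" 
    and v: "v \<in> V" "d x v + d v u = d x u" "s \<le> d x v" "d x v \<le> 3 * s - 4" and w: "w \<in> N v"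
  shows "d x w + d w u = d x u"
proof -
  have sy: "d u v = d v u" "d u x = d x u" "d v x = d x v" using V v dist_sym by auto
  have r: "s \<le> d v u" "d v u \<le> 3 * s - 4" using v V s3 by auto
  have e1: "down u v = up x v" 
    by (rule geodesic_sides_match[OF V(1,2) v(1,2)]) (use cC bC v r V s3 in auto)
  have e2: "down x v = up u v"
    by (rule geodesic_sides_match[OF V(2,1) v(1)]) (use cC bC v r V s3 sy in auto)
  have wV: "w \<in> V" using w v nbr_in by blast
  have "w \<in> down x v \<or> w \<in> side x v \<or> w \<in> up x v" using N_split[OF V(1) v(1)] w by blast
  moreover have "d x w + d u w = d x u" if "w \<in> down x v" 
  proof -
    have "w \<in> up u v" using that e2 by simp
    thus ?thesis using that v sy by (auto simp: up_def down_def)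
  qed
  moreover have "d x w + d u w = d x u" if "w \<in> up x v" 
  proof -
    have "w \<in> down u v" using that e1 by simp
    thus ?thesis using that v sy by (auto simp: up_def down_def)
  qed
  moreover have "d x w + d u w = d x u" if "w \<in> side x v" 
  proof -
    have "w \<notin> down u v" "w \<notin> up u v" using that e1 e2 parts_disjoint[of x v] by blast+
    hence "w \<in> side u v" using N_split[OF V(2) v(1)] w by blast
    thus ?thesis using that v sy by (auto simp: side_def)
  qed
  ultimately show ?thesis using wV V dist_sym[of u w] by auto
qed

text \<open>
  Both sides satisfy the recursion of \<open>interval_step\<close>, with the constant coefficient \<open>C\<close> on
  the right.
\<close>

lemma flat_interval_card:
  assumes V: "x \<in> V" "u \<in> V" "2 * s - 2 \<le> d x u" "d x u \<le> 4 * s - 4"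
    and V': "x' \<in> V" "u' \<in> V" "2 * s - 2 \<le> d x' u'" "d x' u' \<le> 4 * s - 4"
    and "j \<le> s - 1"
  shows "card (interval x u j) = card (interval x' u' j)"
  using assms(9)
proof (induction j)
  case 0
  show ?case using interval_0 V V' by simp
next
  case (Suc j)
  have IH: "card (interval x u j) = card (interval x' u' j)" using Suc by simp
  have "c (d x u - j) = C" "c (d x' u' - j) = C" using Suc.prems V V' s3 by (auto intro!: cC)
  moreover have "j < d x u" "j < d x' u'" using Suc.prems V V' s3 by auto
  ultimately have "card (interval x u (Suc j)) * c (Suc j) = card (interval x' u' (Suc j)) * c (Suc j)"
    using interval_step[of x u j] interval_step[of x' u' j] V V' IH by simp
  moreover have "c (Suc j) > 0" using c_pos[of "Suc j"] Suc.prems s3 sD by simp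
  ultimately show ?case by simp
qed

text \<open>
  The level \<open>s - 1\<close> of the interval from \<open>x\<close> to \<open>v\<close> is contained in that of the interval
  from \<open>x\<close> to \<open>u\<close> and has the same size. Hence every vertex of that level lies on a geodesic
  from \<open>x\<close> to \<open>v\<close>.
\<close>

lemma flat_cover:
  assumes V: "x \<in> V" "u \<in> V" "d x u = 4 * s - 4" 
    and v: "v \<in> V" "d x v + d v u = d x u" "2 * s - 2 \<le> d x v"
    and z: "z \<in> interval x u (s - 1)"
  shows "d z v = d x v - (s - 1)"
proof -
  have "interval x v (s - 1) \<subseteq> interval x u (s - 1)"
  proof
    fix t assume "t \<in> interval x v (s - 1)"
    hence t: "t \<in> V" "d x t = s - 1" "d x t + d t v = d x v" by (auto simp: interval_def)
    have "d t u \<le> d t v + d v u" "d x u \<le> d x t + d t u" by (intro dist_tri V(1,2) v(1) t(1))+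
    hence "d x t + d t u = d x u" using t v by linarith
    thus "t \<in> interval x u (s - 1)" using t by (simp add: interval_def)
  qed
  moreover have "card (interval x v (s - 1)) = card (interval x u (s - 1))"
    using V v s3 by (intro flat_interval_card) auto
  ultimately have "interval x v (s - 1) = interval x u (s - 1)" using fin_interval card_subset_eq by blast
  hence "z \<in> interval x v (s - 1)" using z by simp
  thus ?thesis by (auto simp: interval_def)
qed

text \<open>
  Go from \<open>v\<close> down to level \<open>s - 1\<close>, and from there up to \<open>p\<close> in \<open>s - 1\<close> steps by
  \<open>flat_cover\<close>.
\<close>

lemma flat_mid_dist:
  assumes V: "x \<in> V" "u \<in> V" "d x u = 4 * s - 4" 
    and p: "p \<in> V" "d x p = 2 * s - 2" "d p u = 2 * s - 2"
    and v: "v \<in> V" "d x v + d v u = d x u" "s - 1 \<le> d x v" "d x v \<le> 2 * s - 2"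
  shows "d p v \<le> d x v"
proof -
  obtain z where z: "z \<in> V" "d x z = s - 1" "d z v = d x v - (s - 1)"
    using geodesic_split[OF V(1) v(1), of "s - 1" "d x v - (s - 1)"] v by auto
  have "d z u \<le> d z v + d v u" "d x u \<le> d x z + d z u" by (intro dist_tri V(1,2) v(1) z(1))+
  hence "d x z + d z u = d x u" using z v by linarith
  hence "z \<in> interval x u (s - 1)" using z by (simp add: interval_def)
  hence "d z p = s - 1" using flat_cover[OF V p(1)] p V s3 by simp
  thus ?thesis using dist_tri[of p z v] dist_sym[of p z] p z v by simp
qed

lemma flat_far_card:
  assumes V: "x \<in> V" "u \<in> V" "d x u = 4 * s - 4" and p: "p \<in> V" "d x p = 2 * s - 2" 
  shows "card {w \<in> sphere p 2. d x w = 2 * s} \<le> C * C"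
proof -
  have bb: "b (2 * s - 2) = C" "b (2 * s - 1) = C" using bC s3 by auto
  have "{w \<in> sphere p 2. d x w = 2 * s} \<subseteq> (\<Union>v\<in>up x p. up x v)"
  proof
    fix w assume "w \<in> {w \<in> sphere p 2. d x w = 2 * s}"
    hence w: "w \<in> V" "d p w = 1 + 1" "d x w = 2 * s" by (auto simp: sphere_def)
    obtain v where v: "v \<in> V" "d p v = 1" "d v w = 1" using geodesic_split[OF p(1) w(1,2)] by blast
    have N': "v \<in> N p" "w \<in> N v" using v p w by (auto simp: N_iff)
    have "d x v = 2 * s - 1"
      using dist_step[OF V(1) p(1) N'(1)] dist_step[OF V(1) v(1) N'(2)] p w s3 by simp
    hence "v \<in> up x p" "w \<in> up x v" using N' p w s3 by (auto simp: up_def)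
    thus "w \<in> (\<Union>v\<in>up x p. up x v)" by blast
  qed
  moreover have f: "finite (up x p)" using fin_parts p by blast
  moreover have upV: "v \<in> V \<and> d x v = 2 * s - 1" if "v \<in> up x p" for v 
    using that p nbr_in s3 by (auto simp: up_def)
  ultimately have "card {w \<in> sphere p 2. d x w = 2 * s} \<le> card (\<Union>v\<in>up x p. up x v)"
    using fin_parts by (intro card_mono) auto
  also have "\<dots> \<le> (\<Sum>v\<in>up x p. card (up x v))" using f by (rule card_UN_le)
  also have "\<dots> = (\<Sum>v\<in>up x p. C)" using upV card_up[OF V(1)] bb by (intro sum.cong) auto
  also have "\<dots> = C * C" using card_up[OF V(1) p(1)] p bb by simp
  finally show ?thesis .
qed

text \<open>
  Let \<open>p\<close> be the midpoint of an interval of length \<open>4 * s - 4\<close>. Of the \<open>k * b 1\<close> vertices at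
  distance two from \<open>p\<close>, at most \<open>C * C\<close> are two levels above \<open>p\<close> and as many two levels
  below, so some geodesic from \<open>p\<close> starts with two steps that change the level by at most
  one. If after \<open>j\<close> steps its level differs by \<open>h\<close> from that of \<open>p\<close>, then \<open>h \<le> j - 1\<close>, and
  \<open>j \<le> 2 * s - 2 - h\<close> by \<open>flat_mid_dist\<close>; together these give \<open>h \<le> s - 2\<close>. So by
  \<open>flat_closed\<close> the geodesic never leaves the interval, and it cannot be longer than
  \<open>2 * s - 2\<close>. But \<open>b j > 0\<close> allows it to be extended.
\<close>

lemma flat_contradiction:
  assumes c21: "c 2 = 1" and big: "2 * C * C < k * b 1" shows False
proof -
  obtain x u where V: "x \<in> V" "u \<in> V" "d x u = 4 * s - 4" using vertex_pair_ex[OF sD] by auto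
  obtain p where p: "p \<in> V" "d x p = 2 * s - 2" "d p u = 2 * s - 2"
    using geodesic_split[OF V(1,2), of "2 * s - 2" "2 * s - 2"] V s3 by auto
  have sy: "d u x = 4 * s - 4" "d u p = 2 * s - 2" "d p x = 2 * s - 2" using V p dist_sym by auto
  have near: "d x w + d w u = d x u" if w: "w \<in> V" "d p w = 1 + 1" for w
  proof -
    obtain v where v: "v \<in> V" "d p v = 1" "d v w = 1" using geodesic_split[OF p(1) w] by blast
    have N': "v \<in> N p" "w \<in> N v" using v p w by (auto simp: N_iff)
    have "d x v + d v u = d x u" using flat_closed[OF V p(1) _ _ _ N'(1)] p V s3 by simp
    moreover have "s \<le> d x v" "d x v \<le> 3 * s - 4" using dist_step[OF V(1) p(1) N'(1)] p s3 by auto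
    ultimately show ?thesis using flat_closed[OF V v(1) _ _ _ N'(2)] by simp
  qed
  have mid: "j \<le> d x w" if "w \<in> V" "d p w = j" "d x w + d w u = d x u" "s - 1 \<le> d x w" "d x w \<le> 2 * s - 2" for w j
    using flat_mid_dist[OF V p that(1,3-5)] that by simp
  have mid': "j \<le> d w u" if w: "w \<in> V" "d p w = j" "d x w + d w u = d x u" "d x w \<le> 3 * s - 3" "2 * s - 2 \<le> d x w" for w j
  proof -
    have "d u w = d w u" "d w x = d x w" using dist_sym V w by auto
    thus ?thesis using flat_mid_dist[OF V(2,1) sy(1) p(1) sy(2,3) w(1)] w sy(1) V(3) s3 by simp
  qed
  have cs2: "card (sphere p 2) = k * b 1"
  proof -
    have "card (sphere p 0) = 1"
    proof -
      have "sphere p 0 = {p}" using p dist0 by (auto simp: sphere_def)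
      thus ?thesis by simp
    qed
    hence "card (sphere p 1) = k" using sphere_step[OF p(1), of 0] D_ge c_1 b_0 by simp
    thus ?thesis using sphere_step[OF p(1), of 1] D_ge c21 by (simp add: numeral_2_eq_2)
  qed
  define F where "F = {w \<in> sphere p 2. d x w = 2 * s} \<union> {w \<in> sphere p 2. d u w = 2 * s}"
  have "card F \<le> C * C + C * C"
    unfolding F_def using flat_far_card[OF V p(1,2)] flat_far_card[OF V(2,1) sy(1) p(1) sy(2)]
    by (meson add_mono card_Un_le le_trans)
  hence "card F < card (sphere p 2)" using big cs2 by simp
  moreover have "F \<subseteq> sphere p 2" by (auto simp: F_def)
  ultimately obtain w2 where w2: "w2 \<in> sphere p 2" "w2 \<notin> F" 
    by (metis less_irrefl subsetI subset_antisym)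
  have w2': "w2 \<in> V" "d p w2 = 1 + 1" "d x w2 \<noteq> 2 * s" "d u w2 \<noteq> 2 * s"
    using w2 by (auto simp: F_def sphere_def)
  have h2: "d x w2 + d w2 u = d x u" by (rule near[OF w2'(1,2)])
  have dw2: "d u w2 = d w2 u" using dist_sym V w2' by simp
  have "d x w2 \<le> 2 * s" "2 * s - 4 \<le> d x w2" using dist_tri[of x p w2] dist_tri[of x w2 p] dist_sym[of w2 p] V p w2' s3 by auto
  hence r2: "2 * s - 3 \<le> d x w2" "d x w2 \<le> 2 * s - 1" using w2' h2 dw2 V(3) s3 by auto
  \<comment> \<open>The last two conditions say, without subtraction, that the level of \<open>w\<close> differs from
    the level \<open>2 * s - 2\<close> of \<open>p\<close> by at most \<open>j - 1\<close>.\<close>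
  have "\<exists>w\<in>V. d p w = j \<and> d x w + d w u = d x u \<and> s \<le> d x w \<and> d x w \<le> 3 * s - 4 \<and>
          2 * s \<le> d x w + j + 1 \<and> d x w + 3 \<le> 2 * s + j" if "2 \<le> j" "j \<le> 2 * s - 1" for j
    using that
  proof (induction j rule: dec_induct)
    case base
    show ?case using w2' h2 r2 s3 by (intro bexI[of _ w2]) auto
  next
    case (step j)
    then obtain w where w: "w \<in> V" "d p w = j" "d x w + d w u = d x u" "s \<le> d x w" "d x w \<le> 3 * s - 4"
          "2 * s \<le> d x w + j + 1" "d x w + 3 \<le> 2 * s + j" by auto
    have "b j > 0" using b_pos[of j] step sD s3 by simp
    hence "card (up p w) > 0" using card_up[OF p(1) w(1)] w by simp
    then obtain w' where "w' \<in> up p w" by (metis card.empty ex_in_conv less_irrefl)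
    hence w': "w' \<in> N w" "d p w' = Suc j" using w by (auto simp: up_def)
    have wV: "w' \<in> V" using w' w nbr_in by blast
    have H: "d x w' + d w' u = d x u" by (rule flat_closed[OF V w(1,3,4,5) w'(1)])
    have st: "d x w' \<le> d x w + 1" "d x w \<le> d x w' + 1" using dist_step[OF V(1) w(1) w'(1)] by auto
    have "s \<le> d x w' \<and> d x w' \<le> 3 * s - 4"
    proof (cases "d x w' \<le> 2 * s - 2")
      case True
      have "Suc j \<le> d x w'" using mid[OF wV w'(2) H _ True] st w s3 by simp
      thus ?thesis using True st w(6) s3 by linarith
    next
      case False
      have "Suc j \<le> d w' u" using mid'[OF wV w'(2) H] False st w s3 by simp
      thus ?thesis using False st w(7) s3 H V(3) by linarith
    qed
    thus ?case using H w' wV st w by (intro bexI[of _ w']) auto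
  qed
  moreover have "2 \<le> 2 * s - 1" using s3 by simp
  ultimately obtain w where w: "w \<in> V" "d p w = 2 * s - 1" "d x w + d w u = d x u" 
    "s \<le> d x w" "d x w \<le> 3 * s - 4" by blast
  show False
  proof (cases "d x w \<le> 2 * s - 2")
    case True
    thus False using mid[OF w(1,2,3)] w(4) s3 by linarith
  next
    case False
    hence "2 * s - 1 \<le> d w u" using mid'[OF w(1,2,3)] w(5) by linarith
    thus False using False w(3) s3 V(3) by linarith
  qed
qed

end

section \<open>Comparing sphere sizes with edge counts\<close>

context drg begin

text \<open>
  The index where \<open>c\<close> overtakes \<open>b\<close>. By \<open>c_le_b\<close> it lies beyond the middle of the diameter.
\<close>

definition turn :: nat where "turn = (LEAST i. b i < c i)"

lemma turn_less: "b turn < c turn"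
  unfolding turn_def by (rule LeastI[of _ D]) (use b_D c_pos[of D] D_ge in auto)

lemma before_turn: "i < turn \<Longrightarrow> c i \<le> b i"
  unfolding turn_def using not_less_Least not_less by blast

lemma turn_le_D: "turn \<le> D"
  unfolding turn_def by (rule Least_le) (use b_D c_pos[of D] D_ge in auto)

lemma D_less_turn: "D < 2 * turn"
  using c_le_b[of turn turn] turn_less by (metis linorder_not_le mult_2)

lemma turn_ge2: "turn \<ge> 2"
  using D_less_turn D_ge by linarith

text \<open>
  The quotient of the two sizes is a product of factors \<open>b l / c (l + 1)\<close>; \<open>b\<close> at one end is
  compared with \<open>c\<close> at the other end, and \<open>c_le_b\<close> applies to each such pair.
\<close>

lemma sphere_size_le: "2 * i + n \<le> D \<Longrightarrow> sphere_size i \<le> sphere_size (i + n)"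
proof (induction n arbitrary: i rule: less_induct)
  case (less n)
  show ?case
  proof (cases "n \<le> 1")
    case True
    show ?thesis
    proof (cases "n = 0")
      case False
      hence n: "n = 1" using True by simp
      have "c (Suc i) \<le> b i" using less.prems n by (intro c_le_b) simp
      moreover have "c (Suc i) > 0" using less.prems n by (intro c_pos) auto
      moreover have "sphere_size i > 0" using sphere_size_pos less.prems by simp
      ultimately show ?thesis using n by (simp add: sphere_size_Suc field_simps)
    qed simp
  next
    case False
    define n' where "n' = n - 2"
    have n: "n = Suc (Suc n')" using False by (simp add: n'_def)
    have IH: "sphere_size (Suc i) \<le> sphere_size (Suc i + n')" using less.IH[of n' "Suc i"] less.prems n by simp
    have pos: "c (Suc i) > 0" "c (i + n) > 0" "sphere_size i > 0" "sphere_size (Suc i) > 0"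
      using less.prems n c_pos sphere_size_pos by auto
    have le: "c (i + n) \<le> b i" "c (Suc i) \<le> b (Suc i + n')" using less.prems n by (auto intro!: c_le_b)
    have "sphere_size i * c (i + n) \<le> sphere_size i * b i" using pos le by (intro mult_left_mono) auto
    also have "\<dots> = sphere_size (Suc i) * c (Suc i)" using pos by (simp add: sphere_size_Suc)
    also have "\<dots> \<le> sphere_size (Suc i + n') * b (Suc i + n')" using IH le pos by (intro mult_mono) auto
    also have "\<dots> = sphere_size (i + n) * c (i + n)" using pos sphere_size_Suc[of "Suc i + n'"] n by simp
    finally show ?thesis using pos by simp
  qed
qed

lemma sphere_size_le_turn: "2 \<le> j \<Longrightarrow> j < turn \<Longrightarrow> sphere_size 2 \<le> sphere_size j"
proof (induction j rule: dec_induct)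
  case (step j)
  have jD: "Suc j < D" using step turn_le_D by simp
  have "c (Suc j) \<le> b j" using before_turn[of "Suc j"] b_antimono[of j "Suc j"] step jD by simp
  moreover have "c (Suc j) > 0" "sphere_size j > 0" using jD c_pos sphere_size_pos by auto
  ultimately have "sphere_size j \<le> sphere_size (Suc j)" by (simp add: sphere_size_Suc field_simps)
  thus ?case using step by simp
qed simp

text \<open>
  The coefficient of \<open>outer (i + 1)\<close> in \<open>edges 1 * psi 1\<close>; it is the product of the
  quotients \<open>c j / b j\<close> for \<open>2 \<le> j \<le> i\<close> by \<open>weight_Suc\<close>.
\<close>

definition weight :: "nat \<Rightarrow> real" where "weight i = edges 1 / edges i"

definition weight_sum :: "nat \<Rightarrow> real" where "weight_sum j = (\<Sum>i=1..<j. weight i)"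

lemma weight_1: "weight 1 = 1" using edges_pos[of 1] D_ge by (simp add: weight_def)

lemma weight_pos: "i < D \<Longrightarrow> weight i > 0" using edges_pos[of 1] edges_pos[of i] D_ge by (simp add: weight_def)

lemma weight_Suc: "Suc i < D \<Longrightarrow> weight (Suc i) = weight i * (c (Suc i) / b (Suc i))"
  using edges_c[of i] edges_pos[of i] edges_pos[of "Suc i"] c_pos[of "Suc i"] b_pos[of "Suc i"]
  by (simp add: weight_def edges_def[of "Suc i"] field_simps)

lemma weight_sum_Suc: "1 \<le> j \<Longrightarrow> weight_sum (Suc j) = weight_sum j + weight j" by (simp add: weight_sum_def)

lemma weight_sum_2: "weight_sum 2 = 1" using weight_1 by (simp add: weight_sum_def numeral_2_eq_2)

lemma weight_sum_mono: assumes "i \<le> j" "j \<le> D" shows "weight_sum i \<le> weight_sum j"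
  unfolding weight_sum_def using assms by (intro sum_mono2) (auto intro!: less_imp_le weight_pos)

text \<open>
  By descending induction the right-hand side of
  \<open>outer (i + 1) = sphere_size (i + 1) + outer (i + 2)\<close> is at most
  \<open>sphere_size (i + 1) * (1 + b (i + 1))\<close>, and beyond the turning index
  \<open>1 + b (i + 1) \<le> c (i + 1)\<close>.
\<close>

lemma outer_le_edges: 
  assumes "turn \<le> Suc i" "i < D" shows "outer (Suc i) \<le> edges i"
  using assms
proof (induction "D - i" arbitrary: i)
  case (Suc n)
  show ?case
  proof (cases "Suc i = D")
    case True
    have "outer D = sphere_size D" by (simp add: outer_def)
    moreover have "sphere_size D * 1 \<le> sphere_size D * c D" using sphere_size_pos[of D] c_pos[of D] D_ge by (intro mult_left_mono) auto
    ultimately show ?thesis using edges_c[of i] Suc True by simp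
  next
    case False
    hence iD: "Suc i < D" using Suc by simp
    have "turn \<le> Suc (Suc i)" "n = D - Suc i" using Suc by auto
    hence IH: "outer (Suc (Suc i)) \<le> edges (Suc i)" using Suc.hyps(1) iD by blast
    have "b (Suc i) < c (Suc i)"
      using turn_less b_antimono[of turn "Suc i"] c_mono[of turn "Suc i"] Suc.prems by simp
    hence bc: "real (b (Suc i)) + 1 \<le> c (Suc i)" by simp
    have "outer (Suc i) \<le> sphere_size (Suc i) + sphere_size (Suc i) * b (Suc i)"
      using outer_Suc[of "Suc i"] IH iD by (simp add: edges_def)
    also have "\<dots> = sphere_size (Suc i) * (b (Suc i) + 1)" by (simp add: algebra_simps)
    also have "\<dots> \<le> sphere_size (Suc i) * c (Suc i)" using bc sphere_size_pos[of "Suc i"] iD by (intro mult_left_mono) auto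
    also have "\<dots> = edges i" using edges_c[of i] Suc by simp
    finally show ?thesis .
  qed
qed simp

lemma sphere_size_sum: "(\<Sum>j=1..D. sphere_size j) = size_V - 1"
proof -
  have "{..D} = insert 0 {1..D}" by auto
  thus ?thesis unfolding size_V_eq by (simp add: sphere_size_0)
qed

text \<open>
  Exchange of summation: a vertex at distance \<open>j\<close> is counted once for every \<open>i < j\<close>.
\<close>

lemma early_part:
  assumes "m \<le> D"
  shows "(\<Sum>i=1..<m. weight i * outer (Suc i)) = (\<Sum>j=1..D. sphere_size j * weight_sum (min j m))"
proof -
  have "(\<Sum>i=1..<m. weight i * outer (Suc i)) = (\<Sum>i=1..<m. \<Sum>j=1..D. if i < j then weight i * sphere_size j else 0)"
  proof (rule sum.cong[OF refl])
    fix i assume i: "i \<in> {1..<m}"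
    have "(\<Sum>j=1..D. if i < j then weight i * sphere_size j else 0) = (\<Sum>j\<in>{j\<in>{1..D}. i < j}. weight i * sphere_size j)"
      by (rule sum.inter_filter[symmetric]) simp
    also have "{j\<in>{1..D}. i < j} = {Suc i..D}" by auto
    finally show "weight i * outer (Suc i) = (\<Sum>j=1..D. if i < j then weight i * sphere_size j else 0)"
      by (simp add: outer_def sum_distrib_left)
  qed
  also have "\<dots> = (\<Sum>j=1..D. \<Sum>i=1..<m. if i < j then weight i * sphere_size j else 0)" by (rule sum.swap)
  also have "\<dots> = (\<Sum>j=1..D. sphere_size j * weight_sum (min j m))"
  proof (rule sum.cong[OF refl])
    fix j
    have "(\<Sum>i=1..<m. if i < j then weight i * sphere_size j else 0) = (\<Sum>i\<in>{i\<in>{1..<m}. i < j}. weight i * sphere_size j)"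
      by (rule sum.inter_filter[symmetric]) simp
    also have "{i\<in>{1..<m}. i < j} = {1..<min j m}" by auto
    finally show "(\<Sum>i=1..<m. if i < j then weight i * sphere_size j else 0) = sphere_size j * weight_sum (min j m)"
      by (simp add: weight_sum_def sum_distrib_left mult.commute)
  qed
  finally show ?thesis .
qed

end

context drg_c21 begin

lemma edges_1: "edges 1 = sphere_size 2"
  using edges_c[of 1] D_ge c21 by (simp add: numeral_2_eq_2)

text \<open>
  Give every vertex other than the centre the budget \<open>T\<close>. By \<open>early_part\<close> a vertex at
  distance \<open>j\<close> spends \<open>weight_sum (min j turn)\<close> on the early terms of \<open>edges 1 * psi 1\<close>.
  Each of the \<open>D - turn\<close> late terms costs at most \<open>sphere_size 2\<close> by \<open>outer_le_edges\<close>, and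
  is paid from what is left over in the spheres with radius in \<open>A\<close>.
\<close>

lemma weighted_outer_bound:
  assumes T: "weight_sum turn \<le> T" and A: "A \<subseteq> {2..D}" "\<And>j. j \<in> A \<Longrightarrow> sphere_size 2 \<le> sphere_size j"
    and enough: "real (D - turn) \<le> (\<Sum>j\<in>A. T - weight_sum (min j turn))"
  shows "edges 1 * psi 1 < T * (size_V - 1)"
proof -
  have k2: "sphere_size 2 > 0" using sphere_size_pos D_ge by simp
  have Fle: "weight_sum (min j turn) \<le> T" for j 
    using weight_sum_mono[of "min j turn" turn] turn_le_D T by simp
  define late where "late = (\<Sum>i=turn..<D. weight i * outer (Suc i))"
  define room where "room = (\<Sum>j=2..D. sphere_size j * (T - weight_sum (min j turn)))"
  have split: "edges 1 * psi 1 = (\<Sum>j=1..D. sphere_size j * weight_sum (min j turn)) + late"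
  proof -
    have "edges 1 * psi 1 = (\<Sum>i=1..<D. weight i * outer (Suc i))"
      by (simp add: psi_def sum_distrib_left weight_def)
    also have "\<dots> = (\<Sum>i=1..<turn. weight i * outer (Suc i)) + late"
      unfolding late_def using turn_le_D turn_ge2 by (simp add: sum.atLeastLessThan_concat)
    finally show ?thesis unfolding early_part[OF turn_le_D] .
  qed
  have "late \<le> (\<Sum>i=turn..<D. sphere_size 2)" unfolding late_def
  proof (rule sum_mono)
    fix i assume "i \<in> {turn..<D}"
    hence i: "turn \<le> Suc i" "i < D" by auto
    have "sphere_size 2 * outer (Suc i) \<le> sphere_size 2 * edges i" using outer_le_edges[OF i] k2 by (intro mult_left_mono) auto
    hence "sphere_size 2 * outer (Suc i) / edges i \<le> sphere_size 2" by (subst pos_divide_le_eq[OF edges_pos[OF i(2)]])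
    thus "weight i * outer (Suc i) \<le> sphere_size 2" unfolding weight_def edges_1 by simp
  qed
  also have "(\<Sum>i=turn..<D. sphere_size 2) = sphere_size 2 * real (D - turn)" by simp
  also have "sphere_size 2 * real (D - turn) \<le> sphere_size 2 * (\<Sum>j\<in>A. T - weight_sum (min j turn))"
    using k2 enough by (intro mult_left_mono) auto
  also have "\<dots> = (\<Sum>j\<in>A. sphere_size 2 * (T - weight_sum (min j turn)))" by (rule sum_distrib_left)
  also have "\<dots> \<le> (\<Sum>j\<in>A. sphere_size j * (T - weight_sum (min j turn)))"
    using A Fle by (intro sum_mono mult_right_mono) auto
  also have "\<dots> \<le> room" unfolding room_def
  proof (rule sum_mono2[OF _ A(1)])
    fix j assume "j \<in> {2..D} - A"
    hence "sphere_size j > 0" by (intro sphere_size_pos) auto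
    thus "0 \<le> sphere_size j * (T - weight_sum (min j turn))" using Fle[of j] by simp
  qed simp
  finally have late: "late \<le> room" .
  have "(\<Sum>j=1..D. sphere_size j * (T - weight_sum (min j turn))) = sphere_size 1 * (T - weight_sum (min 1 turn)) + room"
    using sum.atLeast_Suc_atMost[of 1 D "\<lambda>j. sphere_size j * (T - weight_sum (min j turn))"] D_ge
    unfolding room_def by (simp only: Suc_1)
  moreover have "sphere_size 1 * (T - weight_sum (min 1 turn)) > 0"
  proof -
    have "1 \<le> weight_sum turn" using weight_sum_mono[of 2 turn] weight_sum_2 turn_ge2 turn_le_D by simp
    moreover have "weight_sum (min 1 turn) = 0" using turn_ge2 by (simp add: weight_sum_def)
    ultimately show ?thesis unfolding sphere_size_1 using T k_gt by simp
  qed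
  moreover have "(\<Sum>j=1..D. sphere_size j * (T - weight_sum (min j turn))) = T * (size_V - 1) - (\<Sum>j=1..D. sphere_size j * weight_sum (min j turn))"
  proof -
    have "sphere_size j * (T - weight_sum (min j turn)) = T * sphere_size j - sphere_size j * weight_sum (min j turn)" for j
      by (simp add: algebra_simps)
    thus ?thesis unfolding sphere_size_sum[symmetric] by (simp only: sum_subtractf sum_distrib_left)
  qed
  ultimately show ?thesis using split late by linarith
qed

lemma target_from_outer:
  fixes T :: real
  assumes "edges 1 * psi 1 < T * (size_V - 1)" "T * k \<le> 6 * b 1"
  shows "psi 0 - psi D < (1 + 6 / k) * (psi 0 - psi 1)"
proof -
  have k0: "real k > 0" using k_gt by simp
  have b0: "real (b 1) > 0" using b_pos[of 1] D_ge by simp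
  have n0: "size_V \<ge> 1" using sphere_size_sum sum_nonneg[of "{1..D}" sphere_size] sphere_size_pos by (smt (verit) atLeastAtMost_iff)
  have e1: "edges 1 = k * b 1" unfolding edges_def sphere_size_1 by simp
  have "k * (k * b 1 * psi 1) < k * (T * (size_V - 1))" using assms(1) k0 e1 by simp
  also have "\<dots> = T * k * (size_V - 1)" by simp
  also have "\<dots> \<le> 6 * b 1 * (size_V - 1)" using assms(2) n0 by (intro mult_right_mono) auto
  also have "\<dots> = real (b 1) * (6 * (size_V - 1))" by simp
  also have "k * (k * b 1 * psi 1) = real (b 1) * (k * k * psi 1)" by simp
  finally have "real (b 1) * (k * k * psi 1) < real (b 1) * (6 * (size_V - 1))" .
  hence "k * k * psi 1 < 6 * (size_V - 1)" using b0 by simp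
  hence "psi 1 < 6 / k * ((size_V - 1) / k)" using k0 by (simp add: field_simps)
  thus ?thesis using psi_01 psi_D by (simp add: algebra_simps)
qed

text \<open>
  The spheres of radius \<open>2\<close> to \<open>D - 2\<close> are at least as large as the second one. The second
  one leaves a budget of \<open>2\<close> and the others \<open>1 / 2\<close> each, which covers
  \<open>D - turn \<le> (D - 1) / 2\<close>.
\<close>

lemma target_small_weight_sum:
  fixes T :: real
  assumes "weight_sum turn \<le> T - 1 / 2" "T \<ge> 3" "T * k \<le> 6 * b 1"
  shows "psi 0 - psi D < (1 + 6 / k) * (psi 0 - psi 1)"
proof (rule target_from_outer[OF _ assms(3)])
  define A where "A = {2..max 2 (D - 2)}"
  have F2: "weight_sum (min 2 turn) = 1" using weight_sum_2 turn_ge2 by simp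
  have A_eq: "A = insert 2 {3..D - 2}" using D_ge by (auto simp: A_def)
  have ge: "1 / 2 \<le> T - weight_sum (min j turn)" for j
    using weight_sum_mono[of "min j turn" turn] turn_le_D assms(1) by simp
  show "edges 1 * psi 1 < T * (size_V - 1)"
  proof (rule weighted_outer_bound[where A = A])
    show "weight_sum turn \<le> T" using assms by simp
    show "A \<subseteq> {2..D}" using D_ge by (auto simp: A_def)
    show "sphere_size 2 \<le> sphere_size j" if "j \<in> A" for j
    proof (cases "j = 2")
      case False
      hence j: "2 * 2 + (j - 2) \<le> D" "2 + (j - 2) = j" using that by (auto simp: A_def)
      show ?thesis using sphere_size_le[OF j(1)] unfolding j(2) .
    qed simp
    have "(\<Sum>j\<in>{3..D - 2}. 1 / 2) \<le> (\<Sum>j\<in>{3..D - 2}. T - weight_sum (min j turn))"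
      by (intro sum_mono ge)
    hence "2 + real (D - 4) / 2 \<le> (\<Sum>j\<in>A. T - weight_sum (min j turn))"
      using assms(2) F2 unfolding A_eq by simp
    moreover have "2 * (D - turn) \<le> 4 + (D - 4)" using D_less_turn by simp
    hence "real (2 * (D - turn)) \<le> real (4 + (D - 4))" using of_nat_le_iff by blast
    hence "real (D - turn) \<le> 2 + real (D - 4) / 2" by simp
    ultimately show "real (D - turn) \<le> (\<Sum>j\<in>A. T - weight_sum (min j turn))" by linarith
  qed
qed

text \<open>
  The first factor is \<open>c 2 / b 2 \<le> 1 / B\<close>, and each later one is at most \<open>1 - 1 / B\<close>.
\<close>

lemma weight_sum_geometric:
  assumes s: "2 \<le> s" "s \<le> D" and B: "B \<ge> 2" 
    and bc: "\<And>i. 2 \<le> i \<Longrightarrow> i < s \<Longrightarrow> c i \<le> B - 1 \<and> B \<le> b i"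
  shows "weight_sum s \<le> 2 - (1 - 1 / real B) ^ (s - 2)"
    and "3 \<le> s \<Longrightarrow> weight (s - 1) \<le> (1 - 1 / real B) ^ (s - 3) / B"
proof -
  define y where "y = 1 - 1 / real B"
  have Br: "real B \<ge> 2" using B by simp
  have y: "0 \<le> y" "y = (real B - 1) / B" using Br by (auto simp: y_def field_simps)
  have w: "weight i \<le> y ^ (i - 2) / B" if "2 \<le> i" "i < s" for i
    using that
  proof (induction i rule: dec_induct)
    case base
    have "weight 2 = c 2 / b 2" using weight_Suc[of 1] weight_1 s base by (simp add: numeral_2_eq_2)
    also have "\<dots> = 1 / b 2" using c21 by simp
    also have "\<dots> \<le> 1 / B" using bc[of 2] base Br by (intro divide_left_mono) auto
    finally show ?case by simp
  next
    case (step i)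
    have iD: "Suc i < D" using step s by simp
    have bi: "b (Suc i) > 0" using b_pos iD by blast
    have cb: "c (Suc i) \<le> B - 1" "B \<le> b (Suc i)" using bc[of "Suc i"] step by auto
    hence cr: "real (c (Suc i)) \<le> real B - 1" using B by linarith
    have "c (Suc i) / b (Suc i) \<le> (real B - 1) / B"
      using cr cb Br by (intro frac_le) auto
    hence r: "c (Suc i) / b (Suc i) \<le> y" using y by simp
    have "weight (Suc i) = weight i * (c (Suc i) / b (Suc i))" using weight_Suc iD by blast
    also have "\<dots> \<le> (y ^ (i - 2) / B) * y"
      using step r y Br by (intro mult_mono) auto
    also have "\<dots> = y ^ (Suc i - 2) / B"
    proof -
      have e: "Suc i - 2 = Suc (i - 2)" using step.hyps by simp
      show ?thesis unfolding e power_Suc2 by (rule times_divide_eq_left)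
    qed
    finally show ?case .
  qed
  have "weight_sum j \<le> 2 - y ^ (j - 2)" if "2 \<le> j" "j \<le> s" for j
    using that
  proof (induction j rule: dec_induct)
    case base
    show ?case using weight_sum_2 by simp
  next
    case (step j)
    have "weight_sum (Suc j) = weight_sum j + weight j" using step by (intro weight_sum_Suc) simp
    also have "\<dots> \<le> 2 - y ^ (j - 2) + y ^ (j - 2) / B" using step w[of j] by simp
    also have "\<dots> = 2 - y ^ (j - 2) * y" using Br by (simp add: y_def field_simps)
    also have "y ^ (j - 2) * y = y ^ (Suc j - 2)"
    proof -
      have e: "Suc j - 2 = Suc (j - 2)" using step.hyps by simp
      show ?thesis unfolding e power_Suc2 ..
    qed
    finally show ?case .
  qed
  thus "weight_sum s \<le> 2 - (1 - 1 / real B) ^ (s - 2)" using s by (simp add: y_def)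
  assume "3 \<le> s"
  moreover have "s - 1 - 2 = s - 3" by simp
  ultimately show "weight (s - 1) \<le> (1 - 1 / real B) ^ (s - 3) / B" using w[of "s - 1"] by (simp add: y_def)
qed

lemma weight_sum_flat:
  assumes s: "2 \<le> s" and eq: "\<And>i. s \<le> i \<Longrightarrow> i < turn \<Longrightarrow> c i = b i" and "s \<le> j" "j \<le> turn"
  shows "weight_sum j = weight_sum s + real (j - s) * weight (s - 1)"
proof -
  have w: "weight i = weight (s - 1)" if "s - 1 \<le> i" "i < turn" for i
    using that
  proof (induction i rule: dec_induct)
    case (step i)
    have iD: "Suc i < D" using step turn_le_D by simp
    have "c (Suc i) = b (Suc i)" using eq[of "Suc i"] step s by simp
    moreover have "b (Suc i) > 0" using b_pos[OF iD] .
    ultimately show ?case using weight_Suc[OF iD] step by simp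
  qed simp
  show ?thesis using assms(3,4)
  proof (induction j rule: dec_induct)
    case (step j)
    have "weight_sum (Suc j) = weight_sum j + weight j" using step s by (intro weight_sum_Suc) simp
    thus ?case using step w[of j] by (simp add: Suc_diff_le algebra_simps)
  qed simp
qed

end

lemma decay_three: "(2 / 3 :: real) ^ n * (real n + 1) \<le> 3 / 2"
proof (induction n)
  case (Suc n)
  show ?case
  proof (cases "n = 0")
    case False
    have "(2 / 3 :: real) ^ Suc n * (real (Suc n) + 1) = (2 / 3) ^ n * (2 / 3 * (real n + 2))" by simp
    also have "\<dots> \<le> (2 / 3) ^ n * (real n + 1)" using False by (intro mult_left_mono) auto
    finally show ?thesis using Suc by linarith
  qed simp
qed simp

lemma decay_two: "2 \<le> n \<Longrightarrow> (1 / 2 :: real) ^ n * (3 * real n + 4) \<le> 3"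
proof (induction n rule: dec_induct)
  case (step n)
  have "(1 / 2 :: real) ^ Suc n * (3 * real (Suc n) + 4) = (1 / 2) ^ n * (1 / 2 * (3 * real n + 7))" by simp
  also have "\<dots> \<le> (1 / 2) ^ n * (3 * real n + 4)" by (intro mult_left_mono) auto
  finally show ?case using step by linarith
qed (simp add: power2_eq_square)

text \<open>
  With \<open>t = n / B\<close> the left-hand side is at most \<open>exp (- t) * (3 * t + 1 / 2)\<close>, and \<open>exp t\<close>
  dominates its quadratic Taylor polynomial.
\<close>

lemma decay_large:
  fixes B :: real assumes "B \<ge> 4"
  shows "(1 - 1 / B) ^ n * (3 * real n + 6 - B) / B \<le> 3 / 2"
proof -
  define t where "t = real n / B"
  have t0: "t \<ge> 0" using assms by (simp add: t_def)
  have "1 - 1 / B \<le> exp (- (1 / B))" using exp_ge_add_one_self[of "- (1 / B)"] by simp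
  moreover have "0 \<le> 1 - 1 / B" using assms by (simp add: field_simps)
  ultimately have "(1 - 1 / B) ^ n \<le> exp (- (1 / B)) ^ n" by (rule power_mono)
  also have "exp (- (1 / B)) ^ n = exp (- t)" by (simp add: t_def exp_of_nat_mult[symmetric])
  finally have y: "(1 - 1 / B) ^ n \<le> exp (- t)" .
  have "(3 * real n + 6 - B) / B = 3 * t + 6 / B - 1" using assms by (simp add: t_def field_simps)
  moreover have "6 / B \<le> 3 / 2" using assms by (simp add: field_simps)
  ultimately have z: "(3 * real n + 6 - B) / B \<le> 3 * t + 1 / 2" by simp
  have "(1 - 1 / B) ^ n * ((3 * real n + 6 - B) / B) \<le> (1 - 1 / B) ^ n * (3 * t + 1 / 2)"
    using z \<open>0 \<le> 1 - 1 / B\<close> by (intro mult_left_mono) auto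
  also have "\<dots> \<le> exp (- t) * (3 * t + 1 / 2)" using y t0 by (intro mult_right_mono) auto
  also have "\<dots> \<le> exp (- t) * (3 / 2 * (1 + t + t\<^sup>2 / 2))"
  proof (intro mult_left_mono)
    have "0 \<le> (t - 1)\<^sup>2" by simp
    thus "3 * t + 1 / 2 \<le> 3 / 2 * (1 + t + t\<^sup>2 / 2)" by (simp add: power2_eq_square algebra_simps)
  qed simp
  also have "\<dots> \<le> exp (- t) * (3 / 2 * exp t)"
    using exp_lower_Taylor_quadratic[OF t0] by (intro mult_left_mono) auto
  also have "\<dots> = 3 / 2" by (simp add: exp_minus field_simps)
  finally show ?thesis by simp
qed

text \<open>
  The left-hand side bounds the excess over \<open>2\<close> of the weight sum when a flat range of maximal length \<open>3 * n + 5\<close>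
  starts at index \<open>n + 3\<close> and \<open>b\<close> has the value \<open>B\<close> just before it. For \<open>B = 2\<close> and \<open>n \<le> 1\<close>
  the bound fails.
\<close>

lemma decay:
  assumes "B \<ge> (3::nat) \<or> B = 2 \<and> n \<ge> 2"
  shows "(1 - 1 / real B) ^ n * (3 * real n + 6 - real B) / real B \<le> 3 / 2"
proof -
  consider "B = 2" "n \<ge> 2" | "B = 3" | "B \<ge> 4" using assms by linarith
  thus ?thesis
  proof cases
    case 1
    have "(1 - 1 / real B) ^ n * (3 * real n + 6 - real B) / real B = (1 / 2) ^ n * (3 * real n + 4) / 2"
      using 1 by simp
    thus ?thesis using decay_two[OF 1(2)] by linarith
  next
    case 2
    have "(1 - 1 / real B) ^ n * (3 * real n + 6 - real B) / real B = (2 / 3) ^ n * (real n + 1)"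
      using 2 by simp
    thus ?thesis using decay_three[of n] by simp
  next
    case 3
    thus ?thesis using decay_large[of "real B" n] by simp
  qed
qed

section \<open>Flat ranges of the intersection numbers\<close>

context drg_c21 begin

lemma valency_cases:
  obtains "k = 2 * (a 1 + 1)" "3 * real k \<le> 6 * b 1" | "3 * (a 1 + 1) \<le> k" "4 * real k \<le> 6 * b 1"
proof -
  have arith: "3 * K \<le> 6 * B" if "K = 1 + A + B" "K = 2 * (A + 1)" for K A B :: nat
    using that by presburger
  have arith': "4 * K \<le> 6 * B" if "K = 1 + A + B" "3 * (A + 1) \<le> K" for K A B :: nat
    using that by presburger
  have "3 * real k \<le> 6 * b 1" if "k = 2 * (a 1 + 1)"
    using arith[OF k_b1 that] by linarith
  moreover have "4 * real k \<le> 6 * b 1" if "3 * (a 1 + 1) \<le> k"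
    using arith'[OF k_b1 that] by linarith
  ultimately show ?thesis using valency_dichotomy that by blast
qed

text \<open>
  The weights decrease geometrically all the way to the turning index, so they add up to at
  most \<open>2\<close>.
\<close>

lemma strict_target:
  assumes "\<And>i. 2 \<le> i \<Longrightarrow> i < turn \<Longrightarrow> c i < b i"
  shows "psi 0 - psi D < (1 + 6 / k) * (psi 0 - psi 1)"
proof -
  have t3: "turn \<ge> 3"
  proof (rule ccontr)
    assume "\<not> turn \<ge> 3"
    hence "turn = 2" using turn_ge2 by simp
    hence "b 2 < 1" using turn_less c21 by simp
    thus False using b_pos[of 2] D_ge by simp
  qed
  define B where "B = b (turn - 1)"
  have cB: "c (turn - 1) < B" using assms[of "turn - 1"] t3 by (simp add: B_def)
  moreover have "c (turn - 1) > 0" using t3 turn_le_D by (intro c_pos) auto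
  ultimately have B2: "B \<ge> 2" by simp
  have y: "0 \<le> (1 - 1 / real B) ^ (turn - 2)" using B2 by simp
  have "weight_sum turn \<le> 2 - (1 - 1 / real B) ^ (turn - 2)"
  proof (rule weight_sum_geometric(1)[OF turn_ge2 turn_le_D B2])
    fix i assume i: "2 \<le> i" "i < turn"
    have "c i \<le> c (turn - 1)" using i turn_le_D by (intro c_mono) auto
    moreover have "B \<le> b i" unfolding B_def using i turn_le_D by (intro b_antimono) auto
    ultimately show "c i \<le> B - 1 \<and> B \<le> b i" using cB by simp
  qed
  hence w: "weight_sum turn \<le> 2" using y by linarith
  show ?thesis
    by (rule valency_cases; rule target_small_weight_sum[of 3]; use w in simp)
qed

end

text \<open>
  The weights stop decreasing at \<open>s\<close>, the first index from \<open>2\<close> on where \<open>c\<close> and \<open>b\<close> have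
  met. Between \<open>s\<close> and the turning index \<open>c\<close> cannot decrease, \<open>b\<close> cannot increase and
  \<open>c \<le> b\<close>, so both stay constant.
\<close>

locale drg_c21_flat = drg_c21 +
  fixes s C :: nat
  assumes s2: "2 \<le> s" and s_turn: "s < turn" and C_def: "C = c s"
    and eq_s: "c s = b s" and less_s: "\<And>i. 2 \<le> i \<Longrightarrow> i < s \<Longrightarrow> c i < b i"
begin

lemma flat_values: 
  assumes "s \<le> i" "i < turn" shows "c i = C" "b i = C"
proof -
  have "C \<le> c i" "b i \<le> C" using c_mono[of s i] b_antimono[of s i] assms turn_le_D C_def eq_s by auto
  moreover have "c i \<le> b i" using before_turn assms by simp
  ultimately show "c i = C" "b i = C" by auto
qed

lemma weight_sum_at:
  assumes "s \<le> j" "j \<le> turn" shows "weight_sum j = weight_sum s + real (j - s) * weight (s - 1)"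
  by (rule weight_sum_flat[OF s2 _ assms]) (simp add: flat_values)

lemma sD: "s < D" using s_turn turn_le_D by simp

text \<open>
  Before \<open>s\<close> the weights are at least halved in each step, so the flat range adds at most
  \<open>turn - s\<close> times \<open>(1 / 2) ^ (s - 2)\<close>. If neighbourhoods consist of two cliques, the range
  has length one by \<open>edge_clique_bound\<close>, since \<open>a 1 > 0\<close>. Otherwise the budget is \<open>4\<close>
  instead of \<open>3\<close>, and the range has length at most \<open>s\<close> by \<open>no_unique_geodesics\<close>.
\<close>

lemma flat_one_target:
  assumes C1: "C = 1"
  shows "psi 0 - psi D < (1 + 6 / k) * (psi 0 - psi 1)"
proof -
  have c1: "c i = 1" if "1 \<le> i" "i \<le> s" for i
    using c_mono[of i s] c_pos[of i] that sD C1 C_def by simp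
  have bc: "c i \<le> 2 - 1 \<and> 2 \<le> b i" if "2 \<le> i" "i < s" for i
    using less_s[OF that] c1[of i] that by simp
  have half: "1 - 1 / real 2 = 1 / 2" by simp
  have ws: "weight_sum s \<le> 2 - (1 / 2) ^ (s - 2)"
    using weight_sum_geometric(1)[of s 2] s2 sD bc unfolding half by simp
  have w1: "weight (s - 1) \<le> (1 / 2) ^ (s - 2)"
  proof (cases "s = 2")
    case True
    thus ?thesis using weight_1 by simp
  next
    case False
    hence s3: "3 \<le> s" using s2 by simp
    have "weight (s - 1) \<le> (1 / 2) ^ (s - 3) / 2"
      using weight_sum_geometric(2)[of s 2] s3 sD bc unfolding half by simp
    also have "\<dots> = (1 / 2) ^ Suc (s - 3)" by simp
    also have "Suc (s - 3) = s - 2" using s3 by simp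
    finally show ?thesis .
  qed
  define l where "l = turn - s"
  have l1: "l \<ge> 1" using s_turn by (simp add: l_def)
  have "weight_sum turn = weight_sum s + real l * weight (s - 1)" using weight_sum_at[of turn] s_turn by (simp add: l_def)
  also have "\<dots> \<le> 2 - (1 / 2) ^ (s - 2) + real l * (1 / 2) ^ (s - 2)"
    using ws w1 by (intro add_mono mult_left_mono) auto
  also have "\<dots> = 2 + real (l - 1) * (1 / 2) ^ (s - 2)" using l1 by (simp add: of_nat_diff algebra_simps)
  finally have weight_le: "weight_sum turn \<le> 2 + real (l - 1) * (1 / 2) ^ (s - 2)" .
  show ?thesis
  proof (cases rule: valency_cases)
    case 1
    have "l = 1"
    proof (rule ccontr)
      assume "l \<noteq> 1"
      hence "Suc s < turn" using l1 by (simp add: l_def)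
      hence "c (Suc s) = 1" "b s = 1" using flat_values[of "Suc s"] flat_values[of s] C1 by auto
      hence "a 1 = 0" using edge_clique_bound[OF sD] by simp
      thus False using 1 k_gt by simp
    qed
    thus ?thesis using target_small_weight_sum[of 3] 1 weight_le by simp
  next
    case 2
    have "l \<le> s"
    proof (rule ccontr)
      assume "\<not> l \<le> s"
      hence "2 * s < turn" by (simp add: l_def)
      hence "c (2 * s) = 1" "b s = 1" using flat_values[of "2 * s"] flat_values[of s] C1 s2 by auto
      thus False using no_unique_geodesics[of s] s2 \<open>2 * s < turn\<close> turn_le_D by simp
    qed
    moreover have "n + 1 \<le> 2 ^ n" for n :: nat by (induction n) auto
    from this[of "s - 2"] have "s - 1 \<le> 2 ^ (s - 2)" using s2 by simp
    ultimately have "l - 1 \<le> 2 ^ (s - 2)" by simp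
    hence "real (l - 1) \<le> real (2 ^ (s - 2))" using of_nat_le_iff by blast
    hence "real (l - 1) \<le> 2 ^ (s - 2)" by simp
    hence "real (l - 1) * (1 / 2) ^ (s - 2) \<le> 2 ^ (s - 2) * (1 / 2) ^ (s - 2)"
      by (intro mult_right_mono) auto
    also have "\<dots> = (2 * (1 / 2)) ^ (s - 2)" by (rule power_mult_distrib[symmetric])
    also have "\<dots> = 1" by simp
    finally have "weight_sum turn \<le> 3" using weight_le by simp
    thus ?thesis using target_small_weight_sum[of 4] 2 by simp
  qed
qed

text \<open>
  By \<open>line_like_c\<close> neighbourhoods consist of at least three cliques, so the budget is \<open>4\<close>,
  and \<open>flat_contradiction\<close> limits the flat range to \<open>3 * s - 4\<close> indices. The weight sum is
  then at most \<open>2 + 3 / 2\<close> by \<open>decay\<close>, except for a few small parameters.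
\<close>

lemma flat_many_target:
  assumes C2: "C \<ge> 2"
  shows "psi 0 - psi D < (1 + 6 / k) * (psi 0 - psi 1)"
proof -
  have v: "3 * (a 1 + 1) \<le> k" "4 * real k \<le> 6 * b 1"
  proof -
    have "3 * (a 1 + 1) \<le> k \<and> 4 * real k \<le> 6 * b 1"
    proof (cases rule: valency_cases)
      case 1
      hence "c s = 1" using line_like_c[of s] s2 sD by simp
      thus ?thesis using C2 C_def by simp
    qed auto
    thus "3 * (a 1 + 1) \<le> k" "4 * real k \<le> 6 * b 1" by auto
  qed
  have s3: "s \<ge> 3"
  proof (rule ccontr)
    assume "\<not> s \<ge> 3"
    hence "s = 2" using s2 by simp
    thus False using C2 C_def c21 by simp
  qed
  have l: "turn \<le> 4 * s - 4"
  proof (rule ccontr)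
    assume long: "\<not> turn \<le> 4 * s - 4"
    interpret F: drg_flat V N d b c k D s C
    proof
      show "3 \<le> s" "4 * s - 4 \<le> D" using s3 long turn_le_D by auto
      show "c i = C" if "s \<le> i" "i \<le> 4 * s - 4" for i using flat_values[of i] that long by simp
      show "b i = C" if "s \<le> i" "i \<le> 3 * s - 4" for i using flat_values[of i] that long by simp
    qed
    have "C + a s + C = k" using abc_sum[of s] sD flat_values[of s] s_turn by simp
    hence "2 * C \<le> k" by simp
    moreover have "K < 2 * B" if "K = 1 + A + B" "3 * (A + 1) \<le> K" for K A B :: nat
      using that by presburger
    hence "k < 2 * b 1" using v(1) k_b1 by blast
    ultimately have "C < b 1" by linarith
    have "2 * C * C \<le> k * C" using \<open>2 * C \<le> k\<close> by simp
    also have "\<dots> < k * b 1" using \<open>C < b 1\<close> k_gt by simp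
    finally show False using F.flat_contradiction[OF c21] by simp
  qed
  define B where "B = b (s - 1)"
  have cB: "c (s - 1) < B" unfolding B_def using less_s[of "s - 1"] s3 by simp
  have cp: "c (s - 1) > 0" using s3 sD by (intro c_pos) auto
  have B2: "B \<ge> 2" using cB cp by simp
  have bc: "c i \<le> B - 1 \<and> B \<le> b i" if i: "2 \<le> i" "i < s" for i
  proof -
    have "c i \<le> c (s - 1)" using i sD by (intro c_mono) auto
    moreover have "B \<le> b i" unfolding B_def using i sD by (intro b_antimono) auto
    ultimately show ?thesis using cB by simp
  qed
  have geo: "weight_sum s \<le> 2 - (1 - 1 / real B) ^ (s - 2)" "weight (s - 1) \<le> (1 - 1 / real B) ^ (s - 3) / B"
    using weight_sum_geometric[OF s2 less_imp_le[OF sD] B2] bc s3 by blast+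
  define n where "n = s - 3"
  have sn: "s = n + 3" using s3 by (simp add: n_def)
  define y where "y = 1 - 1 / real B"
  have Br: "real B \<ge> 2" using B2 by simp
  have y0: "0 \<le> y" using Br by (simp add: y_def)
  have ws: "weight_sum s \<le> 2 - y ^ Suc n" using geo(1) by (simp add: sn y_def)
  have w1: "weight (s - 1) \<le> y ^ n / B" using geo(2) by (simp add: sn y_def)
  have wt0: "weight (s - 1) \<ge> 0" using weight_pos[of "s - 1"] sD by linarith
  have ln: "turn - s \<le> 3 * n + 5" using l sn by simp
  show ?thesis
  proof (cases "B \<ge> 3 \<or> B = 2 \<and> n \<ge> 2")
    case True
    have "weight_sum turn = weight_sum s + real (turn - s) * weight (s - 1)" using weight_sum_at[of turn] s_turn by simp
    also have "\<dots> \<le> (2 - y ^ Suc n) + real (3 * n + 5) * (y ^ n / B)"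
      using ws w1 wt0 ln by (intro add_mono mult_mono) auto
    also have "\<dots> = 2 + y ^ n * (3 * real n + 6 - real B) / B"
      using Br by (simp add: y_def field_simps)
    also have "\<dots> \<le> 2 + 3 / 2" using decay[OF True] unfolding y_def by simp
    finally have "weight_sum turn \<le> 4 - 1 / 2" by simp
    thus ?thesis using target_small_weight_sum[of 4] v(2) by simp
  next
    case False
    hence B: "B = 2" "n \<le> 1" using B2 by auto
    have y: "y = 1 / 2" using B by (simp add: y_def)
    \<comment> \<open>In the exceptional cases the weight sum can be as large as \<open>4\<close>. What the spheres of
      small radius leave of their budget is then added up explicitly.\<close>
    have room: ?thesis 
      if r: "r \<le> turn" "weight_sum turn \<le> 4" "real (turn - 1) \<le> (\<Sum>j\<in>{2..<r}. 4 - weight_sum j)" for r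
    proof (rule target_from_outer[OF _ v(2)], rule weighted_outer_bound[OF r(2)])
      show "{2..<r} \<subseteq> {2..D}" using r turn_le_D by auto
      show "sphere_size 2 \<le> sphere_size j" if "j \<in> {2..<r}" for j using sphere_size_le_turn[of j] that r by simp
      have "(\<Sum>j\<in>{2..<r}. 4 - weight_sum (min j turn)) = (\<Sum>j\<in>{2..<r}. 4 - weight_sum j)"
        using r by (intro sum.cong) (auto simp: min_def)
      thus "real (D - turn) \<le> (\<Sum>j\<in>{2..<r}. 4 - weight_sum (min j turn))"
        using r(3) D_less_turn by linarith
    qed
    have i5: "{2..<5::nat} = {2, 3, 4}" and i4: "{2..<4::nat} = {2, 3}" and i7: "{2..<7::nat} = {2, 3, 4, 5, 6}" by auto
    have w3: "weight_sum 3 \<le> 3 / 2"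
    proof -
      have "weight_sum 3 \<le> 2 - (1 - 1 / real B) ^ (3 - 2)"
        by (rule weight_sum_geometric(1)[OF _ _ B2 bc]) (use s3 D_ge in auto)
      thus ?thesis using B by simp
    qed
    consider "n = 0" | "n = 1" using B by linarith
    thus ?thesis
    proof cases
      case 1
      hence s: "s = 3" using sn by simp
      have t: "4 \<le> turn" "turn \<le> 8" using s_turn l s by auto
      have w: "weight_sum j \<le> 3 / 2 + real (j - 3) / 2" if "3 \<le> j" "j \<le> turn" for j
      proof -
        have "real (j - 3) * weight 2 \<le> real (j - 3) * (1 / 2)" using w1 s B 1 by (intro mult_left_mono) auto
        moreover have "weight_sum j = weight_sum 3 + real (j - 3) * weight 2" using weight_sum_at[of j] that unfolding s by simp
        ultimately show ?thesis using w3 by linarith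
      qed
      have "real (turn - 3) \<le> 5" using t by linarith
      hence W: "weight_sum turn \<le> 4" using w[of turn] t by linarith
      show ?thesis
      proof (cases "turn = 4")
        case True
        show ?thesis by (rule room[of 4]) (use True W w[of 3] weight_sum_2 in \<open>auto simp: i4\<close>)
      next
        case False
        have "real (turn - 1) \<le> 7" using t by linarith
        thus ?thesis using False t W w[of 3] w[of 4] weight_sum_2 by (intro room[of 5]) (auto simp: i5)
      qed
    next
      case 2
      hence s: "s = 4" using sn by simp
      have t: "5 \<le> turn" "turn \<le> 12" using s_turn l s by auto
      have w4: "weight_sum 4 \<le> 7 / 4" using ws s y 2 by (simp add: power2_eq_square)
      have w: "weight_sum j \<le> 7 / 4 + real (j - 4) / 4" if "4 \<le> j" "j \<le> turn" for j
      proof -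
        have "real (j - 4) * weight 3 \<le> real (j - 4) * (1 / 4)" using w1 s B y 2 by (intro mult_left_mono) auto
        moreover have "weight_sum j = weight_sum 4 + real (j - 4) * weight 3" using weight_sum_at[of j] that unfolding s by simp
        ultimately show ?thesis using w4 by linarith
      qed
      have "real (turn - 4) \<le> 8" using t by linarith
      hence W: "weight_sum turn \<le> 4" using w[of turn] t by linarith
      show ?thesis
      proof (cases "turn \<le> 8")
        case True
        hence "real (turn - 1) \<le> 7" by linarith
        thus ?thesis using t W w[of 4] w3 weight_sum_2 by (intro room[of 5]) (auto simp: i5)
      next
        case False
        have "real (turn - 1) \<le> 11" using t by linarith
        thus ?thesis using False W w[of 4] w[of 5] w[of 6] w3 weight_sum_2 by (intro room[of 7]) (auto simp: i7)
      qed
    qed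
  qed
qed

end

context drg_c21 begin

theorem target_c2_one: "psi 0 - psi D < (1 + 6 / k) * (psi 0 - psi 1)"
proof (cases "\<exists>i. 2 \<le> i \<and> i < turn \<and> c i = b i")
  case False
  show ?thesis
  proof (rule strict_target)
    fix i assume "2 \<le> i" "i < turn"
    thus "c i < b i" using before_turn[of i] False le_neq_implies_less by blast
  qed
next
  case True
  define s where "s = (LEAST i. 2 \<le> i \<and> i < turn \<and> c i = b i)"
  have s: "2 \<le> s \<and> s < turn \<and> c s = b s" unfolding s_def by (rule LeastI_ex[OF True])
  interpret drg_c21_flat V N d b c k D s "c s"
  proof
    fix i assume i: "2 \<le> i" "i < s"
    hence "c i \<noteq> b i" using not_less_Least[of i "\<lambda>i. 2 \<le> i \<and> i < turn \<and> c i = b i"] s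
      unfolding s_def[symmetric] by auto
    thus "c i < b i" using before_turn[of i] i s by simp
  qed (use s in auto)
  have "c s > 0" using s turn_le_D by (intro c_pos) auto
  then consider "c s = 1" | "c s \<ge> 2" by linarith
  thus ?thesis using flat_one_target flat_many_target by cases auto
qed

end

context drg begin

theorem target: "psi 0 - psi D < (1 + 6 / k) * (psi 0 - psi 1)"
proof (cases "c 2 \<ge> 2")
  case True
  thus ?thesis by (rule target_c2)
next
  case False
  hence "c 2 = 1" using c_pos[of 2] D_ge by simp
  then interpret drg_c21 V N d b c k D by unfold_locales
  show ?thesis by (rule target_c2_one)
qed

end

section \<open>Distance-regular graphs\<close>

context pair_graph begin

lemma awalk_snoc:
  assumes "awalk u p w" "(w, v) \<in> parcs G" shows "awalk u (p @ [(w, v)]) v"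
proof -
  have "last (pawalk_verts u p) = w" using assms(1) by (elim awalkE)
  moreover have "v \<in> pverts G" using assms(2) by (rule in_arcsD2)
  ultimately show ?thesis using assms by (simp add: awalk_Cons_iff awalk_Nil_iff)
qed

lemma awalk_concat:
  assumes "awalk u p w" "awalk w q v" shows "awalk u (p @ q) v"
proof -
  have "last (pawalk_verts u p) = w" using assms(1) by (elim awalkE)
  thus ?thesis using assms by simp
qed

lemma awalk_reverse: "awalk u p v \<Longrightarrow> \<exists>q. awalk v q u \<and> length q = length p"
proof (induction p arbitrary: u)
  case Nil
  thus ?case by (auto simp: awalk_Nil_iff)
next
  case (Cons e p)
  obtain x y where e: "e = (x, y)" by (cases e)
  hence "(x, y) \<in> parcs G" "u = x" "awalk y p v" using Cons.prems by (auto simp: awalk_Cons_iff)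
  moreover from this obtain q where "awalk v q y" "length q = length p" using Cons.IH by blast
  moreover have "(y, x) \<in> parcs G" using graph_symmetric[of x y] \<open>(x, y) \<in> parcs G\<close> by simp
  ultimately have "awalk v (q @ [(y, x)]) u \<and> length (q @ [(y, x)]) = length (e # p)"
    using awalk_snoc by simp
  thus ?case by blast
qed

lemma connected_awalk:
  assumes "Digraph_Component.connected (with_proj G)" "u \<in> pverts G" "v \<in> pverts G"
  shows "\<exists>p. awalk u p v"
proof -
  have "strongly_connected (with_proj G)"
    using symmetric_connected_imp_strongly_connected[OF pair_sym_arcs] assms(1) .
  hence "u \<rightarrow>\<^sup>*\<^bsub>with_proj G\<^esub> v" using assms by (auto simp: strongly_connected_def)
  thus ?thesis by (simp add: reachable_awalk)
qed

lemma graph_dist_le: "awalk u p v \<Longrightarrow> graph_dist G u v \<le> length p"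
  unfolding graph_dist_def by (rule Least_le) blast

lemma graph_dist_awalk:
  assumes "awalk u q v" shows "\<exists>p. awalk u p v \<and> length p = graph_dist G u v"
  unfolding graph_dist_def by (rule LeastI_ex) (use assms in blast)

end

text \<open>
  Walks matter only through reversal (symmetry of the distance), concatenation (triangle
  inequality) and removal of the last arc (predecessors).
\<close>

lemma distance_regular_drg:
  fixes G :: "'a pair_pre_digraph"
  assumes dr: "distance_regular G" and reg: "regular_of_valency G k" and k: "k > 2"
    and diam: "graph_diameter G = D" and D: "D \<ge> 3"
  shows "\<exists>b c. drg (pverts G) (neighbours G) (graph_dist G) b c k D"
proof -
  interpret pair_graph G using dr by (simp add: distance_regular_def)
  have con: "Digraph_Component.connected (with_proj G)" using dr by (simp add: distance_regular_def)
  note walk = connected_awalk[OF con]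
  have dist_awalk: "\<exists>p. awalk u p v \<and> length p = graph_dist G u v" if "u \<in> pverts G" "v \<in> pverts G" for u v
    using walk[OF that] graph_dist_awalk by blast
  define Ds where "Ds = {graph_dist G u v | u v. u \<in> pverts G \<and> v \<in> pverts G}"
  have Ds_eq: "Ds = (\<lambda>(u, v). graph_dist G u v) ` (pverts G \<times> pverts G)" by (auto simp: Ds_def)
  have fDs: "finite Ds" unfolding Ds_eq using pair_finite_verts by simp
  have D_max: "D = Max Ds" using diam by (simp add: graph_diameter_def Ds_def)
  have le_D: "graph_dist G u v \<le> D" if "u \<in> pverts G" "v \<in> pverts G" for u v
    unfolding D_max using fDs that by (intro Max_ge) (auto simp: Ds_def)
  have "pverts G \<noteq> {}" using con by (auto simp: connected_conv)
  hence "Ds \<noteq> {}" by (auto simp: Ds_def)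
  hence "D \<in> Ds" unfolding D_max using fDs by (rule Max_in[rotated])
  hence D_ex: "\<exists>u\<in>pverts G. \<exists>v\<in>pverts G. graph_dist G u v = D" by (auto simp: Ds_def)
  obtain b c where bc: "\<forall>i \<le> graph_diameter G. \<forall>x \<in> pverts G. \<forall>y \<in> pverts G.
        graph_dist G x y = i \<longrightarrow>
          card {z \<in> neighbours G y. graph_dist G x z + 1 = i} = c i \<and>
          card {z \<in> neighbours G y. graph_dist G x z = i + 1} = b i"
    using dr by (auto simp: distance_regular_def)
  have zero: "graph_dist G x y = 0 \<longleftrightarrow> x = y" if "x \<in> pverts G" "y \<in> pverts G" for x y
  proof
    assume "graph_dist G x y = 0"
    thus "x = y" using dist_awalk[OF that] by (auto simp: awalk_Nil_iff)
  next
    assume "x = y"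
    hence "awalk x [] y" using that by (simp add: awalk_Nil_iff)
    from graph_dist_le[OF this] show "graph_dist G x y = 0" by simp
  qed
  have sym_le: "graph_dist G x y \<le> graph_dist G y x" if "x \<in> pverts G" "y \<in> pverts G" for x y
    using dist_awalk[OF that(2,1)] awalk_reverse graph_dist_le by metis
  have "drg (pverts G) (neighbours G) (graph_dist G) b c k D"
  proof
    show "finite (pverts G)" by (rule pair_finite_verts)
    show "y \<in> pverts G" if "y \<in> neighbours G x" for x y
      using that in_arcsD2 by (auto simp: neighbours_def)
    show "graph_dist G x y = 0 \<longleftrightarrow> x = y" if "x \<in> pverts G" "y \<in> pverts G" for x y
      by (rule zero[OF that])
    show "graph_dist G x y = graph_dist G y x" if "x \<in> pverts G" "y \<in> pverts G" for x y
      using sym_le that by (simp add: antisym)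
    show "graph_dist G x z \<le> graph_dist G x y + graph_dist G y z"
      if V: "x \<in> pverts G" "y \<in> pverts G" "z \<in> pverts G" for x y z
    proof -
      obtain p q where "awalk x p y" "length p = graph_dist G x y" "awalk y q z" "length q = graph_dist G y z"
        using dist_awalk V by meson
      thus ?thesis using graph_dist_le[OF awalk_concat, of x p y q z] by simp
    qed
    show "y \<in> neighbours G x \<longleftrightarrow> graph_dist G x y = 1" if V: "x \<in> pverts G" "y \<in> pverts G" for x y
    proof
      assume "y \<in> neighbours G x"
      hence e: "(x, y) \<in> parcs G" by (simp add: neighbours_def)
      have "awalk x [(x, y)] y" using e V by (simp add: awalk_Cons_iff awalk_Nil_iff)
      from graph_dist_le[OF this] have "graph_dist G x y \<le> 1" by simp
      moreover have "x \<noteq> y" using pair_no_loops[OF e] by simp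
      hence "graph_dist G x y \<noteq> 0" using zero[OF V] by simp
      ultimately show "graph_dist G x y = 1" by simp
    next
      assume "graph_dist G x y = 1"
      then obtain p where "awalk x p y" "length p = Suc 0" using dist_awalk[OF V] by auto
      then obtain e where "awalk x [e] y" by (auto simp: length_Suc_conv)
      thus "y \<in> neighbours G x" by (cases e) (auto simp: awalk_Cons_iff awalk_Nil_iff neighbours_def)
    qed
    show "\<exists>z\<in>neighbours G y. graph_dist G x z = i" 
      if V: "x \<in> pverts G" "y \<in> pverts G" and i: "graph_dist G x y = Suc i" for x y i
    proof -
      obtain p where p: "awalk x p y" "length p = Suc i" using dist_awalk[OF V] i by auto
      then obtain p' e where pe: "p = p' @ [e]" by (metis length_Suc_conv_rev)
      define z where "z = awlast x p'"
      have w: "awalk x p' z" "awalk z [e] y" using p pe by (auto simp: z_def)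
      have e: "(z, y) \<in> parcs G" using w(2) by (cases e) (auto simp: awalk_Cons_iff awalk_Nil_iff)
      have zV: "z \<in> pverts G" using e by (rule in_arcsD1)
      have "graph_dist G x z \<le> i" using graph_dist_le[OF w(1)] p pe by simp
      moreover obtain r where r: "awalk x r z" "length r = graph_dist G x z" using dist_awalk[OF V(1) zV] by auto
      have "graph_dist G x y \<le> Suc (graph_dist G x z)" using graph_dist_le[OF awalk_snoc[OF r(1) e]] r(2) by simp
      ultimately have "graph_dist G x z = i" using i by simp
      moreover have "z \<in> neighbours G y" using graph_symmetric[of z y] e by (simp add: neighbours_def)
      ultimately show ?thesis by blast
    qed
    show "graph_dist G x y \<le> D" if "x \<in> pverts G" "y \<in> pverts G" for x y
      by (rule le_D[OF that])
    show "\<exists>x\<in>pverts G. \<exists>y\<in>pverts G. graph_dist G x y = D" by (rule D_ex)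
    show "card {z \<in> neighbours G y. graph_dist G x z + 1 = graph_dist G x y} = c (graph_dist G x y)"
      "card {z \<in> neighbours G y. graph_dist G x z = graph_dist G x y + 1} = b (graph_dist G x y)"
      if "x \<in> pverts G" "y \<in> pverts G" for x y
      using bc le_D[OF that] that diam by auto
    show "card (neighbours G x) = k" if "x \<in> pverts G" for x
      using reg that by (simp add: regular_of_valency_def)
  qed (use k D in auto)
  thus ?thesis by blast
qed

theorem theorem2:
  fixes G :: "'a pair_pre_digraph" and k D :: nat
  assumes "distance_regular G"
    and "regular_of_valency G k" and "k > 2"
    and "graph_diameter G = D" and "D \<ge> 3"
  shows "(MAX j \<in> {1..D}. resistance_at_dist G j) = resistance_at_dist G D \<and>
         resistance_at_dist G D < (1 + 6 / real k) * resistance_at_dist G 1"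
proof -
  obtain b c where "drg (pverts G) (neighbours G) (graph_dist G) b c k D"
    using distance_regular_drg[OF assms] by blast
  then interpret drg "pverts G" "neighbours G" "graph_dist G" b c k D .
  define R where "R j = 2 * (psi 0 - psi j) / size_V" for j
  have res: "resistance G u v = R (graph_dist G u v)" if "u \<in> pverts G" "v \<in> pverts G" "u \<noteq> v" for u v
    unfolding resistance_def harmonic_at_def R_def resistance_iff[OF that] by simp
  have res_at: "resistance_at_dist G j = R j" if j: "j \<in> {1..D}" for j
  proof -
    have eq: "resistance G u v = R j" if "u \<in> pverts G" "v \<in> pverts G" "graph_dist G u v = j" for u v
      using res[OF that(1,2)] that dist0[OF that(1,2)] j by auto
    obtain x y where "x \<in> pverts G" "y \<in> pverts G" "graph_dist G x y = j" using vertex_pair_ex[of j] j by auto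
    thus ?thesis unfolding resistance_at_dist_def using eq by (intro the_equality) (blast, metis)
  qed
  have mono: "R j \<le> R D" if "j \<in> {1..D}" for j
    using psi_decr[of j D] that size_V_pos by (cases "j = D") (auto simp: R_def divide_right_mono)
  have "(MAX j\<in>{1..D}. resistance_at_dist G j) = (MAX j\<in>{1..D}. R j)"
    by (intro arg_cong[where f = Max] image_cong) (use res_at in auto)
  also have "\<dots> = R D" using mono D_ge by (intro Max_eqI) auto
  finally have max: "(MAX j\<in>{1..D}. resistance_at_dist G j) = R D" .
  have "2 * (psi 0 - psi D) / size_V < 2 * ((1 + 6 / k) * (psi 0 - psi 1)) / size_V"
    using target size_V_pos by (intro divide_strict_right_mono) auto
  moreover have "2 * (A * x) / size_V = A * (2 * x / size_V)" for A x by simp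
  ultimately have "R D < (1 + 6 / real k) * R 1" unfolding R_def by simp
  thus ?thesis using max res_at[of D] res_at[of 1] D_ge by simp
qed

end
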